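(* Let $G$ be a nonlinearity satisfying (S1)–(S3), let $\mathcal K=\partial_xP(-\partial_x^2)$ be a multiplier such that the quadratic part $G_2$ and the cubic part $G_3$ of $G$ are derivative-free for $\mathcal K$, and fix an integer $m_c\ge1$ with $$P(m_c^2)\,P(4m_c^2)\neq0.\qquad(\ast)$$ Then the following are equivalent: (i) $G_2$ and $G_3$ are variational for $\mathcal K$; (ii) $\xi_R=0$ for every $L_\lambda$ admissible for $G$ with critical wavenumber $m_c$. Without $(\ast)$, (ii) does not imply (i) (that is, the implication (ii)$\Rightarrow$(i) can fail when all hypotheses except $(\ast)$ hold).
   Context: **Setting.** $\mathbb T=\mathbb R/2\pi\mathbb Z$. Consider $\partial_tU=L_\lambda U+G(U)$ for real mean-zero $U=(U_1,U_2)^T=(u,v)^T$ on $\mathbb T$. $O(2)$ acts by translations and by the reflection $(RU)(x)=R_0U(-x)$, $R_0=\operatorname{diag}(1,-1)$. Put $S=\begin{pmatrix}0&1\\1&0\end{pmatrix}$ and $\langle U,V\rangle_{L^2}=\int_0^{2\pi}U\cdot\overline V\,dx$. A differential polynomial is a polynomial with constant real coefficients in the components of $U$ and finitely many of their $x$-derivatives. **Assumption S (nonlinearity).** $G$ has real coefficients, $G(0)=DG(0)=0$; (S1) $G$ is a differential polynomial; (S2) $G$ is $O(2)$-equivariant; (S3) $G=\partial_xf$ is conservative ($f$ a differential polynomial); (S4) $r_G\le2m_L-1$, where $r_G$ is the highest derivative order appearing in $G$ ($r_G=0$ if $G\equiv0$). Write $G=G_2+G_3+\cdots$ with $G_j$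 homogeneous of degree $j$. **Assumption D (linear part), for given $\lambda_c\in\mathbb R$.** For $\lambda$ near $\lambda_c$, $(L_\lambda)_{ab}=\sum_{k=0}^{2m_L}c^{ab}_k(\lambda)\partial_x^k$, $a,b\in\{1,2\}$, with real coefficients depending smoothly on $\lambda$ and $m_L\ge1$ least such; (D1) $L_\lambda$ is $O(2)$-equivariant; (D2) $c^{11}_{2m_L}c^{22}_{2m_L}\ne0$ and $c^{12}_{2m_L}=c^{21}_{2m_L}=0$; (D3) $r_\lambda\le2m_L-1$, where $r_\lambda=\max\{k:\partial_\lambda c_k^{ab}\not\equiv0\text{ near }\lambda_c\text{ for some }a,b\}$. **Assumption H (simple $O(2)$-Hopf crossing at $\lambda_c$ with critical wavenumber $m_c$).** Let $M_m(\lambda)$ be the $2\times2$ Fourier symbol of $L_\lambda$ ($\partial_x\mapsto im$). (H1) $\operatorname{tr}M_{m_c}(\lambda_c)=0$ and $\det M_m(\lambda_c)>0$ for all $m\ne0$; (H2) $\frac{d}{d\lambda}\operatorname{tr}M_{m_c}(\lambda_c)\neq0$; (H3) $\operatorname{tr}M_m(\lambda_c)<0$ for $m\in\mathbb Z\setminus\{0,\pm m_c\}$; (H4) $\liminf_{|m|\to\infty}\det M_m(\lambda_c)/|\operatorname{tr}M_m(\lambda_c)|>0$. $L_\lambda$ is *admissible for $G$* with critical wavenumber $m_c$ if D, S and H hold (for some critical parameter $\lambda_c$). **Multipliers, fluxes, variationality.** A *multiplier* is $\mathcal K=\partial_xP(-\partial_x^2)$ with $P$ a nonzero real polynomial. A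 flux of $G_j$ for $\mathcal K$ is a homogeneous differential polynomial map $F_j$ of degree $j$ with $G_j=\mathcal KF_j$. $G_j$ is *derivative-free* for $\mathcal K$ if $G_j=\mathcal KF_j$ with $F_j$ a homogeneous polynomial map of degree $j$ in $U$ alone. A homogeneous local Hamiltonian of degree $n$ is $\mathsf H_n(U)=\int_{\mathbb T}H_n(U,\partial_xU,\dots,\partial_x^rU)\,dx$ with $r\ge0$ an integer and $H_n$ a real homogeneous polynomial of total degree $n$; it is $R$-invariant if $\mathsf H_n(RU)=\mathsf H_n(U)$. Its variational derivative is defined by $D\mathsf H_n(U)[W]=\int_{\mathbb T}\frac{\delta\mathsf H_n}{\delta U}(U)\cdot W\,dx$ for all smooth $2\pi$-periodic $W$. $F_j$, and hence $G_j$, is *variational* (for $\mathcal K$) if $F_j=S\,\delta\mathsf H_{j+1}/\delta U$, $G_j=S\mathcal K\,\delta\mathsf H_{j+1}/\delta U$ for some $R$-invariant homogeneous local Hamiltonian $\mathsf H_{j+1}$ of degree $j+1$. **Critical data.** Write $M_m=M_m(\lambda_c)$, $\omega_c=\sqrt{\det M_{m_c}}>0$. $M_{m_c}$ has simple eigenvalues $\pm i\omega_c$. Let $\mathbf q=(u_c,v_c)^T$ be an eigenvector of $M_{m_c}$ for $i\omega_c$ and $\mathbf q_B=-R_0\overline{\mathbf q}$, an eigenvector for $-i\omega_c$; $r_c=\operatorname{Re}(u_c\overline{v_c})\neq0$. Put $\mathcal P_1F=\langle F,e^{im_cx}\mathbf q_1^*\rangle_{L^2}$ with $\mathbf q_1^*=S\mathbf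 q/(4\pi r_c)$ (equivalently $\mathbf q\cdot\overline{\mathbf q_1^*}=\frac1{2\pi}$, $\mathbf q_B\cdot\overline{\mathbf q_1^*}=0$), and $$\psi_c=Ae^{im_cx}\mathbf q+Be^{im_cx}\mathbf q_B+\overline Ae^{-im_cx}\overline{\mathbf q}+\overline Be^{-im_cx}\overline{\mathbf q_B}.$$ **Cubic coefficient $\xi$ (at $\lambda=\lambda_c$).** $[\mathfrak m]$ extracts the total coefficient of a monomial $\mathfrak m$ in $A,B,\overline A,\overline B$. Put $m_A=m_B=m_c$, $m_{\overline A}=m_{\overline B}=-m_c$, $\beta_A=\beta_{\overline B}=i\omega_c$, $\beta_B=\beta_{\overline A}=-i\omega_c$, $m_{XY}=m_X+m_Y$, $\beta_{XY}=\beta_X+\beta_Y$. The quadratic center-manifold part is $h_2=\sum_{XY}\Phi_{XY}e^{im_{XY}x}XY$ (sum over quadratic monomials), where $\Phi_{XY}=0$ if $m_{XY}=0$ and otherwise $(\beta_{XY}I-M_{m_{XY}})\Phi_{XY}=\hat g_{XY}$ with $\hat g_{XY}e^{im_{XY}x}=[XY]G_2(\psi_c)$. Then $\xi=\hat s_{1,2}+\hat c_{1,2}$ with $\hat s_{1,2}=\mathcal P_1([AB\overline B]G_3(\psi_c))$ and $\hat c_{1,2}=\mathcal P_1([AB\overline B](DG_2(\psi_c)h_2))$, and $\xi_R=\operatorname{Re}\xi$. (It is the coefficient of $Z_1|Z_2|^2$ in the $Z_1$-equation of the $O(2)$-Hopf normal form.) *)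

theory Defs
  imports "HOL-Analysis.Analysis" "HOL-Library.Poly_Mapping" "HOL-Computational_Algebra.Polynomial"
begin

definition smooth_periodic :: "(real \<Rightarrow> real^2) set" where
  "smooth_periodic = {U.
     (\<forall>b n x. (deriv ^^ n) (\<lambda>y. U y $ b) differentiable (at x)) \<and>
     (\<forall>x. U (x + 2 * pi) = U x)}"

definition phase_space :: "(real \<Rightarrow> real^2) set" where
  "phase_space = {U \<in> smooth_periodic. \<forall>b. integral {0..2*pi} (\<lambda>x. U x $ b) = 0}"

definition R0 :: "'a::ring_1^2^2" where
  "R0 = vector [vector [1, 0], vector [0, -1]]"

definition Smat :: "'a::ring_1^2^2" where
  "Smat = vector [vector [0, 1], vector [1, 0]]"

definition translate :: "real \<Rightarrow> (real \<Rightarrow> real^2) \<Rightarrow> real \<Rightarrow> real^2" where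
  "translate s U = (\<lambda>x. U (x + s))"

definition reflect :: "(real \<Rightarrow> real^2) \<Rightarrow> real \<Rightarrow> real^2" where
  "reflect U = (\<lambda>x. R0 *v U (- x))"

definition O2_equivariant :: "((real \<Rightarrow> real^2) \<Rightarrow> real \<Rightarrow> real^2) \<Rightarrow> bool" where
  "O2_equivariant N \<longleftrightarrow> (\<forall>U\<in>phase_space.
     (\<forall>s. N (translate s U) = translate s (N U)) \<and> N (reflect U) = reflect (N U))"

text \<open>The variable \<open>(b, k)\<close> stands for the \<open>k\<close>-th \<open>x\<close>-derivative of the component \<open>U $ b\<close>.
  Monomials are finitely supported exponent maps; \<open>*\<close> on polynomials is the
  convolution product of \<^theory>\<open>HOL-Library.Poly_Mapping\<close>.\<close>

type_synonym jet_var = "2 \<times> nat"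
type_synonym dpoly = "(jet_var \<Rightarrow>\<^sub>0 nat) \<Rightarrow>\<^sub>0 real"

definition mdeg :: "('v \<Rightarrow>\<^sub>0 nat) \<Rightarrow> nat" where
  "mdeg m = (\<Sum>i\<in>Poly_Mapping.keys m. Poly_Mapping.lookup m i)"

definition dvars :: "dpoly \<Rightarrow> jet_var set" where
  "dvars p = (\<Union>m\<in>Poly_Mapping.keys p. Poly_Mapping.keys m)"

definition dconst :: "real \<Rightarrow> dpoly" where
  "dconst c = Poly_Mapping.single 0 c"

definition dvar :: "jet_var \<Rightarrow> dpoly" where
  "dvar i = Poly_Mapping.single (Poly_Mapping.single i 1) 1"

definition homogeneous :: "nat \<Rightarrow> dpoly \<Rightarrow> bool" where
  "homogeneous j p \<longleftrightarrow> (\<forall>m\<in>Poly_Mapping.keys p. mdeg m = j)"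

definition hom_part :: "nat \<Rightarrow> dpoly^2 \<Rightarrow> dpoly^2" where
  "hom_part j G = (\<chi> a. \<Sum>m | m \<in> Poly_Mapping.keys (G $ a) \<and> mdeg m = j.
                          Poly_Mapping.single m (Poly_Mapping.lookup (G $ a) m))"

text \<open>Evaluation in a commutative algebra, with coefficients embedded by \<open>c\<close> and the jet
  variables replaced by \<open>w\<close>. It is used for jets of real functions and for jets whose entries are
  polynomials in the amplitudes.\<close>

definition deval :: "(real \<Rightarrow> 'b::comm_semiring_1) \<Rightarrow> (jet_var \<Rightarrow> 'b) \<Rightarrow> dpoly \<Rightarrow> 'b" where
  "deval c w p = (\<Sum>m\<in>Poly_Mapping.keys p. c (Poly_Mapping.lookup p m) *
                    (\<Prod>i\<in>Poly_Mapping.keys m. w i ^ Poly_Mapping.lookup m i))"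

definition dpderiv :: "jet_var \<Rightarrow> dpoly \<Rightarrow> dpoly" where
  "dpderiv i p = (\<Sum>m\<in>Poly_Mapping.keys p.
     Poly_Mapping.single (m - Poly_Mapping.single i 1)
       (of_nat (Poly_Mapping.lookup m i) * Poly_Mapping.lookup p m))"

text \<open>The derivative \<open>Dp(w)[h]\<close> at the jet \<open>w\<close> in the direction of the jet \<open>h\<close>.\<close>

definition dlin :: "(real \<Rightarrow> 'b::comm_semiring_1) \<Rightarrow> (jet_var \<Rightarrow> 'b) \<Rightarrow> (jet_var \<Rightarrow> 'b) \<Rightarrow> dpoly \<Rightarrow> 'b" where
  "dlin c w h p = (\<Sum>i\<in>dvars p. deval c w (dpderiv i p) * h i)"

text \<open>The action of \<open>\<partial>\<^sub>x\<close> on differential polynomials, by the chain rule.\<close>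

definition Dx :: "dpoly \<Rightarrow> dpoly" where
  "Dx p = (\<Sum>i\<in>dvars p. dpderiv i p * dvar (fst i, Suc (snd i)))"

definition jet :: "(real \<Rightarrow> real^2) \<Rightarrow> real \<Rightarrow> jet_var \<Rightarrow> real" where
  "jet U x = (\<lambda>(b, k). (deriv ^^ k) (\<lambda>y. U y $ b) x)"

definition dop :: "dpoly^2 \<Rightarrow> (real \<Rightarrow> real^2) \<Rightarrow> real \<Rightarrow> real^2" where
  "dop G U = (\<lambda>x. \<chi> a. deval id (jet U x) (G $ a))"

text \<open>The highest derivative order appearing in \<open>G\<close>, and \<open>0\<close> if there is no variable at all.\<close>

definition dorder :: "dpoly^2 \<Rightarrow> nat" where
  "dorder G = Max (insert 0 {k. \<exists>a b. (b, k) \<in> dvars (G $ a)})"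

text \<open>The bound on the order of \<open>G\<close> involves \<open>L\<^sub>\<lambda>\<close> and is therefore part of
  \<open>admissible_at\<close> below.\<close>

definition nonlinearity :: "dpoly^2 \<Rightarrow> bool" where
  "nonlinearity G \<longleftrightarrow>
     (\<forall>a. deval id (\<lambda>_. 0) (G $ a) = 0) \<and>
     (\<forall>a h. dlin id (\<lambda>_. 0) h (G $ a) = 0) \<and>
     O2_equivariant (dop G) \<and>
     (\<exists>f :: dpoly^2. G = (\<chi> a. Dx (f $ a)))"

text \<open>The multiplier \<open>\<partial>\<^sub>x P(-\<partial>\<^sub>x\<^sup>2)\<close>, applied componentwise.\<close>

definition multiplier :: "real poly \<Rightarrow> dpoly^2 \<Rightarrow> dpoly^2" where
  "multiplier P F = (\<chi> a. Dx (\<Sum>k\<le>degree P. dconst (coeff P k * (-1) ^ k) * (Dx ^^ (2 * k)) (F $ a)))"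

definition is_flux :: "real poly \<Rightarrow> nat \<Rightarrow> dpoly^2 \<Rightarrow> dpoly^2 \<Rightarrow> bool" where
  "is_flux P j Gj F \<longleftrightarrow> (\<forall>a. homogeneous j (F $ a)) \<and> Gj = multiplier P F"

definition derivative_free :: "real poly \<Rightarrow> nat \<Rightarrow> dpoly^2 \<Rightarrow> bool" where
  "derivative_free P j Gj \<longleftrightarrow>
     (\<exists>F. is_flux P j Gj F \<and> (\<forall>a. dvars (F $ a) \<subseteq> UNIV \<times> {0}))"

definition hamiltonian :: "dpoly \<Rightarrow> (real \<Rightarrow> real^2) \<Rightarrow> real" where
  "hamiltonian H U = integral {0..2*pi} (\<lambda>x. deval id (jet U x) H)"

definition R_invariant :: "dpoly \<Rightarrow> bool" where
  "R_invariant H \<longleftrightarrow> (\<forall>U\<in>phase_space. hamiltonian H (reflect U) = hamiltonian H U)"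

definition is_variational_derivative :: "dpoly \<Rightarrow> dpoly^2 \<Rightarrow> bool" where
  "is_variational_derivative H V \<longleftrightarrow> (\<forall>U\<in>phase_space. \<forall>W\<in>smooth_periodic.
     ((\<lambda>t. hamiltonian H (\<lambda>x. U x + t *\<^sub>R W x)) has_real_derivative
        integral {0..2*pi} (\<lambda>x. dop V U x \<bullet> W x)) (at 0))"

definition variational_flux :: "nat \<Rightarrow> dpoly^2 \<Rightarrow> bool" where
  "variational_flux j F \<longleftrightarrow>
     (\<exists>H V. homogeneous (j + 1) H \<and> R_invariant H \<and> is_variational_derivative H V \<and> F = Smat *v V)"

definition variational :: "real poly \<Rightarrow> nat \<Rightarrow> dpoly^2 \<Rightarrow> bool" where
  "variational P j Gj \<longleftrightarrow> (\<exists>F. is_flux P j Gj F \<and> variational_flux j F)"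

text \<open>A family \<open>L\<^sub>\<lambda>\<close> is given by its matrix of polynomials in \<open>\<partial>\<^sub>x\<close>:
  \<open>coeff (L \<lambda> $ a $ b) k\<close> is \<open>c\<^sup>a\<^sup>b\<^sub>k(\<lambda>)\<close>. Only its germ at the critical parameter matters.\<close>

type_synonym lin_family = "real \<Rightarrow> real poly^2^2"

definition lin_op :: "real poly^2^2 \<Rightarrow> (real \<Rightarrow> real^2) \<Rightarrow> real \<Rightarrow> real^2" where
  "lin_op N U = (\<lambda>x. \<chi> a. \<Sum>b\<in>UNIV. \<Sum>k\<le>degree (N $ a $ b).
                   coeff (N $ a $ b) k * (deriv ^^ k) (\<lambda>y. U y $ b) x)"

definition symbol :: "real poly^2^2 \<Rightarrow> int \<Rightarrow> complex^2^2" where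
  "symbol N m = (\<chi> a b. poly (map_poly of_real (N $ a $ b)) (\<i> * of_int m))"

definition order_le_near :: "lin_family \<Rightarrow> real \<Rightarrow> nat \<Rightarrow> bool" where
  "order_le_near L lc m \<longleftrightarrow> (\<forall>\<^sub>F l in nhds lc. \<forall>a b. degree (L l $ a $ b) \<le> 2 * m)"

definition half_order :: "lin_family \<Rightarrow> real \<Rightarrow> nat \<Rightarrow> bool" where
  "half_order L lc mL \<longleftrightarrow> mL \<ge> 1 \<and> order_le_near L lc mL \<and>
     (\<forall>m\<ge>1. order_le_near L lc m \<longrightarrow> mL \<le> m)"

text \<open>The highest order whose coefficients depend on the parameter; inserting \<open>0\<close> gives the
  maximum a value when there is no such order.\<close>

definition param_order :: "lin_family \<Rightarrow> real \<Rightarrow> nat" where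
  "param_order L lc = Max (insert 0 {k. \<exists>a b.
     \<not> (\<forall>\<^sub>F l in nhds lc. deriv (\<lambda>l. coeff (L l $ a $ b) k) l = 0)})"

definition linear_part :: "lin_family \<Rightarrow> real \<Rightarrow> nat \<Rightarrow> bool" where
  "linear_part L lc mL \<longleftrightarrow>
     half_order L lc mL \<and>
     (\<forall>\<^sub>F l in nhds lc. \<forall>a b k n.
        (deriv ^^ n) (\<lambda>l. coeff (L l $ a $ b) k) differentiable (at l)) \<and>
     (\<forall>\<^sub>F l in nhds lc. O2_equivariant (lin_op (L l))) \<and>
     (\<forall>\<^sub>F l in nhds lc.
        coeff (L l $ 1 $ 1) (2 * mL) * coeff (L l $ 2 $ 2) (2 * mL) \<noteq> 0 \<and>
        coeff (L l $ 1 $ 2) (2 * mL) = 0 \<and> coeff (L l $ 2 $ 1) (2 * mL) = 0) \<and>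
     param_order L lc \<le> 2 * mL - 1"

text \<open>By \<open>O(2)\<close>-equivariance the diagonal symbols contain only even and the off-diagonal ones only odd
  powers of \<open>\<partial>\<^sub>x\<close>, so trace and determinant of \<open>symbol (L l) m\<close> are real and \<open>Re\<close> below is a mere
  type conversion.\<close>

definition tr_sym :: "real poly^2^2 \<Rightarrow> int \<Rightarrow> real" where
  "tr_sym N m = Re (trace (symbol N m))"

definition det_sym :: "real poly^2^2 \<Rightarrow> int \<Rightarrow> real" where
  "det_sym N m = Re (det (symbol N m))"

definition hopf_crossing :: "lin_family \<Rightarrow> real \<Rightarrow> int \<Rightarrow> bool" where
  "hopf_crossing L lc mc \<longleftrightarrow>
     tr_sym (L lc) mc = 0 \<and> (\<forall>m. m \<noteq> 0 \<longrightarrow> det_sym (L lc) m > 0) \<and>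
     deriv (\<lambda>l. tr_sym (L l) mc) lc \<noteq> 0 \<and>
     (\<forall>m. m \<notin> {0, mc, -mc} \<longrightarrow> tr_sym (L lc) m < 0) \<and>
     Liminf (filtercomap (\<lambda>m::int. \<bar>m\<bar>) at_top)
       (\<lambda>m. ereal (det_sym (L lc) m / \<bar>tr_sym (L lc) m\<bar>)) > 0"

definition admissible_at :: "dpoly^2 \<Rightarrow> int \<Rightarrow> lin_family \<Rightarrow> real \<Rightarrow> bool" where
  "admissible_at G mc L lc \<longleftrightarrow> nonlinearity G \<and>
     (\<exists>mL. linear_part L lc mL \<and> dorder G \<le> 2 * mL - 1) \<and> hopf_crossing L lc mc"

datatype amp = AmpA | AmpB | AmpAbar | AmpBbar

instance amp :: finite
proof
  have "(UNIV :: amp set) = {AmpA, AmpB, AmpAbar, AmpBbar}"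
    using amp.exhaust by auto
  then show "finite (UNIV :: amp set)"
    by (metis finite.emptyI finite.insertI)
qed

text \<open>Polynomials in the formally independent amplitudes \<open>A, B\<close> and their conjugates.\<close>

type_synonym amp_mono = "amp \<Rightarrow>\<^sub>0 nat"
type_synonym amp_poly = "amp_mono \<Rightarrow>\<^sub>0 complex"

definition cvec :: "complex^2 \<Rightarrow> complex^2" where
  "cvec v = (\<chi> a. cnj (v $ a))"

definition inner_L2 :: "(real \<Rightarrow> complex^2) \<Rightarrow> (real \<Rightarrow> complex^2) \<Rightarrow> complex" where
  "inner_L2 U V = integral {0..2*pi} (\<lambda>x. \<Sum>a\<in>UNIV. U x $ a * cnj (V x $ a))"

definition omega_c :: "real poly^2^2 \<Rightarrow> int \<Rightarrow> real" where
  "omega_c N mc = sqrt (det_sym N mc)"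

definition critical_eigenvector :: "real poly^2^2 \<Rightarrow> int \<Rightarrow> complex^2 \<Rightarrow> bool" where
  "critical_eigenvector N mc q \<longleftrightarrow>
     q \<noteq> 0 \<and> symbol N mc *v q = (\<i> * of_real (omega_c N mc)) *s q"

definition qB :: "complex^2 \<Rightarrow> complex^2" where
  "qB q = - (R0 *v cvec q)"

definition r_c :: "complex^2 \<Rightarrow> real" where
  "r_c q = Re (q $ 1 * cnj (q $ 2))"

definition q1star :: "complex^2 \<Rightarrow> complex^2" where
  "q1star q = of_real (1 / (4 * pi * r_c q)) *s (Smat *v q)"

definition Proj1 :: "int \<Rightarrow> complex^2 \<Rightarrow> (real \<Rightarrow> complex^2) \<Rightarrow> complex" where
  "Proj1 mc q F = inner_L2 F (\<lambda>x. exp (\<i> * of_int mc * of_real x) *s q1star q)"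

primrec amp_sign :: "amp \<Rightarrow> int" where
  "amp_sign AmpA = 1" | "amp_sign AmpB = 1" | "amp_sign AmpAbar = -1" | "amp_sign AmpBbar = -1"

primrec amp_beta :: "real \<Rightarrow> amp \<Rightarrow> complex" where
  "amp_beta w AmpA = \<i> * of_real w" | "amp_beta w AmpB = - \<i> * of_real w"
| "amp_beta w AmpAbar = - \<i> * of_real w" | "amp_beta w AmpBbar = \<i> * of_real w"

primrec amp_vec :: "complex^2 \<Rightarrow> amp \<Rightarrow> complex^2" where
  "amp_vec q AmpA = q" | "amp_vec q AmpB = qB q"
| "amp_vec q AmpAbar = cvec q" | "amp_vec q AmpBbar = cvec (qB q)"

text \<open>Additive extensions to monomials: for \<open>XY\<close> these are \<open>m\<^sub>X + m\<^sub>Y\<close> and \<open>\<beta>\<^sub>X + \<beta>\<^sub>Y\<close>.\<close>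

definition mono_wave :: "int \<Rightarrow> amp_mono \<Rightarrow> int" where
  "mono_wave mc \<mu> = (\<Sum>X\<in>UNIV. int (Poly_Mapping.lookup \<mu> X) * (amp_sign X * mc))"

definition mono_beta :: "real \<Rightarrow> amp_mono \<Rightarrow> complex" where
  "mono_beta w \<mu> = (\<Sum>X\<in>UNIV. of_nat (Poly_Mapping.lookup \<mu> X) * amp_beta w X)"

text \<open>The jet at \<open>x\<close> of a finite sum of terms \<open>\<Phi> e\<^sup>i\<^sup>m\<^sup>x \<mu>\<close> over a set of amplitude monomials \<open>\<mu>\<close>, where
  \<open>m\<close> is the wavenumber of \<open>\<mu>\<close>.\<close>

definition mode_jet :: "int \<Rightarrow> amp_mono set \<Rightarrow> (amp_mono \<Rightarrow> complex^2) \<Rightarrow> real \<Rightarrow> jet_var \<Rightarrow> amp_poly" where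
  "mode_jet mc Ms \<Phi> x = (\<lambda>(b, k). \<Sum>\<mu>\<in>Ms. Poly_Mapping.single \<mu>
     ((\<i> * of_int (mono_wave mc \<mu>)) ^ k * exp (\<i> * of_int (mono_wave mc \<mu>) * of_real x) * \<Phi> \<mu> $ b))"

definition psi_jet :: "int \<Rightarrow> complex^2 \<Rightarrow> real \<Rightarrow> jet_var \<Rightarrow> amp_poly" where
  "psi_jet mc q x = (\<lambda>i. \<Sum>X\<in>UNIV.
     mode_jet mc {Poly_Mapping.single X 1} (\<lambda>_. amp_vec q X) x i)"

definition amp_const :: "real \<Rightarrow> amp_poly" where
  "amp_const c = Poly_Mapping.single 0 (of_real c)"

definition coeff_psi :: "amp_mono \<Rightarrow> dpoly^2 \<Rightarrow> int \<Rightarrow> complex^2 \<Rightarrow> real \<Rightarrow> complex^2" where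
  "coeff_psi \<mu> G mc q x = (\<chi> a. Poly_Mapping.lookup (deval amp_const (psi_jet mc q x) (G $ a)) \<mu>)"

definition ghat :: "dpoly^2 \<Rightarrow> int \<Rightarrow> complex^2 \<Rightarrow> amp_mono \<Rightarrow> complex^2" where
  "ghat G mc q \<mu> = (THE g. \<forall>x. exp (\<i> * of_int (mono_wave mc \<mu>) * of_real x) *s g
                                = coeff_psi \<mu> (hom_part 2 G) mc q x)"

text \<open>At an admissible \<open>L\<^sub>\<lambda>\<close> the linear system below is uniquely solvable.\<close>

definition Phi :: "dpoly^2 \<Rightarrow> real poly^2^2 \<Rightarrow> int \<Rightarrow> complex^2 \<Rightarrow> amp_mono \<Rightarrow> complex^2" where
  "Phi G N mc q \<mu> = (if mono_wave mc \<mu> = 0 then 0 else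
     (THE v. (mat (mono_beta (omega_c N mc) \<mu>) - symbol N (mono_wave mc \<mu>)) *v v = ghat G mc q \<mu>))"

definition h2_jet :: "dpoly^2 \<Rightarrow> real poly^2^2 \<Rightarrow> int \<Rightarrow> complex^2 \<Rightarrow> real \<Rightarrow> jet_var \<Rightarrow> amp_poly" where
  "h2_jet G N mc q = mode_jet mc {\<mu>. mdeg \<mu> = 2} (Phi G N mc q)"

definition mono_ABBbar :: amp_mono where
  "mono_ABBbar = Poly_Mapping.single AmpA 1 + Poly_Mapping.single AmpB 1 + Poly_Mapping.single AmpBbar 1"

definition s12 :: "dpoly^2 \<Rightarrow> int \<Rightarrow> complex^2 \<Rightarrow> complex" where
  "s12 G mc q = Proj1 mc q (coeff_psi mono_ABBbar (hom_part 3 G) mc q)"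

definition c12 :: "dpoly^2 \<Rightarrow> real poly^2^2 \<Rightarrow> int \<Rightarrow> complex^2 \<Rightarrow> complex" where
  "c12 G N mc q = Proj1 mc q (\<lambda>x. \<chi> a. Poly_Mapping.lookup
     (dlin amp_const (psi_jet mc q x) (h2_jet G N mc q x) (hom_part 2 G $ a)) mono_ABBbar)"

definition xi :: "dpoly^2 \<Rightarrow> real poly^2^2 \<Rightarrow> int \<Rightarrow> complex^2 \<Rightarrow> complex" where
  "xi G N mc q = s12 G mc q + c12 G N mc q"

text \<open>The parameter \<open>lc\<close> ranges over all critical parameters of the family and \<open>q\<close> over all
  critical eigenvectors; replacing \<open>q\<close> by \<open>s q\<close> multiplies \<open>xi\<close> by \<open>\<bar>s\<bar>\<^sup>2\<close>.\<close>

definition xi_R_vanishes :: "dpoly^2 \<Rightarrow> int \<Rightarrow> bool" where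
  "xi_R_vanishes G mc \<longleftrightarrow> (\<forall>L lc q. admissible_at G mc L lc \<longrightarrow>
     critical_eigenvector (L lc) mc q \<longrightarrow> Re (xi G (L lc) mc q) = 0)"

end

theory Submission
  imports Defs
begin

text \<open>Reflection parity leaves only \<open>F\<^sub>2 = (a u v, b u\<^sup>2 + c v\<^sup>2)\<close> and
  \<open>F\<^sub>3 = (a' u\<^sup>2 v + b' v\<^sup>3, c' u\<^sup>3 + d' u v\<^sup>2)\<close>, and by symmetry of second derivatives these fluxes are
  variational iff \<open>a = 2 c\<close> and \<open>a' = d'\<close>. Write \<open>\<kappa>\<^sub>m = m P(m\<^sup>2)\<close>, \<open>q = (u, v)\<close>, \<open>r = r\<^sub>c\<close>,
  \<open>J = Im (u cnj v)\<close>, \<open>E = c |v|\<^sup>2 - b |u|\<^sup>2\<close>, and let \<open>\<alpha>, i \<beta>, i \<gamma>, \<delta>\<close> be the entries of the symbol at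
  wavenumber \<open>2 m\<^sub>c\<close> and \<open>\<Delta>\<close> its determinant. Only the mode \<open>AB\<close> of the center manifold contributes to
  \<open>\<xi>\<close>, and with \<open>\<kappa>\<^sub>1\<close>, \<open>\<kappa>\<^sub>2\<close> at the wavenumbers \<open>m\<^sub>c\<close>, \<open>2 m\<^sub>c\<close> one finds
  \<open>\<xi>\<^sub>R = \<kappa>\<^sub>1 / (2 r) * (2 (a' - d') Im ((u cnj v)\<^sup>2) - 2 \<kappa>\<^sub>2 / \<Delta> * (\<gamma> a J + \<alpha> E) (a - 2 c) r)\<close>.
  So \<open>\<xi>\<^sub>R\<close> vanishes in the variational case. Conversely, if \<open>\<kappa>\<^sub>1 \<kappa>\<^sub>2 \<noteq> 0\<close> and \<open>a \<noteq> 2 c\<close>, linear parts with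
  \<open>J = 0\<close> force \<open>b = c = 0\<close>, and then changing only \<open>\<Delta>\<close> gives \<open>a' = d'\<close> and \<open>a = 0\<close>, a contradiction;
  so \<open>a = 2 c\<close>, whence \<open>a' = d'\<close>. If \<open>\<kappa>\<^sub>1 = 0\<close>, then \<open>\<xi>\<^sub>R = 0\<close> for every choice of the fluxes.\<close>

section \<open>Differential polynomials\<close>

lemma poly_mapping_eq_sum_single:
  fixes p :: "'a \<Rightarrow>\<^sub>0 'b::comm_monoid_add"
  assumes "finite K" "Poly_Mapping.keys p \<subseteq> K"
  shows "p = (\<Sum>m\<in>K. Poly_Mapping.single m (Poly_Mapping.lookup p m))"
proof (rule poly_mapping_eqI)
  fix m
  have "(\<Sum>x\<in>K. Poly_Mapping.lookup (Poly_Mapping.single x (Poly_Mapping.lookup p x)) m)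
        = (\<Sum>x\<in>K. if x = m then Poly_Mapping.lookup p m else 0)"
    by (intro sum.cong) (auto simp: lookup_single)
  then show "Poly_Mapping.lookup p m
        = Poly_Mapping.lookup (\<Sum>m\<in>K. Poly_Mapping.single m (Poly_Mapping.lookup p m)) m"
    using assms by (auto simp: lookup_sum in_keys_iff)
qed

lemma poly_mapping_add_induct:
  fixes p :: "'a \<Rightarrow>\<^sub>0 'b::comm_monoid_add"
  assumes "\<And>m c. Q (Poly_Mapping.single m c)" "\<And>p q. Q p \<Longrightarrow> Q q \<Longrightarrow> Q (p + q)"
  shows "Q p"
proof -
  have "Q (\<Sum>m\<in>K. Poly_Mapping.single m (Poly_Mapping.lookup p m))" if "finite K" for K
    using that
  proof (induction K rule: finite_induct)
    case empty
    show ?case using assms(1)[of undefined 0] by simp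
  next
    case (insert x F)
    then show ?case using assms by simp
  qed
  from this[of "Poly_Mapping.keys p"] show ?thesis
    by (simp flip: poly_mapping_eq_sum_single)
qed

lemma mdeg_superset:
  "finite K \<Longrightarrow> Poly_Mapping.keys m \<subseteq> K \<Longrightarrow> mdeg m = (\<Sum>i\<in>K. Poly_Mapping.lookup m i)"
  unfolding mdeg_def by (rule sum.mono_neutral_left) (auto simp: in_keys_iff)

lemma mdeg_add: "mdeg (m + n) = mdeg m + mdeg n"
  by (subst (1 2 3) mdeg_superset[of "Poly_Mapping.keys m \<union> Poly_Mapping.keys n"])
    (auto simp: keys_add lookup_add sum.distrib dest: subsetD[OF keys_add])

lemma mdeg_single [simp]: "mdeg (Poly_Mapping.single i k) = k"
  by (simp add: mdeg_def)

lemma mdeg_zero [simp]: "mdeg 0 = 0"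
  by (simp add: mdeg_def)

lemma monomial_split:
  assumes "Poly_Mapping.lookup m i \<noteq> (0::nat)"
  shows "m = Poly_Mapping.single i 1 + (m - Poly_Mapping.single i 1)"
  using assms by (intro poly_mapping_eqI) (auto simp: lookup_add lookup_minus lookup_single when_def)

text \<open>Induction over generators: a monomial is peeled one variable at a time, by induction on
  its degree. Evaluation and derivation identities then need checking only on constants and
  variables.\<close>

lemma dpoly_induct [case_names const var add mult]:
  assumes "\<And>r. Q (dconst r)" "\<And>i. Q (dvar i)"
    "\<And>p q. Q p \<Longrightarrow> Q q \<Longrightarrow> Q (p + q)" "\<And>p q. Q p \<Longrightarrow> Q q \<Longrightarrow> Q (p * q)"
  shows "Q p"
proof (rule poly_mapping_add_induct)
  fix m c
  show "Q (Poly_Mapping.single m c)"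
  proof (induction "mdeg m" arbitrary: m)
    case 0
    then have "m = 0"
      by (auto simp: mdeg_def in_keys_iff intro: poly_mapping_eqI)
    then show ?case
      using assms(1)[of c] by (simp add: dconst_def)
  next
    case (Suc n)
    then obtain i where i: "Poly_Mapping.lookup m i \<noteq> 0"
      by (metis mdeg_def nat.distinct(1) sum.neutral)
    let ?m = "m - Poly_Mapping.single i 1"
    have "mdeg ?m = n"
      using mdeg_add[of "Poly_Mapping.single i 1" ?m] monomial_split[OF i] Suc(2) by simp
    then have "Q (dvar i * Poly_Mapping.single ?m c)"
      using assms Suc(1) by simp
    also have "dvar i * Poly_Mapping.single ?m c = Poly_Mapping.single m c"
      using monomial_split[OF i] by (simp add: dvar_def mult_single)
    finally show ?case .
  qed
qed (use assms in auto)

definition monom_eval :: "(jet_var \<Rightarrow> 'b::comm_semiring_1) \<Rightarrow> (jet_var \<Rightarrow>\<^sub>0 nat) \<Rightarrow> 'b" where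
  "monom_eval w m = (\<Prod>i\<in>Poly_Mapping.keys m. w i ^ Poly_Mapping.lookup m i)"

lemma monom_eval_superset:
  "finite K \<Longrightarrow> Poly_Mapping.keys m \<subseteq> K \<Longrightarrow>
    monom_eval w m = (\<Prod>i\<in>K. w i ^ Poly_Mapping.lookup m i)"
  unfolding monom_eval_def by (rule prod.mono_neutral_left) (auto simp: in_keys_iff)

lemma monom_eval_add: "monom_eval w (m + n) = monom_eval w m * monom_eval w n"
  by (subst (1 2 3) monom_eval_superset[of "Poly_Mapping.keys m \<union> Poly_Mapping.keys n"])
    (auto simp: lookup_add power_add prod.distrib dest: subsetD[OF keys_add])

lemma monom_eval_scale:
  "monom_eval (\<lambda>i. t * w i) m = t ^ mdeg m * monom_eval w m"
  by (simp add: monom_eval_def mdeg_def power_mult_distrib prod.distrib power_sum)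

lemma dvars_add: "dvars (p + q) \<subseteq> dvars p \<union> dvars q"
  using keys_add[of p q] by (fastforce simp: dvars_def)

lemma dvars_mult: "dvars (p * q) \<subseteq> dvars p \<union> dvars q"
proof
  fix i assume "i \<in> dvars (p * q)"
  then obtain m where m: "m \<in> Poly_Mapping.keys (p * q)" "i \<in> Poly_Mapping.keys m"
    by (auto simp: dvars_def)
  then obtain m1 m2 where "m = m1 + m2" "m1 \<in> Poly_Mapping.keys p" "m2 \<in> Poly_Mapping.keys q"
    using keys_mult[of p q] by fastforce
  then show "i \<in> dvars p \<union> dvars q"
    using m(2) keys_add[of m1 m2] by (fastforce simp: dvars_def)
qed

lemma finite_dvars [simp]: "finite (dvars p)"
  by (simp add: dvars_def)

lemma dvars_dconst [simp]: "dvars (dconst r) = {}"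
  by (auto simp: dvars_def dconst_def split: if_splits)

lemma dvars_dvar [simp]: "dvars (dvar i) = {i}"
  by (auto simp: dvars_def dvar_def)

lemma dpderiv_superset:
  "finite K \<Longrightarrow> Poly_Mapping.keys p \<subseteq> K \<Longrightarrow> dpderiv i p = (\<Sum>m\<in>K.
     Poly_Mapping.single (m - Poly_Mapping.single i 1)
       (of_nat (Poly_Mapping.lookup m i) * Poly_Mapping.lookup p m))"
  unfolding dpderiv_def by (rule sum.mono_neutral_left) (auto simp: in_keys_iff)

lemma dpderiv_add: "dpderiv i (p + q) = dpderiv i p + dpderiv i q"
  by (subst (1 2 3) dpderiv_superset[of "Poly_Mapping.keys p \<union> Poly_Mapping.keys q"])
    (auto simp: lookup_add distrib_left single_add sum.distrib dest: subsetD[OF keys_add])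

lemma dpderiv_single:
  "dpderiv i (Poly_Mapping.single m r)
    = Poly_Mapping.single (m - Poly_Mapping.single i 1) (of_nat (Poly_Mapping.lookup m i) * r)"
  by (simp add: dpderiv_def)

lemma dpderiv_mult: "dpderiv i (p * q) = dpderiv i p * q + p * dpderiv i q"
proof (induction p arbitrary: q rule: poly_mapping_add_induct)
  case (1 m c)
  show ?case
  proof (induction q rule: poly_mapping_add_induct)
    case (1 n d)
    let ?e = "Poly_Mapping.single i (1::nat)"
    \<comment> \<open>Truncated subtraction of exponents misbehaves only when the variable is absent
      from \<open>m\<close>, and then the coefficient is zero.\<close>
    have a: "Poly_Mapping.single (m - ?e + n) (of_nat (Poly_Mapping.lookup m i) * c * d)
        = Poly_Mapping.single (m + n - ?e) (of_nat (Poly_Mapping.lookup m i) * c * d)"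
    proof (cases "Poly_Mapping.lookup m i = 0")
      case False
      then have "m - ?e + n = m + n - ?e"
        by (intro poly_mapping_eqI) (auto simp: lookup_add lookup_minus lookup_single when_def)
      then show ?thesis by simp
    qed simp
    have b: "Poly_Mapping.single (m + (n - ?e)) (c * (of_nat (Poly_Mapping.lookup n i) * d))
        = Poly_Mapping.single (m + n - ?e) (c * (of_nat (Poly_Mapping.lookup n i) * d))"
    proof (cases "Poly_Mapping.lookup n i = 0")
      case False
      then have "m + (n - ?e) = m + n - ?e"
        by (intro poly_mapping_eqI) (auto simp: lookup_add lookup_minus lookup_single when_def)
      then show ?thesis by simp
    qed simp
    show ?case
      unfolding mult_single dpderiv_single a b single_add[symmetric]
      by (simp add: lookup_add algebra_simps)
  next
    case (2 p q)
    then show ?case by (simp add: dpderiv_add algebra_simps)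
  qed
next
  case (2 p p')
  show ?case by (simp only: dpderiv_add distrib_right 2) (simp only: ac_simps)
qed

lemma dpderiv_dconst [simp]: "dpderiv i (dconst r) = 0"
  by (simp add: dconst_def dpderiv_single)

lemma dpderiv_dvar: "dpderiv i (dvar k) = (if i = k then 1 else 0)"
  by (simp add: dvar_def dpderiv_single lookup_single when_def)

lemma dpderiv_eq_0: "i \<notin> dvars p \<Longrightarrow> dpderiv i p = 0"
  unfolding dpderiv_def dvars_def by (rule sum.neutral) (auto simp: in_keys_iff)

text \<open>Three target algebras occur: the reals for jets of functions, \<open>amp_poly\<close>
  for amplitude expansions, and \<open>dpoly\<close> itself for the generic jet
  \<open>dvar\<close>.\<close>

locale coeff_hom =
  fixes c :: "real \<Rightarrow> 'b::comm_ring_1"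
  assumes hom_one: "c 1 = 1"
    and hom_add: "c (x + y) = c x + c y"
    and hom_mult: "c (x * y) = c x * c y"
begin

lemma hom_zero: "c 0 = 0"
  using hom_add[of 0 0] by simp

lemma deval_superset:
  "finite K \<Longrightarrow> Poly_Mapping.keys p \<subseteq> K \<Longrightarrow>
    deval c w p = (\<Sum>m\<in>K. c (Poly_Mapping.lookup p m) * monom_eval w m)"
  unfolding deval_def monom_eval_def
  by (rule sum.mono_neutral_left) (auto simp: in_keys_iff hom_zero)

lemma deval_add: "deval c w (p + q) = deval c w p + deval c w q"
  by (subst (1 2 3) deval_superset[of "Poly_Mapping.keys p \<union> Poly_Mapping.keys q"])
    (auto simp: lookup_add hom_add distrib_right sum.distrib dest: subsetD[OF keys_add])

lemma deval_single: "deval c w (Poly_Mapping.single m r) = c r * monom_eval w m"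
  by (subst deval_superset[of "{m}"]) auto

lemma deval_mult: "deval c w (p * q) = deval c w p * deval c w q"
proof (induction p arbitrary: q rule: poly_mapping_add_induct)
  case (1 m r)
  show ?case
    by (induction q rule: poly_mapping_add_induct)
      (simp_all add: mult_single deval_single hom_mult monom_eval_add deval_add algebra_simps)
qed (simp add: deval_add algebra_simps)

lemma deval_dconst: "deval c w (dconst r) = c r"
  by (simp add: dconst_def deval_single monom_eval_def)

lemma deval_dvar: "deval c w (dvar i) = w i"
  by (simp add: dvar_def deval_single monom_eval_def hom_one)

lemma deval_zero: "deval c w 0 = 0"
  by (simp add: deval_def)

lemma deval_one: "deval c w 1 = 1"
  using deval_dconst[of w 1] by (simp add: dconst_def hom_one)

lemma deval_sum: "deval c w (sum f A) = (\<Sum>a\<in>A. deval c w (f a))"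
  by (induction A rule: infinite_finite_induct) (auto simp: deval_zero deval_add)

lemma deval_power: "deval c w (p ^ n) = deval c w p ^ n"
  by (induction n) (auto simp: deval_one deval_mult)

lemma dlin_superset:
  "finite K \<Longrightarrow> dvars p \<subseteq> K \<Longrightarrow> dlin c w h p = (\<Sum>i\<in>K. deval c w (dpderiv i p) * h i)"
  unfolding dlin_def by (rule sum.mono_neutral_left) (auto simp: dpderiv_eq_0 deval_zero)

lemma dlin_add: "dlin c w h (p + q) = dlin c w h p + dlin c w h q"
  by (subst (1 2 3) dlin_superset[of "dvars p \<union> dvars q"])
    (auto simp: dpderiv_add deval_add distrib_right sum.distrib dest: subsetD[OF dvars_add])

lemma dlin_mult: "dlin c w h (p * q) = dlin c w h p * deval c w q + deval c w p * dlin c w h q"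
proof -
  let ?K = "dvars p \<union> dvars q"
  have "dlin c w h (p * q) = (\<Sum>i\<in>?K. deval c w (dpderiv i (p * q)) * h i)"
    using dvars_mult[of p q] by (intro dlin_superset) auto
  also have "\<dots> = (\<Sum>i\<in>?K. deval c w (dpderiv i p) * h i) * deval c w q
      + deval c w p * (\<Sum>i\<in>?K. deval c w (dpderiv i q) * h i)"
    unfolding sum_distrib_left sum_distrib_right sum.distrib[symmetric]
    by (intro sum.cong refl) (simp add: dpderiv_mult deval_add deval_mult algebra_simps)
  also have "(\<Sum>i\<in>?K. deval c w (dpderiv i p) * h i) = dlin c w h p"
    by (rule dlin_superset[symmetric]) auto
  also have "(\<Sum>i\<in>?K. deval c w (dpderiv i q) * h i) = dlin c w h q"
    by (rule dlin_superset[symmetric]) auto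
  finally show ?thesis .
qed

lemma dlin_dconst: "dlin c w h (dconst r) = 0"
  by (simp add: dlin_def)

lemma dlin_dvar: "dlin c w h (dvar i) = h i"
  by (simp add: dlin_def dpderiv_dvar deval_one)

lemma dlin_zero: "dlin c w h 0 = 0"
  by (simp add: dlin_def dvars_def)

lemma dlin_sum: "dlin c w h (sum f A) = (\<Sum>a\<in>A. dlin c w h (f a))"
  by (induction A rule: infinite_finite_induct) (auto simp: dlin_zero dlin_add)

end

interpretation dpoly_hom: coeff_hom dconst
  by unfold_locales (auto simp: dconst_def single_add mult_single)

interpretation real_hom: coeff_hom "id :: real \<Rightarrow> real"
  by unfold_locales auto

interpretation amp_hom: coeff_hom amp_const
  by unfold_locales (auto simp: amp_const_def single_add mult_single)

lemma dconst_zero [simp]: "dconst 0 = 0"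
  by (simp add: dconst_def)

lemma deval_generic: "deval dconst dvar p = p"
  by (induction p rule: dpoly_induct)
    (simp_all add: dpoly_hom.deval_add dpoly_hom.deval_mult dpoly_hom.deval_dconst dpoly_hom.deval_dvar)

text \<open>The total derivative is the linearization at the generic jet in the direction of the
  shifted jet, so its sum and product rules are those of \<open>dlin\<close>.\<close>

lemma Dx_conv_dlin: "Dx p = dlin dconst dvar (\<lambda>i. dvar (fst i, Suc (snd i))) p"
  by (simp add: Dx_def dlin_def deval_generic)

lemma Dx_add: "Dx (p + q) = Dx p + Dx q"
  by (simp add: Dx_conv_dlin dpoly_hom.dlin_add)

lemma Dx_mult: "Dx (p * q) = Dx p * q + p * Dx q"
  by (simp add: Dx_conv_dlin dpoly_hom.dlin_mult deval_generic)

lemma Dx_dconst [simp]: "Dx (dconst r) = 0"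
  by (simp add: Dx_conv_dlin dpoly_hom.dlin_dconst)

lemma Dx_dvar [simp]: "Dx (dvar i) = dvar (fst i, Suc (snd i))"
  by (simp add: Dx_conv_dlin dpoly_hom.dlin_dvar)

lemma Dx_zero [simp]: "Dx 0 = 0"
  by (simp add: Dx_conv_dlin dpoly_hom.dlin_zero)

text \<open>Transfers \<open>Dx\<close> to a derivation of the target algebra, later
  \<open>wave_deriv\<close>. For jets of functions differentiation is a relation instead of a total
  map, and \<open>deval_jet_Dx\<close> takes this role.\<close>

locale derivation = coeff_hom c for c :: "real \<Rightarrow> 'b::comm_ring_1" +
  fixes \<delta> :: "'b \<Rightarrow> 'b"
  assumes derivation_add: "\<delta> (x + y) = \<delta> x + \<delta> y"
    and derivation_mult: "\<delta> (x * y) = \<delta> x * y + x * \<delta> y"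
    and derivation_const: "\<delta> (c r) = 0"
begin

lemma deval_Dx:
  assumes "\<And>b k. \<delta> (w (b, k)) = w (b, Suc k)"
  shows "deval c w (Dx p) = \<delta> (deval c w p)"
  by (induction p rule: dpoly_induct)
    (auto simp: Dx_add Dx_mult deval_add deval_mult deval_dconst deval_dvar deval_zero
      derivation_add derivation_mult derivation_const assms)

lemma dlin_Dx:
  assumes w: "\<And>b k. \<delta> (w (b, k)) = w (b, Suc k)" and h: "\<And>b k. \<delta> (h (b, k)) = h (b, Suc k)"
  shows "dlin c w h (Dx p) = \<delta> (dlin c w h p)"
  using derivation_const[of 0]
  by (induction p rule: dpoly_induct)
    (auto simp: Dx_add Dx_mult dlin_add dlin_mult dlin_dconst dlin_dvar dlin_zero deval_Dx[OF w]
      derivation_add derivation_mult hom_zero h algebra_simps)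

end

section \<open>Homogeneity and derivative-free polynomials\<close>

lemma homogeneous_dconst: "homogeneous 0 (dconst r)"
  by (auto simp: homogeneous_def dconst_def split: if_splits)

lemma homogeneous_dvar: "homogeneous 1 (dvar i)"
  by (auto simp: homogeneous_def dvar_def split: if_splits)

lemma homogeneous_zero [simp]: "homogeneous j 0"
  by (simp add: homogeneous_def)

lemma homogeneous_add: "homogeneous j p \<Longrightarrow> homogeneous j q \<Longrightarrow> homogeneous j (p + q)"
  using keys_add[of p q] by (auto simp: homogeneous_def)

lemma homogeneous_mult: "homogeneous j p \<Longrightarrow> homogeneous k q \<Longrightarrow> homogeneous (j + k) (p * q)"
  using keys_mult[of p q] by (fastforce simp: homogeneous_def mdeg_add)

lemma homogeneous_sum: "(\<And>a. a \<in> A \<Longrightarrow> homogeneous j (f a)) \<Longrightarrow> homogeneous j (sum f A)"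
  by (induction A rule: infinite_finite_induct) (auto intro: homogeneous_add)

lemma homogeneous_dpderiv:
  assumes "homogeneous (Suc j) p"
  shows "homogeneous j (dpderiv i p)"
  unfolding dpderiv_def
proof (rule homogeneous_sum)
  fix m assume m: "m \<in> Poly_Mapping.keys p"
  show "homogeneous j (Poly_Mapping.single (m - Poly_Mapping.single i 1)
          (of_nat (Poly_Mapping.lookup m i) * Poly_Mapping.lookup p m))"
  proof (cases "Poly_Mapping.lookup m i = 0")
    case False
    have "mdeg (m - Poly_Mapping.single i 1) = j"
      using mdeg_add[of "Poly_Mapping.single i 1" "m - Poly_Mapping.single i 1"]
        monomial_split[OF False] m assms by (simp add: homogeneous_def)
    then show ?thesis
      by (auto simp: homogeneous_def split: if_splits)
  qed simp
qed

lemma homogeneous_Dx: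
  assumes "homogeneous (Suc j) p"
  shows "homogeneous (Suc j) (Dx p)"
  unfolding Dx_def
  using homogeneous_mult[OF homogeneous_dpderiv[OF assms] homogeneous_dvar]
  by (intro homogeneous_sum) simp

lemma homogeneous_scale: "homogeneous j p \<Longrightarrow> homogeneous j (dconst r * p)"
  using homogeneous_mult[OF homogeneous_dconst] by fastforce

lemma homogeneous_multiplier:
  assumes "\<And>a. homogeneous (Suc j) (F $ a)"
  shows "homogeneous (Suc j) (multiplier P F $ a)"
proof -
  have "homogeneous (Suc j) ((Dx ^^ n) (F $ a))" for n
    by (induction n) (auto intro: homogeneous_Dx assms)
  then show ?thesis
    unfolding multiplier_def by (auto intro!: homogeneous_Dx homogeneous_sum homogeneous_scale)
qed

lemma hom_part_homogeneous:
  assumes "\<And>a. homogeneous j (F $ a)"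
  shows "hom_part j F = F" "k \<noteq> j \<Longrightarrow> hom_part k F = 0"
proof -
  have "{m \<in> Poly_Mapping.keys (F $ a). mdeg m = j} = Poly_Mapping.keys (F $ a)" for a
    using assms by (auto simp: homogeneous_def)
  then show "hom_part j F = F"
    by (simp add: hom_part_def vec_eq_iff poly_mapping_eq_sum_single[symmetric])
  show "hom_part k F = 0" if "k \<noteq> j"
  proof -
    have "{m \<in> Poly_Mapping.keys (F $ a). mdeg m = k} = {}" for a
      using assms that by (auto simp: homogeneous_def)
    then show ?thesis
      by (simp only: hom_part_def vec_eq_iff vec_lambda_beta sum.empty zero_index simp_thms)
  qed
qed

lemma hom_part_nth:
  "hom_part j G $ a = (\<Sum>m | m \<in> Poly_Mapping.keys (G $ a) \<and> mdeg m = j.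
      Poly_Mapping.single m (Poly_Mapping.lookup (G $ a) m))"
  by (simp add: hom_part_def)

text \<open>Scaling the jet by \<open>t\<close> turns the degree into a power of \<open>t\<close>,
  so an identity valid for all \<open>t\<close> splits into its homogeneous parts.\<close>

lemma (in coeff_hom) deval_scale:
  assumes "\<And>m. m \<in> Poly_Mapping.keys (G $ a) \<Longrightarrow> mdeg m \<le> n"
  shows "deval c (\<lambda>i. t * w i) (G $ a) = (\<Sum>j\<le>n. deval c w (hom_part j G $ a) * t ^ j)"
proof -
  let ?K = "Poly_Mapping.keys (G $ a)"
  have "(\<Sum>j\<le>n. deval c w (hom_part j G $ a) * t ^ j)
      = (\<Sum>j\<le>n. \<Sum>m | m \<in> ?K \<and> mdeg m = j.
            c (Poly_Mapping.lookup (G $ a) m) * monom_eval (\<lambda>i. t * w i) m)"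
    unfolding hom_part_nth deval_sum deval_single sum_distrib_right monom_eval_scale
    by (intro sum.cong refl) (auto simp: mult_ac)
  also have "\<dots> = (\<Sum>m\<in>?K. c (Poly_Mapping.lookup (G $ a) m) * monom_eval (\<lambda>i. t * w i) m)"
    using assms by (intro sum.group) auto
  finally show ?thesis
    by (simp add: deval_def monom_eval_def)
qed

text \<open>Without derivatives only the variables \<open>(1, 0)\<close> and \<open>(2, 0)\<close>
  remain, and a monomial of degree \<open>j\<close> is fixed by its exponent in the first.\<close>

lemma derivative_free_form:
  assumes "homogeneous j p" "dvars p \<subseteq> UNIV \<times> {0}"
  obtains e where "p = (\<Sum>i\<le>j. dconst (e i) * dvar (1, 0) ^ i * dvar (2, 0) ^ (j - i))"
proof -
  define mo :: "nat \<Rightarrow> jet_var \<Rightarrow>\<^sub>0 nat"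
    where "mo i = Poly_Mapping.single (1, 0) i + Poly_Mapping.single (2, 0) (j - i)" for i
  have pow: "dvar k ^ i = Poly_Mapping.single (Poly_Mapping.single k i) 1" for k i
    by (induction i) (auto simp: dvar_def mult_single single_add[symmetric] add.commute)
  have tm: "dconst r * dvar (1, 0) ^ i * dvar (2, 0) ^ (j - i) = Poly_Mapping.single (mo i) r" for r i
    by (simp add: pow mo_def dconst_def mult_single)
  have 12: "(1::2, 0::nat) \<noteq> (2, 0)" by simp
  have lk: "Poly_Mapping.lookup (mo i) (1, 0) = i" "Poly_Mapping.lookup (mo i) (2, 0) = j - i" for i
    using 12 by (auto simp: mo_def lookup_add lookup_single when_def)
  have inj: "inj_on mo {..j}"
    by (intro inj_onI) (metis lk(1))
  have "Poly_Mapping.keys p \<subseteq> mo ` {..j}"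
  proof
    fix m assume m: "m \<in> Poly_Mapping.keys p"
    then have sub: "Poly_Mapping.keys m \<subseteq> {(1, 0), (2, 0)}"
      using assms(2) exhaust_2 by (fastforce simp: dvars_def)
    have "mdeg m = j"
      using m assms(1) by (simp add: homogeneous_def)
    then have s: "Poly_Mapping.lookup m (1, 0) + Poly_Mapping.lookup m (2, 0) = j"
      using mdeg_superset[OF _ sub] 12 by simp
    have "m = mo (Poly_Mapping.lookup m (1, 0))"
    proof (rule poly_mapping_eqI)
      fix k
      show "Poly_Mapping.lookup m k = Poly_Mapping.lookup (mo (Poly_Mapping.lookup m (1, 0))) k"
        using s sub by (cases "k = (1, 0) \<or> k = (2, 0)")
          (auto simp: mo_def lookup_add lookup_single when_def in_keys_iff)
    qed
    then show "m \<in> mo ` {..j}"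
      using s by auto
  qed
  then have "p = (\<Sum>m\<in>mo ` {..j}. Poly_Mapping.single m (Poly_Mapping.lookup p m))"
    by (intro poly_mapping_eq_sum_single) auto
  also have "\<dots> = (\<Sum>i\<le>j. Poly_Mapping.single (mo i) (Poly_Mapping.lookup p (mo i)))"
    using inj by (simp add: sum.reindex)
  finally show ?thesis
    using that[of "\<lambda>i. Poly_Mapping.lookup p (mo i)"] by (simp only: tm)
qed

section \<open>Smooth periodic functions and Fourier pairings\<close>

definition smooth_fun :: "(real \<Rightarrow> real) \<Rightarrow> bool" where
  "smooth_fun f \<longleftrightarrow> (\<forall>n x. (deriv ^^ n) f differentiable (at x))"

lemma smooth_fun_has_deriv:
  assumes "smooth_fun f"
  shows "((deriv ^^ n) f has_real_derivative (deriv ^^ Suc n) f x) (at x)"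
  using assms by (auto simp: smooth_fun_def real_differentiable_def DERIV_deriv_iff_real_differentiable)

text \<open>A chain of functions, each the derivative of its predecessor, gives all iterated
  derivatives and smoothness at once. The smoothness proofs below exhibit such chains.\<close>

lemma
  assumes "\<And>n x. (g n has_real_derivative g (Suc n) x) (at x)"
  shows funpow_deriv_eq: "(deriv ^^ n) (g 0) = g n"
    and smooth_fun_chain: "smooth_fun (g 0)"
proof -
  show *: "(deriv ^^ n) (g 0) = g n" for n
  proof (induction n)
    case (Suc n)
    have "deriv (g n) = g (Suc n)"
      using DERIV_imp_deriv[OF assms] by (simp add: fun_eq_iff)
    then show ?case
      by (simp add: Suc)
  qed simp
  show "smooth_fun (g 0)"
    unfolding smooth_fun_def * using assms by (auto simp: real_differentiable_def)
qed

lemma smooth_fun_continuous_on: "smooth_fun f \<Longrightarrow> continuous_on A ((deriv ^^ n) f)"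
  by (meson DERIV_continuous_on smooth_fun_has_deriv has_field_derivative_at_within)

lemma
  assumes "smooth_fun f" "smooth_fun g"
  shows smooth_fun_add_scale: "smooth_fun (\<lambda>x. f x + t * g x)"
    and deriv_add_scale: "(deriv ^^ n) (\<lambda>x. f x + t * g x) = (\<lambda>x. (deriv ^^ n) f x + t * (deriv ^^ n) g x)"
proof -
  define h where "h n x = (deriv ^^ n) f x + t * (deriv ^^ n) g x" for n x
  have h: "(h n has_real_derivative h (Suc n) x) (at x)" for n x
    unfolding h_def[abs_def] using assms[THEN smooth_fun_has_deriv]
    by (auto intro!: derivative_eq_intros simp del: funpow.simps)
  from smooth_fun_chain[of h, OF h] show "smooth_fun (\<lambda>x. f x + t * g x)"
    by (simp add: h_def[abs_def])
  from funpow_deriv_eq[of h, OF h] show "(deriv ^^ n) (\<lambda>x. f x + t * g x) = (\<lambda>x. (deriv ^^ n) f x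
      + t * (deriv ^^ n) g x)"
    by (simp add: h_def[abs_def])
qed

lemma
  assumes "smooth_fun f"
  shows smooth_fun_compose_affine: "smooth_fun (\<lambda>x. f (a * x + s))"
    and deriv_compose_affine: "(deriv ^^ n) (\<lambda>x. f (a * x + s)) = (\<lambda>x. a ^ n * (deriv ^^ n) f (a * x + s))"
proof -
  define h where "h n x = a ^ n * (deriv ^^ n) f (a * x + s)" for n x
  have h: "(h n has_real_derivative h (Suc n) x) (at x)" for n x
    unfolding h_def[abs_def] 
    by (rule derivative_eq_intros DERIV_chain2[OF smooth_fun_has_deriv[OF assms, of n]] refl)+ simp
  from smooth_fun_chain[of h, OF h] show "smooth_fun (\<lambda>x. f (a * x + s))"
    by (simp add: h_def[abs_def])
  from funpow_deriv_eq[of h, OF h] show "(deriv ^^ n) (\<lambda>x. f (a * x + s))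
      = (\<lambda>x. a ^ n * (deriv ^^ n) f (a * x + s))"
    by (simp add: h_def[abs_def])
qed

lemma smooth_periodic_iff:
  "U \<in> smooth_periodic \<longleftrightarrow> (\<forall>b. smooth_fun (\<lambda>y. U y $ b)) \<and> (\<forall>x. U (x + 2 * pi) = U x)"
  by (auto simp: smooth_periodic_def smooth_fun_def)

lemma phase_space_smooth_periodic: "U \<in> phase_space \<Longrightarrow> U \<in> smooth_periodic"
  by (simp add: phase_space_def)

lemma smooth_fun_zero: "smooth_fun (\<lambda>x. 0)"
  using smooth_fun_chain[of "\<lambda>n x. 0"] by simp

lemma smooth_fun_scale: "smooth_fun f \<Longrightarrow> smooth_fun (\<lambda>x. t * f x)"
  and deriv_scale: "smooth_fun f \<Longrightarrow> (deriv ^^ n) (\<lambda>x. t * f x) = (\<lambda>x. t * (deriv ^^ n) f x)"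
  using smooth_fun_add_scale[OF smooth_fun_zero, of f t] deriv_add_scale[OF smooth_fun_zero, of f n t]
    funpow_deriv_eq[of "\<lambda>n x. 0" n] by auto

lemma jet_scale:
  assumes "U \<in> smooth_periodic"
  shows "jet (\<lambda>x. t *\<^sub>R U x) x = (\<lambda>i. t * jet U x i)"
  using assms by (auto simp: jet_def smooth_periodic_iff deriv_scale)

lemma jet_translate:
  assumes "U \<in> smooth_periodic"
  shows "jet (translate s U) x = jet U (x + s)"
proof -
  have "(deriv ^^ k) (\<lambda>y. U (y + s) $ b) x = (deriv ^^ k) (\<lambda>y. U y $ b) (x + s)" for b k
    using assms deriv_compose_affine[of "\<lambda>y. U y $ b" k 1 s] by (simp add: smooth_periodic_iff)
  then show ?thesis
    by (simp add: jet_def translate_def)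
qed

lemma jet_periodic:
  assumes "U \<in> smooth_periodic"
  shows "jet U (x + 2 * pi) = jet U x"
proof -
  have "translate (2 * pi) U = U"
    using assms by (auto simp: translate_def smooth_periodic_iff)
  then show ?thesis
    using jet_translate[OF assms, of "2 * pi" x] by simp
qed

lemma deval_jet_Dx:
  assumes "U \<in> smooth_periodic"
  shows "((\<lambda>x. deval id (jet U x) p) has_real_derivative deval id (jet U x) (Dx p)) (at x)"
proof (induction p rule: dpoly_induct)
  case (var i)
  obtain b k where i: "i = (b, k)" by (cases i)
  have "smooth_fun (\<lambda>y. U y $ b)"
    using assms by (simp add: smooth_periodic_iff)
  from smooth_fun_has_deriv[OF this, of k x] show ?case
    unfolding i Dx_dvar real_hom.deval_dvar jet_def by simp
next
  case (mult p q)
  from DERIV_mult[OF this] show ?case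
    unfolding Dx_mult real_hom.deval_mult real_hom.deval_add by (simp only: ac_simps)
next
  case (const r)
  show ?case
    unfolding Dx_dconst real_hom.deval_dconst real_hom.deval_zero by (rule DERIV_const)
next
  case (add p q)
  from DERIV_add[OF this] show ?case
    unfolding Dx_add real_hom.deval_add .
qed

lemma
  assumes "U \<in> smooth_periodic"
  shows smooth_fun_deval_jet: "smooth_fun (\<lambda>x. deval id (jet U x) p)"
    and deriv_deval_jet:
      "(deriv ^^ n) (\<lambda>x. deval id (jet U x) p) = (\<lambda>x. deval id (jet U x) ((Dx ^^ n) p))"
  using smooth_fun_chain[of "\<lambda>n x. deval id (jet U x) ((Dx ^^ n) p)"]
    funpow_deriv_eq[of "\<lambda>n x. deval id (jet U x) ((Dx ^^ n) p)"] deval_jet_Dx[OF assms]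
  by auto

lemma Dx_sum: "Dx (sum f A) = (\<Sum>a\<in>A. Dx (f a))"
  by (induction A rule: infinite_finite_induct) (auto simp: Dx_add)

lemma multiplier_nth:
  "multiplier P F $ a
    = (\<Sum>k\<le>degree P. dconst (coeff P k * (-1) ^ k) * (Dx ^^ Suc (2 * k)) (F $ a))"
  by (simp add: multiplier_def Dx_sum Dx_mult)

lemma dop_multiplier:
  assumes "U \<in> smooth_periodic"
  shows "dop (multiplier P F) U x $ a
    = (\<Sum>k\<le>degree P. coeff P k * (-1) ^ k * (deriv ^^ Suc (2 * k)) (\<lambda>x. dop F U x $ a) x)"
  by (simp add: dop_def multiplier_nth real_hom.deval_sum real_hom.deval_mult real_hom.deval_dconst
      deriv_deval_jet[OF assms] del: funpow.simps)

lemma integral_deriv_periodic: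
  fixes f f' :: "real \<Rightarrow> real"
  assumes "\<And>x. (f has_real_derivative f' x) (at x)" "f (2 * pi) = f 0"
  shows "(f' has_integral 0) {0..2 * pi}"
  using fundamental_theorem_of_calculus[of 0 "2 * pi" f f'] assms
  by (simp add: has_real_derivative_iff_has_vector_derivative[symmetric] has_field_derivative_at_within)

lemma integral_periodic_by_parts:
  assumes h: "\<And>x. (h has_real_derivative h' x) (at x)" and h': "continuous_on UNIV h'"
    and per: "h (2 * pi) = h 0"
  shows "integral {0..2 * pi} (\<lambda>x. h' x * sin (real n * x))
      = - real n * integral {0..2 * pi} (\<lambda>x. h x * cos (real n * x))"
    and "integral {0..2 * pi} (\<lambda>x. h' x * cos (real n * x))
        = real n * integral {0..2 * pi} (\<lambda>x. h x * sin (real n * x))"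
proof -
  have ch: "continuous_on A h" for A
    by (meson DERIV_continuous_on h has_field_derivative_at_within)
  have ch': "continuous_on A h'" for A
    using h' continuous_on_subset by blast
  have n2: "sin (real n * (2 * pi)) = 0" "cos (real n * (2 * pi)) = 1"
    using sin_2npi[of n] cos_2npi[of n] by (simp_all add: mult_ac)
  have "((\<lambda>x. h' x * sin (real n * x) + h x * (cos (real n * x) * real n)) has_integral 0) {0..2 * pi}"
    by (rule integral_deriv_periodic[of "\<lambda>x. h x * sin (real n * x)"])
      (auto intro!: derivative_eq_intros h simp: n2)
  then have "integral {0..2 * pi} (\<lambda>x. h' x * sin (real n * x))
      + integral {0..2 * pi} (\<lambda>x. real n * (h x * cos (real n * x))) = 0"
    by (subst Henstock_Kurzweil_Integration.integral_add[symmetric])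
      (auto intro!: integrable_continuous_real continuous_intros ch ch' simp: integral_unique mult_ac)
  then show "integral {0..2 * pi} (\<lambda>x. h' x * sin (real n * x))
      = - real n * integral {0..2 * pi} (\<lambda>x. h x * cos (real n * x))"
    by simp
  have "((\<lambda>x. h' x * cos (real n * x) + h x * (- sin (real n * x) * real n)) has_integral 0) {0..2 * pi}"
    by (rule integral_deriv_periodic[of "\<lambda>x. h x * cos (real n * x)"])
      (auto intro!: derivative_eq_intros h simp: n2 per)
  then have "integral {0..2 * pi} (\<lambda>x. h' x * cos (real n * x))
      + integral {0..2 * pi} (\<lambda>x. (- real n) * (h x * sin (real n * x))) = 0"
    by (subst Henstock_Kurzweil_Integration.integral_add[symmetric])
      (auto intro!: integrable_continuous_real continuous_intros ch ch' simp: integral_unique mult_ac)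
  then show "integral {0..2 * pi} (\<lambda>x. h' x * cos (real n * x))
      = real n * integral {0..2 * pi} (\<lambda>x. h x * sin (real n * x))"
    by simp
qed

text \<open>Testing against a single Fourier mode gives access to the flux itself at every wavenumber that the
  multiplier does not annihilate, without inverting the multiplier on differential polynomials.\<close>

lemma multiplier_pairing:
  assumes U: "U \<in> smooth_periodic"
  shows "integral {0..2 * pi} (\<lambda>x. dop (multiplier P F) U x $ a * sin (real n * x))
    = - real n * poly P (real n ^ 2) * integral {0..2 * pi} (\<lambda>x. dop F U x $ a * cos (real n * x))"
proof -
  define h where "h k = (\<lambda>x. deval id (jet U x) ((Dx ^^ k) (F $ a)))" for k
  have h: "(h k has_real_derivative h (Suc k) x) (at x)" for k x
    unfolding h_def using deval_jet_Dx[OF U] by simp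
  have ch: "continuous_on A (h k)" for A k
    by (meson DERIV_continuous_on h has_field_derivative_at_within)
  have per: "h k (2 * pi) = h k 0" for k
    using jet_periodic[OF U, of 0] by (simp add: h_def)
  define C where "C k = integral {0..2 * pi} (\<lambda>x. h k x * cos (real n * x))" for k
  \<comment> \<open>Two integrations by parts make the second x-derivative act as multiplication by
    \<open>- (real n ^ 2)\<close>; the outer derivative exchanges sine and cosine.\<close>
  have step: "C (Suc (Suc k)) = - (real n ^ 2) * C k" for k
    using integral_periodic_by_parts[OF h ch per] by (simp add: C_def power2_eq_square)
  have Ck: "C (2 * k) = (- (real n ^ 2)) ^ k * C 0" for k
    by (induction k) (use step in \<open>auto simp: algebra_simps\<close>)
  have S: "integral {0..2 * pi} (\<lambda>x. h (Suc (2 * k)) x * sin (real n * x))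
      = - real n * ((- (real n ^ 2)) ^ k * C 0)" for k
    using integral_periodic_by_parts(1)[OF h ch per, of "2 * k" n] Ck[of k] by (simp add: C_def)
  have "integral {0..2 * pi} (\<lambda>x. dop (multiplier P F) U x $ a * sin (real n * x))
      = integral {0..2 * pi} (\<lambda>x. \<Sum>k\<le>degree P. coeff P k * (-1) ^ k * (h (Suc (2 * k)) x * sin (real
          n * x)))"
    by (simp add: h_def dop_def multiplier_nth real_hom.deval_sum real_hom.deval_mult real_hom.deval_dconst
      sum_distrib_right mult.assoc del: funpow.simps)
  also have "\<dots> = (\<Sum>k\<le>degree P. coeff P k * (-1) ^ k * integral {0..2 * pi} (\<lambda>x. h (Suc (2 * k)) x *
      sin (real n * x)))"
    by (subst integral_sum) (auto intro!: integrable_continuous_real continuous_intros ch)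
  also have "\<dots> = (\<Sum>k\<le>degree P. coeff P k * (real n ^ 2) ^ k) * (- real n * C 0)"
    unfolding S sum_distrib_right
  proof (rule sum.cong[OF refl])
    fix k
    have "(-1) ^ k * (- (real n ^ 2)) ^ k = (real n ^ 2) ^ k"
      by (simp add: power_mult_distrib[symmetric])
    then show "coeff P k * (- 1) ^ k * (- real n * ((- (real n)\<^sup>2) ^ k * C 0))
      = coeff P k * ((real n)\<^sup>2) ^ k * (- real n * C 0)"
      by (metis (no_types, opaque_lifting) mult.assoc mult.left_commute)
  qed
  finally show ?thesis
    by (simp add: poly_altdef C_def h_def dop_def)
qed

lemma integral_reflect_periodic:
  fixes g :: "real \<Rightarrow> real"
  assumes "\<And>x. g (x + 2 * pi) = g x"
  shows "integral {0..2 * pi} (\<lambda>x. g (- x)) = integral {0..2 * pi} g"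
proof -
  have "g (- (x + 2 * pi)) = g (- x)" for x
    using assms[of "- x - 2 * pi"] by simp
  then have "integral {0..2 * pi} (\<lambda>x. g (- x)) = integral {- (2 * pi)..0} (\<lambda>x. g (- x))"
    using integral_shift_real_ivl[of 0 "2 * pi" "2 * pi" "\<lambda>x. g (- x)"] by simp
  then show ?thesis
    using Henstock_Kurzweil_Integration.integral_reflect_real[of "2 * pi" 0 g] by simp
qed

lemma R0_mult: "R0 *v v = vector [v $ 1, - v $ (2::2)]" for v :: "real^2"
  by (simp add: R0_def vec_eq_iff forall_2 matrix_vector_mult_def sum_2)

lemma reflect_nth: "reflect U x $ b = (if b = 1 then 1 else -1) * U (- x) $ b"
  using exhaust_2[of b] by (auto simp: reflect_def R0_mult)

lemma reflect_smooth_periodic: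
  assumes "U \<in> smooth_periodic"
  shows "reflect U \<in> smooth_periodic"
proof -
  have "U (- x - 2 * pi) = U (- x)" for x
    using assms unfolding smooth_periodic_iff by (metis diff_add_cancel)
  moreover have "smooth_fun (\<lambda>y. reflect U y $ b)" for b
    using assms smooth_fun_compose_affine[of "\<lambda>y. U y $ b" "-1" 0] unfolding reflect_nth smooth_periodic_iff
    by (intro smooth_fun_scale) simp
  ultimately show ?thesis
    unfolding smooth_periodic_iff by (simp add: vec_eq_iff reflect_nth)
qed

lemma reflect_scale: "reflect (\<lambda>x. t *\<^sub>R U x) = (\<lambda>x. t *\<^sub>R reflect U x)"
  by (simp add: fun_eq_iff vec_eq_iff reflect_nth)

lemma phase_space_scale: "U \<in> phase_space \<Longrightarrow> (\<lambda>x. t *\<^sub>R U x) \<in> phase_space"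
  by (auto simp: phase_space_def smooth_periodic_iff intro: smooth_fun_scale)

text \<open>Comparing powers of \<open>t\<close> in the equivariance relation at \<open>t U\<close> separates the homogeneous parts.\<close>

lemma hom_part_reflect:
  assumes G: "O2_equivariant (dop G)" and U: "U \<in> phase_space"
  shows "dop (hom_part j G) (reflect U) x $ a = (if a = 1 then 1 else -1) * dop (hom_part j G) U (- x) $ a"
proof -
  let ?n = "Max (insert j (mdeg ` Poly_Mapping.keys (G $ a)))"
  have n: "mdeg m \<le> ?n" if "m \<in> Poly_Mapping.keys (G $ a)" for m
    using that by (intro Max_ge) auto
  have U': "U \<in> smooth_periodic"
    using U by (rule phase_space_smooth_periodic)
  let ?s = "if a = 1 then 1 else -1 :: real"
  have "(\<Sum>i\<le>?n. dop (hom_part i G) (reflect U) x $ a * t ^ i)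
     = (\<Sum>i\<le>?n. (?s * dop (hom_part i G) U (- x) $ a) * t ^ i)" for t
  proof -
    have "dop G (reflect (\<lambda>x. t *\<^sub>R U x)) = reflect (dop G (\<lambda>x. t *\<^sub>R U x))"
      using G phase_space_scale[OF U] by (simp add: O2_equivariant_def)
    then have "dop G (\<lambda>x. t *\<^sub>R reflect U x) x $ a = ?s * dop G (\<lambda>x. t *\<^sub>R U x) (- x) $ a"
      by (simp add: reflect_scale reflect_nth)
    then show ?thesis
      by (simp add: dop_def jet_scale U' reflect_smooth_periodic real_hom.deval_scale[OF n]
          sum_distrib_left mult.assoc)
  qed
  then have "\<forall>i\<le>?n. dop (hom_part i G) (reflect U) x $ a = ?s * dop (hom_part i G) U (- x) $ a"
    by (subst polyfun_eq_coeffs[symmetric]) blast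
  then show ?thesis by simp
qed

text \<open>The multiplier is odd in d/dx and exchanges sine and cosine pairings. Reflection
  reverses the sine but preserves the cosine, so the flux has the parity opposite to that of the
  nonlinearity. The common factor n P(n^2) is nonzero and cancels.\<close>

lemma flux_pairing_reflect:
  assumes eq: "\<And>x. dop (multiplier P F) (reflect U) x $ a = s * dop (multiplier P F) U (- x) $ a"
    and U: "U \<in> smooth_periodic" and n: "n > 0" "poly P (real n ^ 2) \<noteq> 0"
  shows "integral {0..2 * pi} (\<lambda>x. dop F (reflect U) x $ a * cos (real n * x))
    = - s * integral {0..2 * pi} (\<lambda>x. dop F U x $ a * cos (real n * x))"
proof -
  let ?g = "\<lambda>x. dop (multiplier P F) U x $ a * sin (real n * x)"
  have per: "?g (x + 2 * pi) = ?g x" for x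
  proof -
    have "sin (real n * x + real n * (2 * pi)) = sin (real n * x)"
      using sin.plus_of_nat[of "real n * x" n] by (simp add: mult_ac)
    then show ?thesis
      by (simp add: dop_def jet_periodic[OF U] distrib_left)
  qed
  have "integral {0..2 * pi} (\<lambda>x. dop (multiplier P F) (reflect U) x $ a * sin (real n * x))
      = integral {0..2 * pi} (\<lambda>x. - s * ?g (- x))"
    unfolding eq by (intro integral_cong) simp
  also have "\<dots> = - s * integral {0..2 * pi} ?g"
    unfolding integral_reflect_periodic[of ?g, OF per, symmetric] by (rule integral_mult_right)
  finally show ?thesis
    using n unfolding multiplier_pairing[OF U] multiplier_pairing[OF reflect_smooth_periodic[OF U]]
      mult.left_commute[of "- s"] by (subst (asm) mult_left_cancel) auto
qed

section \<open>Cosine test modes and nonresonant wavenumbers\<close>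

definition cos_mode :: "nat \<Rightarrow> nat \<Rightarrow> real \<Rightarrow> real \<Rightarrow> real \<Rightarrow> real^2" where
  "cos_mode k l s t = (\<lambda>x. vector [s * cos (real k * x), t * cos (real l * x)])"

lemma smooth_fun_cos: "smooth_fun (\<lambda>x. s * cos (a * x))"
proof -
  \<comment> \<open>Each differentiation shifts the argument of the cosine by pi/2.\<close>
  have "smooth_fun (\<lambda>x. cos (0 * pi / 2 + x))"
    using smooth_fun_chain[of "\<lambda>n x. cos (real n * pi / 2 + x)"]
    by (force intro!: derivative_eq_intros simp: cos_add sin_add add_divide_distrib distrib_right)
  from smooth_fun_compose_affine[OF this, of a 0] show ?thesis
    by (intro smooth_fun_scale) simp
qed

lemma integral_cos:
  assumes "n > 0"
  shows "((\<lambda>x. cos (real n * x)) has_integral 0) {0..2 * pi}"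
  by (rule integral_deriv_periodic[of "\<lambda>x. sin (real n * x) / real n"])
    (use assms sin_2npi[of n] in \<open>auto intro!: derivative_eq_intros simp: mult_ac\<close>)

lemma cos_mode_phase_space:
  assumes "k > 0" "l > 0"
  shows "cos_mode k l s t \<in> phase_space"
proof -
  have per: "cos (real n * (x + 2 * pi)) = cos (real n * x)" for n x
    using cos.plus_of_nat[of "real n * x" n] by (simp add: algebra_simps)
  have "integral {0..2 * pi} (\<lambda>x. s * cos (real n * x)) = 0" if "n > 0" for n s
    using integral_cos[OF that] by (simp add: integral_unique)
  then show ?thesis
    using assms by (auto simp: phase_space_def smooth_periodic_iff forall_2 cos_mode_def smooth_fun_cos per)
qed

lemma reflect_cos_mode: "reflect (cos_mode k l s t) = cos_mode k l s (- t)"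
  by (auto simp: fun_eq_iff vec_eq_iff forall_2 reflect_nth cos_mode_def)

lemma integral_pos:
  fixes f :: "real \<Rightarrow> real"
  assumes "continuous_on {0..2 * pi} f" "\<And>x. f x \<ge> 0" "f 0 > 0"
  shows "integral {0..2 * pi} f > 0"
proof -
  have int: "f integrable_on {0..2 * pi}"
    using assms(1) by (rule integrable_continuous_real)
  have "integral {0..2 * pi} f \<noteq> 0"
  proof
    assume "integral {0..2 * pi} f = 0"
    then have "(f has_integral 0) {0..2 * pi}"
      using int by (metis integrable_integral)
    then show False
      using has_integral_0_cbox_imp_0[of 0 "2 * pi" f 0] assms pi_gt_zero by (auto simp: not_le)
  qed
  moreover have "integral {0..2 * pi} f \<ge> 0"
    using assms(2) int by (intro integral_nonneg) auto
  ultimately show ?thesis by simp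
qed

text \<open>These are the weights with which products of test modes enter the cosine pairings. Being
  positive, they can be cancelled from the relations between flux coefficients.\<close>

lemma
  assumes "n > 0"
  shows integral_cos_double: "integral {0..2 * pi} (\<lambda>x. cos (real n * x) ^ 2 * cos (real (2 * n) * x)) > 0"
    and integral_cos4: "integral {0..2 * pi} (\<lambda>x. cos (real n * x) ^ 4) > 0"
    and integral_cos22: "integral {0..2 * pi} (\<lambda>x. cos (real (2 * n) * x) ^ 2 * cos (real n * x) ^ 2) > 0"
proof -
  \<comment> \<open>This integrand changes sign; the double-angle formula writes it as half the sum
    of a mean-zero cosine and a square.\<close>
  have e: "cos (real n * x) ^ 2 * cos (real (2 * n) * x) = (cos (real (2 * n) * x)
      + cos (real (2 * n) * x) ^ 2) / 2" for x
  proof -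
    have "cos (real (2 * n) * x) = 2 * cos (real n * x) ^ 2 - 1"
      using cos_double_cos[of "real n * x"] by (simp add: mult.assoc)
    then show ?thesis by algebra
  qed
  have "integral {0..2 * pi} (\<lambda>x. cos (real n * x) ^ 2 * cos (real (2 * n) * x))
    = (integral {0..2 * pi} (\<lambda>x. cos (real (2 * n) * x))
        + integral {0..2 * pi} (\<lambda>x. cos (real (2 * n) * x) ^ 2)) / 2"
    unfolding e
    by (subst Henstock_Kurzweil_Integration.integral_add[symmetric])
       (auto intro!: integrable_continuous_real continuous_intros simp del: of_nat_mult)
  also have "\<dots> = integral {0..2 * pi} (\<lambda>x. cos (real (2 * n) * x) ^ 2) / 2"
    using integral_cos[of "2 * n"] assms by (simp add: integral_unique)
  also have "\<dots> > 0"
    by (simp del: of_nat_mult, intro integral_pos) (auto intro!: continuous_intros)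
  finally show "integral {0..2 * pi} (\<lambda>x. cos (real n * x) ^ 2 * cos (real (2 * n) * x)) > 0" .
qed (auto intro!: integral_pos continuous_intros)

text \<open>P has finitely many roots and squaring is injective on the naturals, so all but finitely
  many n have both n and 2n nonresonant. This n serves as a test wavenumber and is unrelated to the
  critical one.\<close>

lemma ex_nonroot:
  assumes "P \<noteq> (0 :: real poly)"
  obtains n :: nat where "n > 0" "poly P (real n ^ 2) \<noteq> 0" "poly P (real (2 * n) ^ 2) \<noteq> 0"
proof -
  let ?B = "{n. poly P (real n ^ 2) = 0} \<union> {n. poly P (real (2 * n) ^ 2) = 0}"
  have "finite {x. poly P x = 0}"
    using assms by (rule poly_roots_finite)
  moreover have "inj (\<lambda>n. real n ^ 2)" "inj (\<lambda>n. real (2 * n) ^ 2)"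
    by (auto intro!: injI)
  ultimately have "finite ((\<lambda>n. real n ^ 2) -` {x. poly P x
      = 0})" "finite ((\<lambda>n. real (2 * n) ^ 2) -` {x. poly P x = 0})"
    by (blast intro: finite_vimageI)+
  then have "finite (insert 0 ?B)"
    by (simp add: vimage_def)
  then obtain n where "n \<notin> insert 0 ?B"
    using ex_new_if_finite infinite_UNIV_nat by blast
  with that show thesis by auto
qed

section \<open>Variational fluxes\<close>

definition dmono :: "real \<Rightarrow> nat \<Rightarrow> nat \<Rightarrow> dpoly" where
  "dmono r i k = dconst r * dvar (1, 0) ^ i * dvar (2, 0) ^ k"

definition quad_flux :: "real \<Rightarrow> real \<Rightarrow> real \<Rightarrow> dpoly^2" where
  "quad_flux a b c = vector [dmono a 1 1, dmono b 2 0 + dmono c 0 2]"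

definition cubic_flux :: "real \<Rightarrow> real \<Rightarrow> real \<Rightarrow> real \<Rightarrow> dpoly^2" where
  "cubic_flux a b c d = vector [dmono a 2 1 + dmono b 0 3, dmono c 3 0 + dmono d 1 2]"

lemma (in coeff_hom) deval_dmono: "deval c w (dmono r i k) = c r * w (1, 0) ^ i * w (2, 0) ^ k"
  by (simp add: dmono_def deval_mult deval_power deval_dconst deval_dvar)

lemma homogeneous_power: "homogeneous j p \<Longrightarrow> homogeneous (n * j) (p ^ n)"
proof (induction n)
  case 0
  then show ?case
    using homogeneous_dconst[of 1] by (simp add: dconst_def)
next
  case (Suc n)
  then show ?case
    using homogeneous_mult[of j p "n * j" "p ^ n"] by simp
qed

lemma homogeneous_dmono: "i + k = j \<Longrightarrow> homogeneous j (dmono r i k)"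
  using homogeneous_scale[OF homogeneous_mult[OF homogeneous_power homogeneous_power, OF
      homogeneous_dvar homogeneous_dvar], of i k]
  by (simp add: dmono_def mult.assoc)

lemma homogeneous_quad_flux: "homogeneous 2 (quad_flux a b c $ i)"
  using exhaust_2[of i] by (auto simp: quad_flux_def intro!: homogeneous_add homogeneous_dmono)

lemma homogeneous_cubic_flux: "homogeneous 3 (cubic_flux a b c d $ i)"
  using exhaust_2[of i] by (auto simp: cubic_flux_def intro!: homogeneous_add homogeneous_dmono)

lemma jet_zero: "jet U x (b, 0) = U x $ b"
  by (simp add: jet_def)

lemma dop_quad_flux:
  "dop (quad_flux a b c) U x $ 1 = a * U x $ 1 * U x $ 2"
  "dop (quad_flux a b c) U x $ 2 = b * (U x $ 1) ^ 2 + c * (U x $ 2) ^ 2"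
  by (simp_all add: dop_def quad_flux_def real_hom.deval_add real_hom.deval_dmono jet_zero)

lemma dop_cubic_flux:
  "dop (cubic_flux a b c d) U x $ 1 = a * (U x $ 1) ^ 2 * U x $ 2 + b * (U x $ 2) ^ 3"
  "dop (cubic_flux a b c d) U x $ 2 = c * (U x $ 1) ^ 3 + d * U x $ 1 * (U x $ 2) ^ 2"
  by (simp_all add: dop_def cubic_flux_def real_hom.deval_add real_hom.deval_dmono jet_zero)

text \<open>On \<open>cos_mode n n s t\<close> a derivative-free flux is a form in \<open>s\<close>
  and \<open>t\<close> times cos^j(nx), and reflection changes \<open>t\<close> to
  \<open>- t\<close>. Pairing with a wavenumber \<open>m\<close> for which the integral does not
  vanish transfers the parity to this form; m = 2n works in degree 2 and m = n in degree 3.\<close>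

lemma flux_parity:
  assumes G: "O2_equivariant (dop G)" and GF: "hom_part j G = multiplier P F"
    and F: "F $ a = (\<Sum>i\<le>j. dmono (e i) i (j - i))"
    and n: "n > 0" and m: "m > 0" "poly P (real m ^ 2) \<noteq> 0"
    and I: "integral {0..2 * pi} (\<lambda>x. cos (real n * x) ^ j * cos (real m * x)) \<noteq> 0"
  shows "(\<Sum>i\<le>j. e i * s ^ i * (- t) ^ (j - i))
    = - (if a = 1 then 1 else -1) * (\<Sum>i\<le>j. e i * s ^ i * t ^ (j - i))"
proof -
  let ?I = "integral {0..2 * pi} (\<lambda>x. cos (real n * x) ^ j * cos (real m * x))"
  have D: "dop F (cos_mode n n s t) x $ a = (\<Sum>i\<le>j. e i * s ^ i * t ^ (j - i)) * cos (real n * x) ^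
      j" for s t x
    unfolding sum_distrib_right
    by (simp add: dop_def F real_hom.deval_sum real_hom.deval_dmono jet_zero cos_mode_def
        power_mult_distrib)
      (auto intro!: sum.cong simp: mult_ac power_add[symmetric])
  have int: "integral {0..2 * pi} (\<lambda>x. dop F (cos_mode n n s t) x $ a * cos (real m * x))
      = (\<Sum>i\<le>j. e i * s ^ i * t ^ (j - i)) * ?I" for s t
    unfolding D mult.assoc by simp
  have "cos_mode n n s t \<in> phase_space"
    using n by (intro cos_mode_phase_space)
  then have "integral {0..2 * pi} (\<lambda>x. dop F (cos_mode n n s (- t)) x $ a * cos (real m * x))
      = - (if a = 1 then 1 else -1) * integral {0..2 * pi} (\<lambda>x. dop F (cos_mode n n s t) x $ a * cos
          (real m * x))"
    unfolding reflect_cos_mode[symmetric]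
    by (intro flux_pairing_reflect[OF _ _ m] phase_space_smooth_periodic)
      (simp_all add: hom_part_reflect[OF G, where j = j, unfolded GF])
  then have "(\<Sum>i\<le>j. e i * s ^ i * (- t) ^ (j - i)) * ?I
      = (- (if a = 1 then 1 else -1) * (\<Sum>i\<le>j. e i * s ^ i * t ^ (j - i))) * ?I"
    unfolding int mult.assoc .
  with I show ?thesis by (subst (asm) mult_right_cancel)
qed

lemma derivative_freeE:
  assumes "derivative_free P j Gj"
  obtains F e where "Gj = multiplier P F" "\<And>a. F $ a = (\<Sum>i\<le>j. dmono (e a i) i (j - i))"
proof -
  from assms obtain F where F: "Gj = multiplier P F" "\<And>a. homogeneous j (F $ a)" "\<And>a. dvars (F $ a)
      \<subseteq> UNIV \<times> {0}"
    by (auto simp: derivative_free_def is_flux_def)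
  have "\<exists>e. F $ a = (\<Sum>i\<le>j. dmono (e i) i (j - i))" for a
    unfolding dmono_def by (rule derivative_free_form[OF F(2,3), of a]) blast
  then obtain e where "\<And>a. F $ a = (\<Sum>i\<le>j. dmono (e a i) i (j - i))"
    by metis
  with F(1) that show thesis by blast
qed

lemma dmono_zero [simp]: "dmono 0 i k = 0"
  by (simp add: dmono_def)

lemma quadratic_flux_form:
  assumes G: "nonlinearity G" and P: "P \<noteq> 0" and df: "derivative_free P 2 (hom_part 2 G)"
  obtains a b c where "hom_part 2 G = multiplier P (quad_flux a b c)"
proof -
  obtain F e where GF: "hom_part 2 G = multiplier P F" and F: "\<And>a. F $ a = (\<Sum>i\<le>2. dmono (e a i) i (2 - i))"
    by (rule derivative_freeE[OF df]) blast
  obtain n where n: "n > 0" "poly P (real (2 * n) ^ 2) \<noteq> 0"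
    by (rule ex_nonroot[OF P]) blast
  have par: "(\<Sum>i\<le>2. e a i * s ^ i * (- t) ^ (2 - i))
    = - (if a = 1 then 1 else -1) * (\<Sum>i\<le>2. e a i * s ^ i * t ^ (2 - i))" for a s t
    by (rule flux_parity[OF _ GF F n(1) _ n(2)])
      (use G n integral_cos_double[OF n(1)] in \<open>auto simp: nonlinearity_def\<close>)
  \<comment> \<open>The values of \<open>s\<close> and \<open>t\<close> isolate the coefficients of
    wrong parity: v^2 and u^2 in the first component, uv in the second.\<close>
  have "e 1 0 = 0" "e 1 2 = 0" "e 2 1 = 0"
    using par[where a = 1 and s = 0 and t = 1] par[where a = 1 and s = 1 and t = 0]
      par[where a = 2 and s = 1 and t = 1]
    by (simp_all add: eval_nat_numeral)
  then have "F = quad_flux (e 1 1) (e 2 2) (e 2 0)"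
    by (auto simp: vec_eq_iff forall_2 F quad_flux_def numeral_2_eq_2)
  with GF that show thesis by blast
qed

lemma cubic_flux_form:
  assumes G: "nonlinearity G" and P: "P \<noteq> 0" and df: "derivative_free P 3 (hom_part 3 G)"
  obtains a b c d where "hom_part 3 G = multiplier P (cubic_flux a b c d)"
proof -
  obtain F e where GF: "hom_part 3 G = multiplier P F" and F: "\<And>a. F $ a = (\<Sum>i\<le>3. dmono (e a i) i (3 - i))"
    by (rule derivative_freeE[OF df]) blast
  obtain n where n: "n > 0" "poly P (real n ^ 2) \<noteq> 0"
    by (rule ex_nonroot[OF P]) blast
  have I: "integral {0..2 * pi} (\<lambda>x. cos (real n * x) ^ 3 * cos (real n * x)) \<noteq> 0"
    using integral_cos4[OF n(1)] by (simp add: power3_eq_cube power4_eq_xxxx)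
  have par: "(\<Sum>i\<le>3. e a i * s ^ i * (- t) ^ (3 - i))
    = - (if a = 1 then 1 else -1) * (\<Sum>i\<le>3. e a i * s ^ i * t ^ (3 - i))" for a s t
    by (rule flux_parity[OF _ GF F n(1) n I]) (use G in \<open>simp add: nonlinearity_def\<close>)
  have "e 1 3 = 0" "e 2 0 = 0"
    using par[where a = 1 and s = 1 and t = 0] par[where a = 2 and s = 0 and t = 1]
    by (simp_all add: eval_nat_numeral)
  \<comment> \<open>At \<open>s = t = 1\<close> parity only annihilates the sum of the two
    wrong-parity coefficients of a component, and one of them is already known to vanish.\<close>
  moreover have "e 1 1 = 0" "e 2 2 = 0"
    using par[where a = 1 and s = 1 and t = 1] par[where a = 2 and s = 1 and t = 1] calculation
    by (simp_all add: eval_nat_numeral)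
  ultimately have "F = cubic_flux (e 1 2) (e 1 0) (e 2 3) (e 2 1)"
    by (auto simp: vec_eq_iff forall_2 F cubic_flux_def eval_nat_numeral)
  with GF that show thesis by blast
qed

text \<open>Along the line U + t W a Hamiltonian density of degree at most four in U alone is a
  quartic in \<open>t\<close>; its derivative at 0 is the integral of the linear
  coefficient.\<close>

lemma derivative_coeff_integral:
  fixes g :: "real \<Rightarrow> real"
  assumes g: "\<And>t. g t = integral {0..2 * pi} (\<lambda>x. Ca x + Cb x * t + Cc x * t ^ 2 + Cd x * t ^ 3
      + Ce x * t ^ 4)"
    and C: "continuous_on {0..2 * pi} Ca" "continuous_on {0..2 * pi} Cb" "continuous_on {0..2 * pi} Cc"
      "continuous_on {0..2 * pi} Cd" "continuous_on {0..2 * pi} Ce"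
  shows "(g has_real_derivative integral {0..2 * pi} Cb) (at 0)"
proof -
  let ?I = "integral {0..2 * pi}"
  have "g = (\<lambda>t. ?I Ca + ?I Cb * t + ?I Cc * t ^ 2 + ?I Cd * t ^ 3 + ?I Ce * t ^ 4)"
  proof
    fix t
    note int = integrable_continuous_real[OF C(1)] integrable_continuous_real[OF C(2)]
      integrable_continuous_real[OF C(3)] integrable_continuous_real[OF C(4)]
          integrable_continuous_real[OF C(5)]
    from int[THEN integrable_integral] show "g t = ?I Ca + ?I Cb * t + ?I Cc * t ^ 2 + ?I Cd * t ^ 3
        + ?I Ce * t ^ 4"
      unfolding g by (intro integral_unique has_integral_add has_integral_mult_left)
  qed
  then show ?thesis
    by (auto intro!: derivative_eq_intros)
qed

text \<open>Equality of mixed partial derivatives, obtained from one-variable derivatives alone: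
  subtracting explicit primitives in \<open>s\<close> leaves a function \<open>\<psi>\<close>
  constant in \<open>s\<close>, and the resulting formula for \<open>\<phi> 1\<close> in terms of
  \<open>\<phi> 0\<close> is differentiated at \<open>t = 1\<close>. The exponent \<open>i\<close>
  is 0 for quadratic and 1 for cubic fluxes.\<close>

lemma mixed_partials:
  fixes \<phi> :: "real \<Rightarrow> real \<Rightarrow> real"
  assumes s: "\<And>s t. ((\<lambda>s. \<phi> s t) has_real_derivative A * s ^ p + B * s ^ i * t ^ 2) (at s)"
    and t: "\<And>s t. (\<phi> s has_real_derivative C * s ^ Suc i * t + D * t ^ 3) (at t)"
  shows "C * real (Suc i) = 2 * B"
proof -
  define \<psi> where "\<psi> s t = \<phi> s t - A * s ^ Suc p / Suc p - B * s ^ Suc i * t ^ 2 / Suc i" for s t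
  have pow: "((\<lambda>s. a * s ^ Suc k / real (Suc k)) has_real_derivative a * s ^ k) (at s)" for a s k
    using DERIV_cdivide[OF DERIV_cmult[OF DERIV_pow[of "Suc k" s UNIV], of a], of "real (Suc k)"] by simp
  have "((\<lambda>s. \<psi> s t) has_real_derivative 0) (at s)" for s t
    using DERIV_diff[OF DERIV_diff[OF s[of t s] pow[of A p s]] pow[of "B * t ^ 2" i s]]
    by (simp add: \<psi>_def mult_ac)
  then have "\<psi> 1 t = \<psi> 0 t" for t
    using DERIV_isconst_all[of "\<lambda>s. \<psi> s t"] by blast
  then have "\<phi> 1 t = \<phi> 0 t + A / Suc p + B * t ^ 2 / Suc i" for t
    unfolding \<psi>_def by (simp add: diff_eq_eq)
  then have "\<phi> 1 = (\<lambda>t. \<phi> 0 t + A / Suc p + B * t ^ 2 / Suc i)"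
    by blast
  moreover have "((\<lambda>t. \<phi> 0 t + A / Suc p + B * t ^ 2 / Suc i) has_real_derivative
      (C * 0 ^ Suc i * 1 + D * 1 ^ 3) + B * 2 / Suc i) (at 1)"
    by (auto intro!: derivative_eq_intros t[of 0 1, simplified])
  ultimately have "C * 1 ^ Suc i * 1 + D * 1 ^ 3 = (C * 0 ^ Suc i * 1 + D * 1 ^ 3) + B * 2 / Suc i"
    using t[of 1 1] DERIV_unique by metis
  then show ?thesis
    by (simp add: field_simps)
qed

lemma Smat_mult_nth: "(Smat *v V) $ 1 = V $ 2" "(Smat *v V) $ 2 = V $ 1"
  for V :: "'a::ring_1^2"
  by (simp_all add: Smat_def matrix_vector_mult_def sum_2)

lemma Smat_involution: "Smat *v (Smat *v V) = V" for V :: "'a::ring_1^2"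
  by (simp add: vec_eq_iff forall_2 Smat_mult_nth)

lemma dop_Smat: "dop (Smat *v F) U x $ 1 = dop F U x $ 2" "dop (Smat *v F) U x $ 2 = dop F U x $ 1"
  by (simp_all add: dop_def Smat_mult_nth)

text \<open>Injectivity of the multiplier on differential polynomials is not needed here: by
  \<open>multiplier_pairing\<close> a variational flux and the given one agree at the nonresonant wavenumbers
  \<open>n\<close> and \<open>2n\<close>.\<close>

lemma variational_potential:
  assumes var: "variational P j (multiplier P F)"
    and n: "n > 0" "poly P (real n ^ 2) \<noteq> 0" "poly P (real (2 * n) ^ 2) \<noteq> 0"
  obtains \<phi> where
    "\<And>s t. ((\<lambda>s. \<phi> s t) has_real_derivative
      integral {0..2 * pi} (\<lambda>x. dop F (cos_mode (2 * n) n s t) x $ 2 * cos (real (2 * n) * x))) (at s)"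
    "\<And>s t. (\<phi> s has_real_derivative
      integral {0..2 * pi} (\<lambda>x. dop F (cos_mode (2 * n) n s t) x $ 1 * cos (real n * x))) (at t)"
proof -
  from var obtain F' H V where eq: "multiplier P F = multiplier P F'"
    and H: "is_variational_derivative H V" and V: "F' = Smat *v V"
    by (auto simp: variational_def is_flux_def variational_flux_def)
  define \<phi> where "\<phi> s t = hamiltonian H (cos_mode (2 * n) n s t)" for s t
  have U: "cos_mode (2 * n) n s t \<in> phase_space" for s t
    using n by (intro cos_mode_phase_space) auto
  note U' = phase_space_smooth_periodic[OF U]
  have same: "integral {0..2 * pi} (\<lambda>x. dop F' (cos_mode (2 * n) n s t) x $ a * cos (real m * x))
      = integral {0..2 * pi} (\<lambda>x. dop F (cos_mode (2 * n) n s t) x $ a * cos (real m * x))"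
    if "m > 0" "poly P (real m ^ 2) \<noteq> 0" for m s t a
    using multiplier_pairing[OF U', of P F s t a m] multiplier_pairing[OF U', of P F' s t a m] that
    unfolding eq by simp
  \<comment> \<open>\<open>Smat\<close> exchanges the components: the derivative in the amplitude
    \<open>s\<close> of u sees the second component of the flux, that in \<open>t\<close> the
    first.\<close>
  have Vn: "dop V U x $ 1 = dop F' U x $ 2" "dop V U x $ 2 = dop F' U x $ 1" for U x
    by (simp_all add: V dop_def Smat_mult_nth)
  have der: "((\<lambda>\<tau>. \<phi> (s + \<tau> * s') (t + \<tau> * t')) has_real_derivative
      integral {0..2 * pi} (\<lambda>x. dop V (cos_mode (2 * n) n s t) x \<bullet> cos_mode (2 * n) n s' t' x)) (at
          0)" for s t s' t'
  proof -
    have "(\<lambda>x. cos_mode (2 * n) n s t x + \<tau> *\<^sub>R cos_mode (2 * n) n s' t' x)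
        = cos_mode (2 * n) n (s + \<tau> * s') (t + \<tau> * t')" for \<tau>
      by (simp add: cos_mode_def fun_eq_iff vec_eq_iff forall_2 algebra_simps)
    with H[unfolded is_variational_derivative_def, rule_format, OF U U', of s t s' t']
    show ?thesis
      unfolding \<phi>_def by simp
  qed
  show thesis
  proof (rule that)
    fix s t
    have "((\<lambda>\<tau>. \<phi> (\<tau> + s) t) has_real_derivative
      integral {0..2 * pi} (\<lambda>x. dop F (cos_mode (2 * n) n s t) x $ 2 * cos (real (2 * n) * x))) (at 0)"
      using der[of s 1 t 0] same[of "2 * n" s t 2] n
      by (simp add: inner_vec_def sum_2 Vn cos_mode_def add.commute)
    then show "((\<lambda>s. \<phi> s t) has_real_derivative
      integral {0..2 * pi} (\<lambda>x. dop F (cos_mode (2 * n) n s t) x $ 2 * cos (real (2 * n) * x))) (at s)"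
      using DERIV_shift[of "\<lambda>s. \<phi> s t" _ 0 s] by simp
    have "((\<lambda>\<tau>. \<phi> s (\<tau> + t)) has_real_derivative
      integral {0..2 * pi} (\<lambda>x. dop F (cos_mode (2 * n) n s t) x $ 1 * cos (real n * x))) (at 0)"
      using der[of s 0 t 1] same[of n s t 1] n
      by (simp add: inner_vec_def sum_2 Vn cos_mode_def add.commute)
    then show "(\<phi> s has_real_derivative
      integral {0..2 * pi} (\<lambda>x. dop F (cos_mode (2 * n) n s t) x $ 1 * cos (real n * x))) (at t)"
      using DERIV_shift[of "\<phi> s" _ 0 t] by simp
  qed
qed

text \<open>With u = s cos(2nx) and v = t cos(nx) the terms a u v and c v^2 are paired with the same
  weight \<open>I\<close>, and symmetry of second derivatives reads a I = 2 c I. With equal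
  wavenumbers the weight would be the integral of a cubed cosine, which is zero.\<close>

lemma variational_quad_imp:
  assumes var: "variational P 2 (multiplier P (quad_flux a b c))" and P: "P \<noteq> 0"
  shows "a = 2 * c"
proof -
  obtain n where n: "n > 0" "poly P (real n ^ 2) \<noteq> 0" "poly P (real (2 * n) ^ 2) \<noteq> 0"
    using ex_nonroot[OF P] .
  obtain \<phi> where \<phi>:
    "\<And>s t. ((\<lambda>s. \<phi> s t) has_real_derivative
      integral {0..2 * pi} (\<lambda>x. dop (quad_flux a b c) (cos_mode (2 * n) n s t) x $ 2 * cos (real (2
          * n) * x))) (at s)"
    "\<And>s t. (\<phi> s has_real_derivative
      integral {0..2 * pi} (\<lambda>x. dop (quad_flux a b c) (cos_mode (2 * n) n s t) x $ 1 * cos (real n *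
          x))) (at t)"
    using variational_potential[OF var n] by blast
  define I where "I = integral {0..2 * pi} (\<lambda>x. cos (real n * x) ^ 2 * cos (real (2 * n) * x))"
  define K where "K = integral {0..2 * pi} (\<lambda>x. cos (real (2 * n) * x) ^ 3)"
  have s: "integral {0..2 * pi} (\<lambda>x. dop (quad_flux a b c) (cos_mode (2 * n) n s t) x $ 2 * cos
      (real (2 * n) * x))
    = b * K * s ^ 2 + c * I * s ^ 0 * t ^ 2" for s t
  proof -
    have "integral {0..2 * pi} (\<lambda>x. dop (quad_flux a b c) (cos_mode (2 * n) n s t) x $ 2 * cos (real
        (2 * n) * x))
      = integral {0..2 * pi} (\<lambda>x. b * s ^ 2 * cos (real (2 * n) * x) ^ 3
          + c * t ^ 2 * (cos (real n * x) ^ 2 * cos (real (2 * n) * x)))"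
      by (intro integral_cong) (simp add: dop_quad_flux cos_mode_def power2_eq_square power3_eq_cube
          algebra_simps)
    also have "\<dots> = b * s ^ 2 * K + c * t ^ 2 * I"
      unfolding K_def I_def
      by (subst Henstock_Kurzweil_Integration.integral_add) (auto intro!: integrable_continuous_real
          continuous_intros)
    finally show ?thesis by (simp add: mult_ac)
  qed
  have t: "integral {0..2 * pi} (\<lambda>x. dop (quad_flux a b c) (cos_mode (2 * n) n s t) x $ 1 * cos
      (real n * x))
    = a * I * s ^ Suc 0 * t + 0 * t ^ 3" for s t
  proof -
    have "integral {0..2 * pi} (\<lambda>x. dop (quad_flux a b c) (cos_mode (2 * n) n s t) x $ 1 * cos (real n * x))
      = integral {0..2 * pi} (\<lambda>x. a * s * t * (cos (real n * x) ^ 2 * cos (real (2 * n) * x)))"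
      by (intro integral_cong) (simp add: dop_quad_flux cos_mode_def power2_eq_square algebra_simps)
    also have "\<dots> = a * s * t * I"
      unfolding I_def by (rule integral_mult_right)
    finally show ?thesis by (simp add: mult_ac)
  qed
  have "a * I * real (Suc 0) = 2 * (c * I)"
    using \<phi> unfolding s t by (rule mixed_partials)
  moreover have "I > 0"
    unfolding I_def using n(1) by (rule integral_cos_double)
  ultimately show ?thesis by simp
qed

text \<open>The terms a u^2 v and d u v^2 share the weight \<open>I\<close>, and the mixed
  derivatives give 2 a I = 2 d I.\<close>

lemma variational_cubic_imp:
  assumes var: "variational P 3 (multiplier P (cubic_flux a b c d))" and P: "P \<noteq> 0"
  shows "a = d"
proof -
  obtain n where n: "n > 0" "poly P (real n ^ 2) \<noteq> 0" "poly P (real (2 * n) ^ 2) \<noteq> 0"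
    using ex_nonroot[OF P] .
  obtain \<phi> where \<phi>:
    "\<And>s t. ((\<lambda>s. \<phi> s t) has_real_derivative
      integral {0..2 * pi} (\<lambda>x. dop (cubic_flux a b c d) (cos_mode (2 * n) n s t) x $ 2 * cos (real
          (2 * n) * x))) (at s)"
    "\<And>s t. (\<phi> s has_real_derivative
      integral {0..2 * pi} (\<lambda>x. dop (cubic_flux a b c d) (cos_mode (2 * n) n s t) x $ 1 * cos (real
          n * x))) (at t)"
    using variational_potential[OF var n] by blast
  define I where "I = integral {0..2 * pi} (\<lambda>x. cos (real (2 * n) * x) ^ 2 * cos (real n * x) ^ 2)"
  define K where "K m = integral {0..2 * pi} (\<lambda>x. cos (real m * x) ^ 4)" for m
  have s: "integral {0..2 * pi} (\<lambda>x. dop (cubic_flux a b c d) (cos_mode (2 * n) n s t) x $ 2 * cos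
      (real (2 * n) * x))
    = c * K (2 * n) * s ^ 3 + d * I * s ^ 1 * t ^ 2" for s t
  proof -
    have "integral {0..2 * pi} (\<lambda>x. dop (cubic_flux a b c d) (cos_mode (2 * n) n s t) x $ 2 * cos
        (real (2 * n) * x))
      = integral {0..2 * pi} (\<lambda>x. c * s ^ 3 * cos (real (2 * n) * x) ^ 4
          + d * s * t ^ 2 * (cos (real (2 * n) * x) ^ 2 * cos (real n * x) ^ 2))"
      by (intro integral_cong) (simp add: dop_cubic_flux cos_mode_def eval_nat_numeral algebra_simps)
    also have "\<dots> = c * s ^ 3 * K (2 * n) + d * s * t ^ 2 * I"
      unfolding K_def I_def
      by (subst Henstock_Kurzweil_Integration.integral_add) (auto intro!: integrable_continuous_real
          continuous_intros)
    finally show ?thesis by (simp add: mult_ac)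
  qed
  have t: "integral {0..2 * pi} (\<lambda>x. dop (cubic_flux a b c d) (cos_mode (2 * n) n s t) x $ 1 * cos
      (real n * x))
    = a * I * s ^ Suc 1 * t + b * K n * t ^ 3" for s t
  proof -
    have "integral {0..2 * pi} (\<lambda>x. dop (cubic_flux a b c d) (cos_mode (2 * n) n s t) x $ 1 * cos
        (real n * x))
      = integral {0..2 * pi} (\<lambda>x. a * s ^ 2 * t * (cos (real (2 * n) * x) ^ 2 * cos (real n * x) ^
          2) + b * t ^ 3 * cos (real n * x) ^ 4)"
      by (intro integral_cong) (simp add: dop_cubic_flux cos_mode_def eval_nat_numeral algebra_simps)
    also have "\<dots> = a * s ^ 2 * t * I + b * t ^ 3 * K n"
      unfolding K_def I_def
      by (subst Henstock_Kurzweil_Integration.integral_add) (auto intro!: integrable_continuous_real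
          continuous_intros)
    finally show ?thesis by (simp add: mult_ac power2_eq_square)
  qed
  have "a * I * real (Suc 1) = 2 * (d * I)"
    using \<phi> unfolding s t by (rule mixed_partials)
  moreover have "I > 0"
    unfolding I_def using n(1) by (rule integral_cos22)
  ultimately show ?thesis by simp
qed

section \<open>Hamiltonians of the variational fluxes\<close>

lemma R_invariantI:
  assumes "\<And>U x. U \<in> smooth_periodic \<Longrightarrow> deval id (jet (reflect U) x) H = deval id (jet U (- x)) H"
  shows "R_invariant H"
  unfolding R_invariant_def hamiltonian_def
proof
  fix U assume "U \<in> phase_space"
  then have U: "U \<in> smooth_periodic"
    by (rule phase_space_smooth_periodic)
  show "integral {0..2 * pi} (\<lambda>x. deval id (jet (reflect U) x) H)
      = integral {0..2 * pi} (\<lambda>x. deval id (jet U x) H)"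
    using integral_reflect_periodic[of "\<lambda>x. deval id (jet U x) H"] jet_periodic[OF U] assms[OF U] by simp
qed

lemma smooth_periodic_continuous: "U \<in> smooth_periodic \<Longrightarrow> continuous_on A (\<lambda>x. U x $ b)"
  using smooth_fun_continuous_on[of "\<lambda>x. U x $ b" A 0] by (simp add: smooth_periodic_iff)

lemma variational_quad:
  assumes "a = 2 * c"
  shows "variational P 2 (multiplier P (quad_flux a b c))"
proof -
  \<comment> \<open>The gradient of b u^3 / 3 + c u v^2 is (b u^2 + c v^2, 2 c u v);
    \<open>Smat\<close> turns it into the flux because a = 2c.\<close>
  let ?H = "dmono (b / 3) 3 0 + dmono c 1 2"
  have "is_variational_derivative ?H (Smat *v quad_flux a b c)"
    unfolding is_variational_derivative_def
  proof (intro ballI)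
    fix U W assume "U \<in> phase_space" and W: "W \<in> smooth_periodic"
    then have U: "U \<in> smooth_periodic"
      by (simp add: phase_space_smooth_periodic)
    note cont = smooth_periodic_continuous[OF U] smooth_periodic_continuous[OF W]
    have "((\<lambda>t. hamiltonian ?H (\<lambda>x. U x + t *\<^sub>R W x)) has_real_derivative
      integral {0..2 * pi} (\<lambda>x. (b * (U x $ 1) ^ 2 + c * (U x $ 2) ^ 2) * W x $ 1
          + 2 * c * U x $ 1 * U x $ 2 * W x $ 2)) (at 0)"
      unfolding hamiltonian_def real_hom.deval_add real_hom.deval_dmono jet_zero
    proof (rule derivative_coeff_integral[where
      Ca = "\<lambda>x. b / 3 * (U x $ 1) ^ 3 + c * U x $ 1 * (U x $ 2) ^ 2" and
      Cc = "\<lambda>x. b * U x $ 1 * (W x $ 1) ^ 2 + c * (2 * U x $ 2 * W x $ 2 * W x $ 1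
          + U x $ 1 * (W x $ 2) ^ 2)" and
      Cd = "\<lambda>x. b / 3 * (W x $ 1) ^ 3 + c * W x $ 1 * (W x $ 2) ^ 2" and
      Ce = "\<lambda>x. 0"], goal_cases)
      case (1 t)
      show ?case
        by (rule integral_cong) (simp add: eval_nat_numeral field_simps)
    qed (auto intro!: continuous_intros cont)
    then show "((\<lambda>t. hamiltonian ?H (\<lambda>x. U x + t *\<^sub>R W x)) has_real_derivative
        integral {0..2 * pi} (\<lambda>x. dop (Smat *v quad_flux a b c) U x \<bullet> W x)) (at 0)"
      by (simp add: inner_vec_def sum_2 dop_Smat dop_quad_flux assms)
  qed
  moreover have "R_invariant ?H"
    by (rule R_invariantI) (simp add: real_hom.deval_add real_hom.deval_dmono jet_zero reflect_nth)
  moreover have "homogeneous (2 + 1) ?H"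
    by (intro homogeneous_add homogeneous_dmono) simp_all
  ultimately have "variational_flux 2 (quad_flux a b c)"
    unfolding variational_flux_def by (metis Smat_involution)
  then show ?thesis
    unfolding variational_def is_flux_def using homogeneous_quad_flux by blast
qed

lemma variational_cubic:
  assumes "a = d"
  shows "variational P 3 (multiplier P (cubic_flux a b c d))"
proof -
  \<comment> \<open>The gradient of this quartic is (c u^3 + d u v^2, d u^2 v + b v^3), the flux
    with its components exchanged because a = d.\<close>
  let ?H = "dmono (c / 4) 4 0 + dmono (d / 2) 2 2 + dmono (b / 4) 0 4"
  have "is_variational_derivative ?H (Smat *v cubic_flux a b c d)"
    unfolding is_variational_derivative_def
  proof (intro ballI)
    fix U W assume "U \<in> phase_space" and W: "W \<in> smooth_periodic"
    then have U: "U \<in> smooth_periodic"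
      by (simp add: phase_space_smooth_periodic)
    note cont = smooth_periodic_continuous[OF U] smooth_periodic_continuous[OF W]
    have "((\<lambda>t. hamiltonian ?H (\<lambda>x. U x + t *\<^sub>R W x)) has_real_derivative
      integral {0..2 * pi} (\<lambda>x. (c * (U x $ 1) ^ 3 + d * U x $ 1 * (U x $ 2) ^ 2) * W x $ 1
          + (d * (U x $ 1) ^ 2 * U x $ 2 + b * (U x $ 2) ^ 3) * W x $ 2)) (at 0)"
      unfolding hamiltonian_def real_hom.deval_add real_hom.deval_dmono jet_zero
    proof (rule derivative_coeff_integral[where
      Ca = "\<lambda>x. c / 4 * (U x $ 1) ^ 4 + d / 2 * (U x $ 1) ^ 2 * (U x $ 2) ^ 2 + b / 4 * (U x $ 2) ^ 4" and
      Cc = "\<lambda>x. c * 3 / 2 * (U x $ 1) ^ 2 * (W x $ 1) ^ 2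
          + d / 2 * ((U x $ 1) ^ 2 * (W x $ 2) ^ 2 + 4 * U x $ 1 * W x $ 1 * U x $ 2 * W x $ 2
              + (W x $ 1) ^ 2 * (U x $ 2) ^ 2)
          + b * 3 / 2 * (U x $ 2) ^ 2 * (W x $ 2) ^ 2" and
      Cd = "\<lambda>x. c * U x $ 1 * (W x $ 1) ^ 3 + d * (U x $ 1 * W x $ 1 * (W x $ 2) ^ 2
          + (W x $ 1) ^ 2 * U x $ 2 * W x $ 2)
          + b * U x $ 2 * (W x $ 2) ^ 3" and
      Ce = "\<lambda>x. c / 4 * (W x $ 1) ^ 4 + d / 2 * (W x $ 1) ^ 2 * (W x $ 2) ^ 2
          + b / 4 * (W x $ 2) ^ 4"], goal_cases)
      case (1 t)
      show ?case
        by (rule integral_cong) (simp add: eval_nat_numeral field_simps)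
    qed (auto intro!: continuous_intros cont)
    then show "((\<lambda>t. hamiltonian ?H (\<lambda>x. U x + t *\<^sub>R W x)) has_real_derivative
        integral {0..2 * pi} (\<lambda>x. dop (Smat *v cubic_flux a b c d) U x \<bullet> W x)) (at 0)"
      by (simp add: inner_vec_def sum_2 dop_Smat dop_cubic_flux assms)
  qed
  moreover have "R_invariant ?H"
    by (rule R_invariantI) (simp add: real_hom.deval_add real_hom.deval_dmono jet_zero reflect_nth)
  moreover have "homogeneous (3 + 1) ?H"
    by (intro homogeneous_add homogeneous_dmono) simp_all
  ultimately have "variational_flux 3 (cubic_flux a b c d)"
    unfolding variational_flux_def by (metis Smat_involution)
  then show ?thesis
    unfolding variational_def is_flux_def using homogeneous_cubic_flux by blast
qed

section \<open>The cubic coefficient\<close>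

lemma mono_wave_add: "mono_wave mc (\<mu> + \<nu>) = mono_wave mc \<mu> + mono_wave mc \<nu>"
  by (simp add: mono_wave_def lookup_add distrib_right sum.distrib)

lemma mono_beta_add: "mono_beta w (\<mu> + \<nu>) = mono_beta w \<mu> + mono_beta w \<nu>"
  by (simp add: mono_beta_def lookup_add distrib_right sum.distrib)

definition amp_var :: "amp \<Rightarrow> amp_mono" where
  "amp_var X = Poly_Mapping.single X 1"

abbreviation amp_pair :: "amp \<Rightarrow> amp \<Rightarrow> amp_mono" where
  "amp_pair X Y \<equiv> amp_var X + amp_var Y"

lemma lookup_amp_var: "Poly_Mapping.lookup (amp_var X) Y = (if X = Y then 1 else 0)"
  by (simp add: amp_var_def lookup_single when_def)

lemma amp_var_eq_iff [simp]: "amp_var X = amp_var Y \<longleftrightarrow> X = Y"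
  by (metis lookup_amp_var zero_neq_one)

lemma mono_ABBbar_eq: "mono_ABBbar = amp_pair AmpA AmpB + amp_var AmpBbar"
  by (simp add: mono_ABBbar_def amp_var_def)

lemma mono_wave_amp_var [simp]: "mono_wave mc (amp_var X) = amp_sign X * mc"
proof -
  have "mono_wave mc (amp_var X) = (\<Sum>Y\<in>UNIV. if Y = X then amp_sign X * mc else 0)"
    unfolding mono_wave_def lookup_amp_var by (intro sum.cong) auto
  then show ?thesis by simp
qed

lemma mono_beta_amp_var [simp]: "mono_beta w (amp_var X) = amp_beta w X"
proof -
  have "mono_beta w (amp_var X) = (\<Sum>Y\<in>UNIV. if Y = X then amp_beta w X else 0)"
    unfolding mono_beta_def lookup_amp_var by (intro sum.cong) auto
  then show ?thesis by simp
qed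

text \<open>On the jets of \<open>\<psi>\<^sub>c\<close> and \<open>h\<^sub>2\<close> the derivative \<open>\<partial>\<^sub>x\<close> multiplies the amplitude monomial \<open>\<mu>\<close> by \<open>i m\<^sub>\<mu>\<close>.\<close>

definition wave_deriv :: "int \<Rightarrow> amp_poly \<Rightarrow> amp_poly" where
  "wave_deriv mc p = (\<Sum>\<mu>\<in>Poly_Mapping.keys p.
     Poly_Mapping.single \<mu> (\<i> * of_int (mono_wave mc \<mu>) * Poly_Mapping.lookup p \<mu>))"

lemma lookup_wave_deriv:
  "Poly_Mapping.lookup (wave_deriv mc p) \<mu> = \<i> * of_int (mono_wave mc \<mu>) * Poly_Mapping.lookup p \<mu>"
proof -
  have "Poly_Mapping.lookup (wave_deriv mc p) \<mu> = (\<Sum>\<nu>\<in>Poly_Mapping.keys p.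
      if \<nu> = \<mu> then \<i> * of_int (mono_wave mc \<mu>) * Poly_Mapping.lookup p \<mu> else 0)"
    unfolding wave_deriv_def lookup_sum by (intro sum.cong) (auto simp: lookup_single)
  then show ?thesis
    by (simp add: in_keys_iff)
qed

lemma wave_deriv_add: "wave_deriv mc (p + q) = wave_deriv mc p + wave_deriv mc q"
  by (intro poly_mapping_eqI) (simp add: lookup_wave_deriv lookup_add distrib_left)

lemma wave_deriv_single:
  "wave_deriv mc (Poly_Mapping.single \<mu> r) = Poly_Mapping.single \<mu> (\<i> * of_int (mono_wave mc \<mu>) * r)"
  by (intro poly_mapping_eqI) (auto simp: lookup_wave_deriv lookup_single when_def)

lemma wave_deriv_sum: "wave_deriv mc (sum f A) = (\<Sum>a\<in>A. wave_deriv mc (f a))"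
  by (intro poly_mapping_eqI) (simp add: lookup_wave_deriv lookup_sum sum_distrib_left)

lemma wave_deriv_mult: "wave_deriv mc (p * q) = wave_deriv mc p * q + p * wave_deriv mc q"
proof (induction p arbitrary: q rule: poly_mapping_add_induct)
  case (1 \<mu> r)
  show ?case
  proof (induction q rule: poly_mapping_add_induct)
    case (1 \<nu> s)
    show ?case
      by (simp add: mult_single wave_deriv_single mono_wave_add single_add[symmetric] algebra_simps)
  next
    case (2 p q)
    then show ?case
      by (simp add: wave_deriv_add distrib_left)
  qed
next
  case (2 p p')
  show ?case
    by (simp only: wave_deriv_add distrib_right 2) (simp only: ac_simps)
qed

interpretation wave: derivation amp_const "wave_deriv mc"
  by unfold_locales
    (simp_all add: wave_deriv_add wave_deriv_mult amp_const_def wave_deriv_single mono_wave_def)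

lemma wave_deriv_mode_jet: "wave_deriv mc (mode_jet mc Ms \<Phi> x (b, k)) = mode_jet mc Ms \<Phi> x (b, Suc k)"
  by (simp add: mode_jet_def wave_deriv_sum wave_deriv_single mult_ac)

lemma wave_deriv_psi_jet: "wave_deriv mc (psi_jet mc q x (b, k)) = psi_jet mc q x (b, Suc k)"
  by (simp add: psi_jet_def wave_deriv_sum wave_deriv_mode_jet)

lemma wave_deriv_h2_jet: "wave_deriv mc (h2_jet G N mc q x (b, k)) = h2_jet G N mc q x (b, Suc k)"
  by (simp add: h2_jet_def wave_deriv_mode_jet)

text \<open>i times this number is the Fourier symbol of the multiplier at wavenumber
  \<open>m\<close>.\<close>

definition kappa :: "real poly \<Rightarrow> int \<Rightarrow> real" where
  "kappa P m = of_int m * poly P (of_int (m ^ 2))"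

lemma lookup_wave_deriv_funpow:
  "Poly_Mapping.lookup ((wave_deriv mc ^^ n) p) \<mu>
      = (\<i> * of_int (mono_wave mc \<mu>)) ^ n * Poly_Mapping.lookup p \<mu>"
  by (induction n) (simp_all add: lookup_wave_deriv)

lemma lookup_amp_const_mult: "Poly_Mapping.lookup (amp_const r * p) \<mu> = of_real r * Poly_Mapping.lookup p \<mu>"
  by (induction p rule: poly_mapping_add_induct)
    (simp_all add: amp_const_def mult_single lookup_single when_def distrib_left lookup_add)

lemma lookup_two_mult: "Poly_Mapping.lookup (2 * p) \<mu> = 2 * Poly_Mapping.lookup p \<mu>" for p :: amp_poly
  unfolding mult_2 lookup_add ..

text \<open>Stated for abstract \<open>p\<close> and \<open>p'\<close> so that it applies to
  evaluation and linearization alike. The signs (-1)^k cancel against i^(2k), leaving P at the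
  square of the wavenumber.\<close>

lemma wave_symbol_multiplier:
  assumes "p = (\<Sum>k\<le>degree P. amp_const (coeff P k * (-1) ^ k) * (wave_deriv mc ^^ Suc (2 * k)) p')"
  shows "Poly_Mapping.lookup p \<mu> = \<i> * of_real (kappa P (mono_wave mc \<mu>)) * Poly_Mapping.lookup p' \<mu>"
proof -
  let ?m = "of_int (mono_wave mc \<mu>) :: complex"
  have "(- 1) ^ k * (- (?m ^ 2)) ^ k = (?m ^ 2) ^ k" for k
    unfolding power_mult_distrib[symmetric] by simp
  then have pow: "of_real (coeff P k * (-1) ^ k) * (\<i> * ?m) ^ Suc (2 * k)
      = \<i> * ?m * of_real (coeff P k * (of_int (mono_wave mc \<mu> ^ 2)) ^ k)" for k
    by (simp add: power_mult power_mult_distrib)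
  have "Poly_Mapping.lookup p \<mu> = (\<Sum>k\<le>degree P. of_real (coeff P k * (-1) ^ k) * (\<i> * ?m) ^ Suc (2 *
      k)) * Poly_Mapping.lookup p' \<mu>"
    unfolding assms lookup_sum lookup_amp_const_mult lookup_wave_deriv_funpow sum_distrib_right
        mult.assoc ..
  then show ?thesis
    unfolding pow by (simp add: kappa_def poly_altdef sum_distrib_left mult_ac)
qed

context
  fixes mc :: int and w h :: "jet_var \<Rightarrow> amp_poly"
  assumes w: "\<And>b k. wave_deriv mc (w (b, k)) = w (b, Suc k)"
begin

lemma lookup_deval_multiplier:
  "Poly_Mapping.lookup (deval amp_const w (multiplier P F $ a)) \<mu>
    = \<i> * of_real (kappa P (mono_wave mc \<mu>)) * Poly_Mapping.lookup (deval amp_const w (F $ a)) \<mu>"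
proof (rule wave_symbol_multiplier)
  have "deval amp_const w ((Dx ^^ n) p) = (wave_deriv mc ^^ n) (deval amp_const w p)" for n p
    by (induction n) (simp_all add: wave.deval_Dx[where w = w, OF w])
  then show "deval amp_const w (multiplier P F $ a)
    = (\<Sum>k\<le>degree P. amp_const (coeff P k * (-1) ^ k) * (wave_deriv mc ^^ Suc (2 * k)) (deval
        amp_const w (F $ a)))"
    by (simp add: multiplier_nth amp_hom.deval_sum amp_hom.deval_mult amp_hom.deval_dconst del:
        funpow.simps)
qed

lemma lookup_dlin_multiplier:
  assumes h: "\<And>b k. wave_deriv mc (h (b, k)) = h (b, Suc k)"
  shows "Poly_Mapping.lookup (dlin amp_const w h (multiplier P F $ a)) \<mu>
    = \<i> * of_real (kappa P (mono_wave mc \<mu>)) * Poly_Mapping.lookup (dlin amp_const w h (F $ a)) \<mu>"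
proof (rule wave_symbol_multiplier)
  have "dlin amp_const w h ((Dx ^^ n) p) = (wave_deriv mc ^^ n) (dlin amp_const w h p)" for n p
    by (induction n) (simp_all add: wave.dlin_Dx[where w = w and h = h, OF w h])
  then show "dlin amp_const w h (multiplier P F $ a)
    = (\<Sum>k\<le>degree P. amp_const (coeff P k * (-1) ^ k) * (wave_deriv mc ^^ Suc (2 * k)) (dlin
        amp_const w h (F $ a)))"
    by (simp add: multiplier_nth amp_hom.dlin_sum amp_hom.dlin_mult amp_hom.dlin_dconst
        amp_hom.deval_dconst del: funpow.simps)
qed

end

section \<open>Coefficients of products of linear forms in the amplitudes\<close>

definition linear_form :: "(amp \<Rightarrow> complex) \<Rightarrow> amp_poly" where
  "linear_form y = (\<Sum>X\<in>UNIV. Poly_Mapping.single (amp_var X) (y X))"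

lemma lookup_single_mult:
  fixes q :: amp_poly
  shows "Poly_Mapping.lookup (Poly_Mapping.single (amp_var X) c * q) \<mu>
    = (if Poly_Mapping.lookup \<mu> X = 0 then 0 else c * Poly_Mapping.lookup q (\<mu> - amp_var X))"
proof (induction q rule: poly_mapping_add_induct)
  case (1 \<nu> d)
  have "amp_var X + \<nu> = \<mu> \<longleftrightarrow> Poly_Mapping.lookup \<mu> X \<noteq> 0 \<and> \<nu> = \<mu> - amp_var X"
    using monomial_split[of \<mu> X] by (auto simp: lookup_add lookup_amp_var amp_var_def)
  then show ?case
    by (auto simp: mult_single lookup_single when_def)
next
  case (2 p q)
  then show ?case
    by (auto simp: distrib_left lookup_add)
qed

lemma lookup_linear_form_mult:
  "Poly_Mapping.lookup (linear_form y * q) \<mu> = (\<Sum>X\<in>UNIV. if Poly_Mapping.lookup \<mu> X = 0 then 0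
     else y X * Poly_Mapping.lookup q (\<mu> - amp_var X))"
  by (simp only: linear_form_def sum_distrib_right lookup_sum lookup_single_mult)

lemma lookup_linear_form: "Poly_Mapping.lookup (linear_form y) (amp_var X) = y X"
  by (simp add: linear_form_def lookup_sum lookup_single when_def)

lemma lookup_linear_form_mult2:
  assumes "X \<noteq> Y"
  shows "Poly_Mapping.lookup (linear_form y * linear_form z) (amp_pair X Y) = y X * z Y + y Y * z X"
proof -
  have "Poly_Mapping.lookup (linear_form y * linear_form z) (amp_pair X Y)
      = (\<Sum>Z\<in>UNIV. (if Z = X then y X * z Y else 0) + (if Z = Y then y Y * z X else 0))"
    unfolding lookup_linear_form_mult
    using assms lookup_linear_form[of z X] lookup_linear_form[of z Y]
    by (intro sum.cong) (auto simp: lookup_add lookup_amp_var)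
  then show ?thesis
    by (simp add: sum.distrib)
qed

text \<open>Each term takes one amplitude from the linear form and leaves the complementary pair to
  \<open>q\<close>. This factor stays arbitrary: it is a product of linear forms in the cubic part
  of xi and a component of \<open>h2_jet\<close> in the quadratic one.\<close>

lemma lookup_linear_form_mult3:
  assumes "X \<noteq> Y" "X \<noteq> Z" "Y \<noteq> Z"
  shows "Poly_Mapping.lookup (linear_form y * q) (amp_pair X Y + amp_var Z)
    = y X * Poly_Mapping.lookup q (amp_pair Y Z) + y Y * Poly_Mapping.lookup q (amp_pair X Z)
      + y Z * Poly_Mapping.lookup q (amp_pair X Y)"
proof -
  let ?l = "Poly_Mapping.lookup q"
  have "amp_pair X Y + amp_var Z - amp_var X = amp_pair Y Z"
    "amp_pair X Y + amp_var Z - amp_var Y = amp_pair X Z"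
    "amp_pair X Y + amp_var Z - amp_var Z = amp_pair X Y"
    by (auto intro!: poly_mapping_eqI simp: lookup_add lookup_minus)
  then have "Poly_Mapping.lookup (linear_form y * q) (amp_pair X Y + amp_var Z)
      = (\<Sum>W\<in>UNIV. (if W = X then y X * ?l (amp_pair Y Z) else 0) + (if W
          = Y then y Y * ?l (amp_pair X Z) else 0)
          + (if W = Z then y Z * ?l (amp_pair X Y) else 0))"
    unfolding lookup_linear_form_mult using assms
    by (intro sum.cong) (auto simp: lookup_add lookup_amp_var)
  then show ?thesis
    by (simp add: sum.distrib)
qed

lemma lookup_linear_form_mult_ABBbar:
  "Poly_Mapping.lookup (linear_form y * q) mono_ABBbar
    = y AmpA * Poly_Mapping.lookup q (amp_pair AmpB AmpBbar)
        + y AmpB * Poly_Mapping.lookup q (amp_pair AmpA AmpBbar)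
      + y AmpBbar * Poly_Mapping.lookup q (amp_pair AmpA AmpB)"
  unfolding mono_ABBbar_eq by (rule lookup_linear_form_mult3) simp_all

text \<open>Of the pairs contained in A B Bbar only A B escapes wavenumber zero, where
  \<open>Phi\<close> is zero by definition.\<close>

lemma wave_pairs:
  "mono_wave mc (amp_pair AmpA AmpB) = 2 * mc" "mono_wave mc (amp_pair AmpA AmpBbar) = 0"
  "mono_wave mc (amp_pair AmpB AmpBbar) = 0" "mono_wave mc mono_ABBbar = mc"
  by (simp_all add: mono_ABBbar_eq mono_wave_add)

section \<open>Fourier modes of the critical wave and the projection\<close>

definition wave_exp :: "int \<Rightarrow> real \<Rightarrow> complex" where
  "wave_exp m x = exp (\<i> * of_int m * of_real x)"

lemma wave_exp_nonzero [simp]: "wave_exp m x \<noteq> 0"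
  by (simp add: wave_exp_def)

lemma wave_exp_double: "wave_exp (2 * m) x = wave_exp m x * wave_exp m x"
  unfolding wave_exp_def exp_add[symmetric] by (simp add: algebra_simps)

lemma wave_exp_uminus: "wave_exp (- m) x = inverse (wave_exp m x)"
  by (simp add: wave_exp_def exp_minus)

lemma wave_exp_cnj: "wave_exp m x * cnj (wave_exp m x) = 1"
  by (simp add: wave_exp_def exp_cnj flip: exp_add)

definition psi_coeff :: "int \<Rightarrow> complex^2 \<Rightarrow> real \<Rightarrow> 2 \<Rightarrow> amp \<Rightarrow> complex" where
  "psi_coeff mc q x b X = wave_exp (amp_sign X * mc) x * amp_vec q X $ b"

lemma psi_jet_zero: "psi_jet mc q x (b, 0) = linear_form (psi_coeff mc q x b)"
  unfolding psi_jet_def mode_jet_def linear_form_def psi_coeff_def wave_exp_def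
      amp_var_def[symmetric] by simp

lemma R0_mult_complex: "(R0 *v v) $ 1 = v $ 1" "(R0 *v v) $ 2 = - v $ 2" for v :: "complex^2"
  by (simp_all add: R0_def matrix_vector_mult_def sum_2)

lemma amp_vec_nth:
  "amp_vec q AmpA $ b = q $ b"
  "amp_vec q AmpB $ 1 = - cnj (q $ 1)" "amp_vec q AmpB $ 2 = cnj (q $ 2)"
  "amp_vec q AmpBbar $ 1 = - q $ 1" "amp_vec q AmpBbar $ 2 = q $ 2"
  by (simp_all add: qB_def cvec_def R0_mult_complex)

lemma psi_coeff_nth:
  "psi_coeff mc q x b AmpA = wave_exp mc x * q $ b"
  "psi_coeff mc q x 1 AmpB = - wave_exp mc x * cnj (q $ 1)"
  "psi_coeff mc q x 2 AmpB = wave_exp mc x * cnj (q $ 2)"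
  "psi_coeff mc q x 1 AmpBbar = - inverse (wave_exp mc x) * q $ 1"
  "psi_coeff mc q x 2 AmpBbar = inverse (wave_exp mc x) * q $ 2"
  unfolding psi_coeff_def amp_vec_nth by (simp_all add: wave_exp_uminus)

lemma coeff_psi_quad:
  "coeff_psi (amp_pair AmpA AmpB) (multiplier P (quad_flux a b c)) mc q x
   = wave_exp (2 * mc) x *s
      ((\<i> * of_real (kappa P (2 * mc))) *s
        vector [of_real a * (q $ 1 * cnj (q $ 2) - cnj (q $ 1) * q $ 2),
          2 * of_real c * (q $ 2 * cnj (q $ 2)) - 2 * of_real b * (q $ 1 * cnj (q $ 1))])"
  by (simp add: vec_eq_iff forall_2 coeff_psi_def lookup_deval_multiplier[where w
      = "psi_jet mc q x", OF wave_deriv_psi_jet] wave_pairs wave_exp_double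
      quad_flux_def amp_hom.deval_add amp_hom.deval_dmono psi_jet_zero lookup_add lookup_amp_const_mult
      mult.assoc power2_eq_square lookup_linear_form_mult2 psi_coeff_nth)
    (simp add: algebra_simps)

text \<open>In the coefficient of u^2 v, taking v from A and from Bbar gives opposite multiples of
  |u|^2 v, which cancel; taking it from B leaves -2 u^2 cnj v. The monomial u v^2 behaves likewise,
  while a cube gives six equal terms.\<close>

lemma coeff_psi_cubic:
  "coeff_psi mono_ABBbar (multiplier P (cubic_flux a b c d)) mc q x
   = wave_exp mc x *s
      ((\<i> * of_real (kappa P mc)) *s
        vector [6 * of_real b * (q $ 2 * cnj (q $ 2) * q $ 2) - 2 * of_real a * ((q $ 1) ^ 2 * cnj (q $ 2)),
          6 * of_real c * (q $ 1 * cnj (q $ 1) * q $ 1) - 2 * of_real d * (cnj (q $ 1) * (q $ 2) ^ 2)])"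
  by (simp add: vec_eq_iff forall_2 coeff_psi_def lookup_deval_multiplier[where w
      = "psi_jet mc q x", OF wave_deriv_psi_jet] wave_pairs
        cubic_flux_def amp_hom.deval_add amp_hom.deval_dmono psi_jet_zero lookup_add lookup_amp_const_mult
        mult.assoc power2_eq_square power3_eq_cube lookup_linear_form_mult2
            lookup_linear_form_mult_ABBbar psi_coeff_nth)
      (simp add: field_simps)

lemma Proj1_exp:
  "Proj1 mc q (\<lambda>x. wave_exp mc x *s w)
    = (w $ 1 * cnj (q $ 2) + w $ 2 * cnj (q $ 1)) / of_real (2 * r_c q)"
proof -
  have "(\<Sum>a\<in>UNIV. (wave_exp mc x *s w) $ a * cnj ((wave_exp mc x *s q1star q) $ a))
      = wave_exp mc x * cnj (wave_exp mc x) * (\<Sum>a\<in>UNIV. w $ a * cnj (q1star q $ a))" for x :: real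
    by (simp add: sum_2 algebra_simps)
  then have "Proj1 mc q (\<lambda>x. wave_exp mc x *s w)
      = of_real (2 * pi) * (\<Sum>a\<in>UNIV. w $ a * cnj (q1star q $ a))"
    unfolding Proj1_def inner_L2_def wave_exp_def[symmetric]
    by (simp only: wave_exp_cnj) (simp add: scaleR_conv_of_real)
  also have "(\<Sum>a\<in>UNIV. w $ a * cnj (q1star q $ a))
      = (w $ 1 * cnj (q $ 2) + w $ 2 * cnj (q $ 1)) / of_real (4 * pi * r_c q)"
    by (simp add: sum_2 q1star_def Smat_mult_nth add_divide_distrib)
  \<comment> \<open>For \<open>r = 0\<close> both sides are zero by the convention for
    division.\<close>
  also have "of_real (2 * pi) * (X / of_real (4 * pi * r)) = X / complex_of_real (2 * r)" for X r
    by (cases "r = 0") (simp_all add: field_simps)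
  finally show ?thesis .
qed

text \<open>\<open>h2_jet\<close> sums over all amplitude monomials of degree 2, and over an
  infinite index set such a sum would be zero by default.\<close>

lemma finite_mono_deg: "finite {\<mu> :: amp_mono. mdeg \<mu> = n}"
proof -
  have "Poly_Mapping.lookup \<mu> X \<le> mdeg \<mu>" for \<mu> :: amp_mono and X
    by (subst mdeg_superset[of UNIV]) (auto intro: member_le_sum)
  then have "Poly_Mapping.lookup ` {\<mu> :: amp_mono. mdeg \<mu> = n} \<subseteq> (UNIV \<rightarrow>\<^sub>E {..n})"
    by auto
  then have "finite (Poly_Mapping.lookup ` {\<mu> :: amp_mono. mdeg \<mu> = n})"
    by (rule finite_subset) (auto intro: finite_PiE)
  then show ?thesis
    by (rule finite_imageD) (simp add: inj_on_def flip: poly_mapping_eq_iff)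
qed

lemma lookup_h2_jet:
  assumes "mdeg \<mu> = 2"
  shows "Poly_Mapping.lookup (h2_jet G N mc q x (b, 0)) \<mu>
    = wave_exp (mono_wave mc \<mu>) x * Phi G N mc q \<mu> $ b"
proof -
  have "Poly_Mapping.lookup (h2_jet G N mc q x (b, 0)) \<mu>
      = (\<Sum>\<nu> | mdeg \<nu> = 2. if \<nu> = \<mu> then wave_exp (mono_wave mc \<mu>) x * Phi G N mc q \<mu> $ b else 0)"
    unfolding h2_jet_def mode_jet_def wave_exp_def
        by (simp add: lookup_sum lookup_single when_def) (intro sum.cong, auto)
  then show ?thesis
    using assms finite_mono_deg by simp
qed

lemma c12_eq:
  assumes "hom_part 2 G = multiplier P (quad_flux a b c)" and "\<Phi> = Phi G N mc q (amp_pair AmpA AmpB)"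
  shows "c12 G N mc q = \<i> * of_real (kappa P mc) *
    (of_real a * (q $ 2 * \<Phi> $ 1 - q $ 1 * \<Phi> $ 2) * cnj (q $ 2)
      + (2 * of_real c * q $ 2 * \<Phi> $ 2 - 2 * of_real b * q $ 1 * \<Phi> $ 1) * cnj (q $ 1)) / of_real (2
          * r_c q)"
proof -
  have P0: "Phi G N mc q (amp_pair AmpA AmpBbar) = 0" "Phi G N mc q (amp_pair AmpB AmpBbar) = 0"
    unfolding Phi_def wave_pairs by simp_all
  have deg: "mdeg (amp_pair X Y) = 2" for X Y :: amp
    by (simp add: mdeg_add amp_var_def)
  \<comment> \<open>Only the splitting of A B Bbar into Bbar from the critical wave and A B from the
    center manifold survives.\<close>
  have prod: "Poly_Mapping.lookup (linear_form y * h2_jet G N mc q x (i, 0)) mono_ABBbar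
      = y AmpBbar * (wave_exp (2 * mc) x * \<Phi> $ i)" for y x i
    unfolding lookup_linear_form_mult_ABBbar lookup_h2_jet[OF deg] P0 wave_pairs assms(2)[symmetric] by simp
  have "(\<lambda>x. \<chi> i. Poly_Mapping.lookup (dlin amp_const (psi_jet mc q x) (h2_jet G N mc q x) (hom_part
      2 G $ i)) mono_ABBbar)
    = (\<lambda>x. wave_exp mc x *s ((\<i> * of_real (kappa P mc)) *s
         vector [of_real a * (q $ 2 * \<Phi> $ 1 - q $ 1 * \<Phi> $ 2), 2 * of_real c * q $ 2 * \<Phi> $ 2 - 2 *
             of_real b * q $ 1 * \<Phi> $ 1]))"
    (is "?l = ?r")
  proof
    fix x
    show "?l x = ?r x"
      unfolding assms(1) vec_eq_iff forall_2
      by (simp add: lookup_dlin_multiplier[where w = "psi_jet mc q x" and h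
          = "h2_jet G N mc q x", OF wave_deriv_psi_jet wave_deriv_h2_jet] wave_pairs quad_flux_def dmono_def
        amp_hom.dlin_add amp_hom.dlin_mult amp_hom.dlin_dconst amp_hom.dlin_dvar amp_hom.deval_mult
        amp_hom.deval_dconst amp_hom.deval_dvar power2_eq_square psi_jet_zero lookup_add
            lookup_amp_const_mult
        distrib_left mult.assoc mult.commute[of "h2_jet G N mc q _ _"] prod psi_coeff_nth
            wave_exp_double lookup_two_mult)
        (simp add: field_simps)
  qed
  then show ?thesis
    unfolding c12_def by (simp only: Proj1_exp) (simp add: algebra_simps)
qed

text \<open>The frequencies of A and B cancel, so the system for the mode A B has minus the symbol
  at \<open>2 * mc\<close> as its matrix and is solved by Cramer's rule. The determinant is \<alpha>
  \<delta> + \<beta> \<gamma> because the off-diagonal entries are imaginary. The solution has a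
  real first and an imaginary second component.\<close>

lemma Phi_AB:
  fixes \<alpha> \<beta> \<gamma> \<delta> :: real
  assumes G: "hom_part 2 G = multiplier P (quad_flux a b c)" and mc: "mc \<noteq> 0"
    and M: "symbol N (2 * mc) = vector [vector [of_real \<alpha>, \<i> * of_real \<beta>], vector [\<i> * of_real \<gamma>,
        of_real \<delta>]]"
    and \<Delta>: "\<Delta> = \<alpha> * \<delta> + \<beta> * \<gamma>" "\<Delta> \<noteq> 0"
    and J: "J = Im (q $ 1 * cnj (q $ 2))" and E: "E = c * cmod (q $ 2) ^ 2 - b * cmod (q $ 1) ^ 2"
  shows "Phi G N mc q (amp_pair AmpA AmpB)
    = vector [of_real (2 * kappa P (2 * mc) / \<Delta> * (\<delta> * a * J - \<beta> * E)),
        - \<i> * of_real (2 * kappa P (2 * mc) / \<Delta> * (\<gamma> * a * J + \<alpha> * E))]"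
proof -
  have w: "mono_wave mc (amp_pair AmpA AmpB) = 2 * mc" "mono_beta om (amp_pair AmpA AmpB) = 0" for om
    by (simp_all add: mono_wave_add mono_beta_add)
  have uv: "q $ 1 * cnj (q $ 2) - cnj (q $ 1) * q $ 2 = 2 * \<i> * of_real J"
    "q $ 2 * cnj (q $ 2) = of_real (cmod (q $ 2) ^ 2)" "q $ 1 * cnj (q $ 1) = of_real (cmod (q $ 1) ^ 2)"
    by (simp_all add: J complex_eq_iff complex_norm_square[symmetric])
  define k where "k = kappa P (2 * mc)"
  have vec: "(\<i> * of_real (kappa P (2 * mc))) *s
        vector [of_real a * (q $ 1 * cnj (q $ 2) - cnj (q $ 1) * q $ 2),
          2 * of_real c * (q $ 2 * cnj (q $ 2)) - 2 * of_real b * (q $ 1 * cnj (q $ 1))]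
      = (vector [of_real (- 2 * k * a * J), \<i> * of_real (2 * k * E)] :: complex^2)"
    unfolding uv by (simp add: vec_eq_iff forall_2 k_def E algebra_simps)
  \<comment> \<open>The description in \<open>ghat\<close> is unique because the exponential never
    vanishes.\<close>
  have gh: "ghat G mc q (amp_pair AmpA AmpB) = vector [of_real (- 2 * k * a * J), \<i> * of_real (2 * k * E)]"
    unfolding ghat_def G coeff_psi_quad w vec wave_exp_def[symmetric]
    by (rule the_equality) (metis vector_mul_lcancel wave_exp_nonzero)+
  have lin: "(mat 0 - symbol N (2 * mc)) *v v = vector [of_real (- 2 * k * a * J), \<i> * of_real (2 *
      k * E)] \<longleftrightarrow>
      of_real \<alpha> * v $ 1 + \<i> * of_real \<beta> * v $ 2 = of_real (2 * k * a * J)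
      \<and> \<i> * of_real \<gamma> * v $ 1 + of_real \<delta> * v $ 2 = - \<i> * of_real (2 * k * E)" for v
  proof -
    have "-(x::complex) - y = z \<longleftrightarrow> x + y = - z" for x y z
      using neg_equal_iff_equal[of "x + y" "- z"] by simp
    then show ?thesis
      by (simp add: M matrix_vector_mult_def sum_2 vec_eq_iff forall_2 mat_def)
  qed
  have "Phi G N mc q (amp_pair AmpA AmpB) = (THE v. of_real \<alpha> * v $ 1 + \<i> * of_real \<beta> * v $ 2
      = of_real (2 * k * a * J)
      \<and> \<i> * of_real \<gamma> * v $ 1 + of_real \<delta> * v $ 2 = - \<i> * of_real (2 * k * E))"
    unfolding Phi_def w gh lin using mc by simp
  also have "\<dots> = vector [of_real (2 * k / \<Delta> * (\<delta> * a * J - \<beta> * E)), - \<i> * of_real (2 * k / \<Delta> * (\<gamma> *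
      a * J + \<alpha> * E))]"
  proof (rule the_equality)
    show "of_real \<alpha> * vector [of_real (2 * k / \<Delta> * (\<delta> * a * J - \<beta> * E)), - \<i> * of_real (2 * k / \<Delta> *
        (\<gamma> * a * J + \<alpha> * E))] $ (1::2)
        + \<i> * of_real \<beta> * vector [of_real (2 * k / \<Delta> * (\<delta> * a * J - \<beta> * E)), - \<i> * of_real (2 * k /
            \<Delta> * (\<gamma> * a * J + \<alpha> * E))] $ (2::2)
         = complex_of_real (2 * k * a * J) \<and>
      \<i> * of_real \<gamma> * vector [of_real (2 * k / \<Delta> * (\<delta> * a * J - \<beta> * E)), - \<i> * of_real (2 * k / \<Delta> *
          (\<gamma> * a * J + \<alpha> * E))] $ (1::2)
        + of_real \<delta> * vector [of_real (2 * k / \<Delta> * (\<delta> * a * J - \<beta> * E)), - \<i> * of_real (2 * k / \<Delta> *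
            (\<gamma> * a * J + \<alpha> * E))] $ (2::2)
         = - \<i> * complex_of_real (2 * k * E)"
      using \<Delta>(2) by (simp add: complex_eq_iff divide_simps) (simp add: \<Delta>(1) algebra_simps)
  next
    fix v :: "complex^2"
    assume v: "of_real \<alpha> * v $ 1 + \<i> * of_real \<beta> * v $ 2 = of_real (2 * k * a * J)
      \<and> \<i> * of_real \<gamma> * v $ 1 + of_real \<delta> * v $ 2 = - \<i> * of_real (2 * k * E)"
    have "of_real \<Delta> * v $ 1 = of_real \<delta> * (of_real \<alpha> * v $ 1 + \<i> * of_real \<beta> * v $ 2)
        - \<i> * of_real \<beta> * (\<i> * of_real \<gamma> * v $ 1 + of_real \<delta> * v $ 2)"
      by (simp add: \<Delta>(1) algebra_simps)
    also have "\<dots> = of_real (2 * k * (\<delta> * a * J - \<beta> * E))"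
      using v by (simp add: algebra_simps)
    finally have 1: "v $ 1 = of_real (2 * k / \<Delta> * (\<delta> * a * J - \<beta> * E))"
      using \<Delta>(2) by (simp add: field_simps)
    have "of_real \<Delta> * v $ 2 = of_real \<alpha> * (\<i> * of_real \<gamma> * v $ 1 + of_real \<delta> * v $ 2)
        - \<i> * of_real \<gamma> * (of_real \<alpha> * v $ 1 + \<i> * of_real \<beta> * v $ 2)"
      by (simp add: \<Delta>(1) algebra_simps)
    also have "\<dots> = - \<i> * of_real (2 * k * (\<gamma> * a * J + \<alpha> * E))"
      using v by (simp add: algebra_simps)
    finally have 2: "v $ 2 = - \<i> * of_real (2 * k / \<Delta> * (\<gamma> * a * J + \<alpha> * E))"
      using \<Delta>(2) by (simp add: field_simps)
    from 1 2 show "v = vector [of_real (2 * k / \<Delta> * (\<delta> * a * J - \<beta> * E)), - \<i> * of_real (2 * k / \<Delta> *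
        (\<gamma> * a * J + \<alpha> * E))]"
      by (simp add: vec_eq_iff forall_2)
  qed
  finally show ?thesis
    by (simp only: k_def)
qed

text \<open>The prefactor i times \<open>kappa P mc\<close> turns real parts into imaginary parts.
  After projection the terms with b' and c' are real multiples of |v|^4 and |u|^4 and drop out; so
  does the first component of \<open>Phi\<close>, which is real and meets only |v|^2 and |u|^2. What
  remains has the variational defects a' - d' and a - 2c as factors.\<close>

lemma Re_xi:
  fixes \<alpha> \<beta> \<gamma> \<delta> :: real
  assumes G2: "hom_part 2 G = multiplier P (quad_flux a b c)"
    and G3: "hom_part 3 G = multiplier P (cubic_flux a' b' c' d')" and mc: "mc \<noteq> 0"
    and M: "symbol N (2 * mc) = vector [vector [of_real \<alpha>, \<i> * of_real \<beta>], vector [\<i> * of_real \<gamma>,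
        of_real \<delta>]]"
    and \<Delta>: "\<Delta> = \<alpha> * \<delta> + \<beta> * \<gamma>" "\<Delta> \<noteq> 0"
    and J: "J = Im (q $ 1 * cnj (q $ 2))" and E: "E = c * cmod (q $ 2) ^ 2 - b * cmod (q $ 1) ^ 2"
  shows "Re (xi G N mc q) = kappa P mc / (2 * r_c q) *
    (2 * (a' - d') * Im ((q $ 1 * cnj (q $ 2)) ^ 2)
      - 2 * kappa P (2 * mc) / \<Delta> * (\<gamma> * a * J + \<alpha> * E) * (a - 2 * c) * r_c q)"
proof -
  have Re: "Re (\<i> * of_real k * z / of_real r) = - (k / r) * Im z" for k r z
    by (simp add: Re_divide_of_real)
  let ?u = "q $ 1" and ?v = "q $ 2"
  have s: "s12 G mc q = \<i> * of_real (kappa P mc) *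
      ((6 * of_real b' * (?v * cnj ?v * ?v) - 2 * of_real a' * (?u ^ 2 * cnj ?v)) * cnj ?v
        + (6 * of_real c' * (?u * cnj ?u * ?u) - 2 * of_real d' * (cnj ?u * ?v ^ 2)) * cnj ?u) /
            of_real (2 * r_c q)"
    unfolding s12_def G3 coeff_psi_cubic Proj1_exp by (simp add: algebra_simps)
  have "Re (s12 G mc q) = kappa P mc / (2 * r_c q) * (2 * (a' - d') * Im ((?u * cnj ?v) ^ 2))"
    unfolding s Re by (simp add: power2_eq_square algebra_simps)
  moreover have "Re (c12 G N mc q) = kappa P mc / (2 * r_c q) *
      (- 2 * kappa P (2 * mc) / \<Delta> * (\<gamma> * a * J + \<alpha> * E) * (a - 2 * c) * r_c q)"
  proof -
    define p s where "p = 2 * kappa P (2 * mc) / \<Delta> * (\<delta> * a * J - \<beta> * E)"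
      and "s = 2 * kappa P (2 * mc) / \<Delta> * (\<gamma> * a * J + \<alpha> * E)"
    have "c12 G N mc q = \<i> * of_real (kappa P mc) *
      (of_real a * (?v * of_real p - ?u * (- \<i> * of_real s)) * cnj ?v
      + (2 * of_real c * ?v * (- \<i> * of_real s) - 2 * of_real b * ?u * of_real p) * cnj ?u) /
          of_real (2 * r_c q)"
      using c12_eq[OF G2, of _ N mc q] Phi_AB[OF G2 mc M \<Delta> J E] by (simp only: p_def s_def vector_2)
    moreover have "Im (of_real a * (?v * of_real p - ?u * (- \<i> * of_real s)) * cnj ?v
      + (2 * of_real c * ?v * (- \<i> * of_real s) - 2 * of_real b * ?u * of_real p) * cnj ?u)
          = s * (a - 2 * c) * r_c q"
      by (simp add: r_c_def algebra_simps)
    ultimately have "Re (c12 G N mc q) = - (kappa P mc / (2 * r_c q)) * (s * (a - 2 * c) * r_c q)"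
      by (simp only: Re)
    then show ?thesis
      by (simp add: s_def)
  qed
  ultimately show ?thesis
    by (simp add: xi_def ring_distribs)
qed

section \<open>Admissible linear parts\<close>

definition eval_of_real :: "real poly \<Rightarrow> complex \<Rightarrow> complex" where
  "eval_of_real p z = poly (map_poly of_real p) z"

lemma eval_of_real_pCons: "eval_of_real (pCons a p) z = of_real a + z * eval_of_real p z"
  by (simp add: eval_of_real_def map_poly_pCons)

lemma eval_of_real_zero: "eval_of_real 0 z = 0"
  by (simp add: eval_of_real_def)

lemma eval_of_real_add: "eval_of_real (p + q) z = eval_of_real p z + eval_of_real q z"
proof -
  have "map_poly of_real (p + q) = map_poly of_real p + (map_poly of_real q :: complex poly)"
    by (intro poly_eqI) (simp add: coeff_map_poly)
  then show ?thesis by (simp add: eval_of_real_def)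
qed

lemma eval_of_real_smult: "eval_of_real (smult c p) z = of_real c * eval_of_real p z"
proof -
  have "map_poly of_real (smult c p) = smult (of_real c) (map_poly of_real p :: complex poly)"
    by (intro poly_eqI) (simp add: coeff_map_poly)
  then show ?thesis by (simp add: eval_of_real_def)
qed

lemma eval_of_real_diff: "eval_of_real (p - q) z = eval_of_real p z - eval_of_real q z"
  using eval_of_real_add[of p "smult (-1) q" z] unfolding eval_of_real_smult by simp

lemma eval_of_real_mult: "eval_of_real (p * q) z = eval_of_real p z * eval_of_real q z"
  by (induction p)
    (simp_all add: eval_of_real_zero eval_of_real_pCons eval_of_real_add eval_of_real_smult algebra_simps)

lemma eval_of_real_power: "eval_of_real (p ^ n) z = eval_of_real p z ^ n"
  by (induction n)
    (simp_all add: eval_of_real_mult one_pCons eval_of_real_pCons eval_of_real_zero)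

lemma eval_of_real_sum: "eval_of_real p z = (\<Sum>k\<le>degree p. of_real (coeff p k) * z ^ k)"
  by (simp add: eval_of_real_def poly_altdef degree_map_poly coeff_map_poly)

lemma symbol_nth: "symbol N m $ a $ b = eval_of_real (N $ a $ b) (\<i> * of_int m)"
  by (simp add: symbol_def eval_of_real_def)

lemma deriv_cos_mode:
  "(deriv ^^ k) (\<lambda>y. cos (real n * y)) x = Re ((\<i> * of_nat n) ^ k * exp (\<i> * of_nat n * of_real x))"
proof -
  let ?f = "\<lambda>x::real. exp (\<i> * of_nat n * of_real x)"
  have "((\<lambda>x. Re ((\<i> * of_nat n) ^ k * ?f x)) has_real_derivative Re ((\<i> * of_nat n) ^ Suc k * ?f
      x)) (at x)" for k x
  proof -
    have "(exp has_field_derivative exp (\<i> * of_nat n * of_real x)) (at (\<i> * of_nat n * of_real x))"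
      by (rule DERIV_exp)
    moreover have "((\<lambda>x. \<i> * of_nat n * of_real x) has_vector_derivative \<i> * of_nat n) (at x)"
      by (auto intro!: derivative_eq_intros)
    ultimately have "(?f has_vector_derivative (\<i> * of_nat n) * ?f x) (at x)"
      using field_vector_diff_chain_at[of "\<lambda>x. \<i> * of_nat n * of_real x" _ x exp] by (simp add: o_def)
    then have "((\<lambda>x. (\<i> * of_nat n) ^ k * ?f x) has_vector_derivative (\<i> * of_nat n) ^ k * ((\<i> *
        of_nat n) * ?f x)) (at x)"
      by (rule has_vector_derivative_mult_right)
    then have "((\<lambda>x. Re ((\<i> * of_nat n) ^ k * ?f x)) has_vector_derivative Re ((\<i> * of_nat n) ^ k *
        ((\<i> * of_nat n) * ?f x))) (at x)"
      by (rule bounded_linear.has_vector_derivative[OF bounded_linear_Re])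
    then show ?thesis
      by (simp add: has_real_derivative_iff_has_vector_derivative mult_ac)
  qed
  from funpow_deriv_eq[of "\<lambda>k x. Re ((\<i> * of_nat n) ^ k * ?f x)", OF this, of k]
  show ?thesis
    by (simp add: Re_exp fun_eq_iff)
qed

lemma lin_op_cos_mode:
  "lin_op N (cos_mode n n s t) x $ a
    = s * Re (symbol N (int n) $ a $ 1 * exp (\<i> * of_nat n * of_real x))
      + t * Re (symbol N (int n) $ a $ 2 * exp (\<i> * of_nat n * of_real x))"
proof -
  have *: "(\<Sum>k\<le>degree p. coeff p k * (deriv ^^ k) (\<lambda>y. s * cos (real n * y)) x)
      = s * Re (eval_of_real p (\<i> * of_nat n) * exp (\<i> * of_nat n * of_real x))" for p s
  proof -
    have "smooth_fun (\<lambda>y. cos (real n * y))"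
      using smooth_fun_cos[of 1 "real n"] by simp
    then have "(\<Sum>k\<le>degree p. coeff p k * (deriv ^^ k) (\<lambda>y. s * cos (real n * y)) x)
        = (\<Sum>k\<le>degree p. s * Re (of_real (coeff p k) * (\<i> * of_nat n) ^ k * exp (\<i> * of_nat n * of_real x)))"
      by (simp add: deriv_scale deriv_cos_mode mult.assoc mult.left_commute[of _ s])
    then show ?thesis
      by (simp add: eval_of_real_sum sum_distrib_right sum_distrib_left mult.assoc)
  qed
  show ?thesis
    by (simp add: lin_op_def sum_2 cos_mode_def * symbol_nth)
qed

lemma Re_mult_wave: "Re (z * exp (\<i> * of_nat n * of_real x))
    = Re z * cos (real n * x) - Im z * sin (real n * x)"
  by (simp add: Re_exp Im_exp)

text \<open>Reflection equivariance is tested on single cosine modes. The point x = 0 exposes the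
  real part of an entry and the quarter period its imaginary part; parity makes one of the two
  vanish.\<close>

lemma symbol_form:
  assumes N: "O2_equivariant (lin_op N)" and n: "n > 0"
  obtains \<alpha> \<beta> \<gamma> \<delta> :: real where
    "symbol N (int n) = vector [vector [of_real \<alpha>, \<i> * of_real \<beta>], vector [\<i> * of_real \<gamma>, of_real \<delta>]]"
    "det_sym N (int n) = \<alpha> * \<delta> + \<beta> * \<gamma>"
proof -
  let ?z = "\<lambda>a b. symbol N (int n) $ a $ b"
  have eq: "lin_op N (cos_mode n n s (- t)) x $ a = (if a
      = 1 then 1 else -1) * lin_op N (cos_mode n n s t) (- x) $ a" for s t x a
    using N cos_mode_phase_space[OF n n, of s t]
    unfolding O2_equivariant_def by (simp add: reflect_nth flip: reflect_cos_mode)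
  have quarter: "real n * (pi / (2 * real n)) = pi / 2"
    using n by simp
  have "Im (?z 1 1) = 0" "Im (?z 2 2) = 0" "Re (?z 1 2) = 0" "Re (?z 2 1) = 0"
    using eq[of 1 0 "pi / (2 * real n)" 1] eq[of 0 1 "pi / (2 * real n)" 2] eq[of 0 1 0 1] eq[of 1 0 0 2]
    unfolding lin_op_cos_mode Re_mult_wave mult_minus_right quarter by simp_all
  then have z: "?z 1 1 = of_real (Re (?z 1 1))" "?z 2 2 = of_real (Re (?z 2 2))"
    "?z 1 2 = \<i> * of_real (Im (?z 1 2))" "?z 2 1 = \<i> * of_real (Im (?z 2 1))"
    by (simp_all add: complex_eq_iff)
  show thesis
  proof (rule that)
    show "symbol N (int n) = vector [vector [of_real (Re (?z 1 1)), \<i> * of_real (Im (?z 1 2))],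
        vector [\<i> * of_real (Im (?z 2 1)), of_real (Re (?z 2 2))]]"
      using z by (simp add: vec_eq_iff forall_2)
    show "det_sym N (int n) = Re (?z 1 1) * Re (?z 2 2) + Im (?z 1 2) * Im (?z 2 1)"
      unfolding det_sym_def det_2 by (subst z(1), subst z(2), subst z(3), subst z(4)) simp
  qed
qed

text \<open>The determinant at \<open>2 * mc\<close> is positive at a Hopf crossing, so
  \<open>Re_xi\<close> applies to every admissible family. The second alternative gives the
  implication from variationality, the first the resonant counterexample.\<close>

lemma xi_R_vanishesI:
  assumes G2: "hom_part 2 G = multiplier P (quad_flux a b c)"
    and G3: "hom_part 3 G = multiplier P (cubic_flux a' b' c' d')" and mc: "mc \<ge> 1"
    and van: "kappa P mc = 0 \<or> a = 2 * c \<and> a' = d'"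
  shows "xi_R_vanishes G mc"
  unfolding xi_R_vanishes_def
proof (intro allI impI)
  fix L lc q
  assume "admissible_at G mc L lc"
  then obtain mL where L: "linear_part L lc mL" and H: "hopf_crossing L lc mc"
    by (auto simp: admissible_at_def)
  have "O2_equivariant (lin_op (L lc))"
    using L eventually_nhds_x_imp_x unfolding linear_part_def by blast
  moreover have "nat (2 * mc) > 0" and n: "int (nat (2 * mc)) = 2 * mc"
    using mc by auto
  ultimately obtain \<alpha> \<beta> \<gamma> \<delta> where M:
    "symbol (L lc) (2 * mc) = vector [vector [of_real \<alpha>, \<i> * of_real \<beta>], vector [\<i> * of_real \<gamma>, of_real \<delta>]]"
    "det_sym (L lc) (2 * mc) = \<alpha> * \<delta> + \<beta> * \<gamma>"
    using symbol_form[of "L lc" "nat (2 * mc)"] unfolding n by blast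
  have "det_sym (L lc) (2 * mc) > 0"
    using H mc by (auto simp: hopf_crossing_def)
  then show "Re (xi G (L lc) mc q) = 0"
    using Re_xi[OF G2 G3 _ M(1) refl _ refl refl, of q] M(2) mc van by auto
qed

lemma lin_op_equivariant:
  assumes "\<And>a k. odd k \<Longrightarrow> coeff (N $ a $ a) k = 0"
    and "\<And>k. even k \<Longrightarrow> coeff (N $ 1 $ 2) k = 0" "\<And>k. even k \<Longrightarrow> coeff (N $ 2 $ 1) k = 0"
  shows "O2_equivariant (lin_op N)"
  unfolding O2_equivariant_def
proof (intro ballI conjI allI)
  fix U assume "U \<in> phase_space"
  then have U: "smooth_fun (\<lambda>y. U y $ b)" for b
    using phase_space_smooth_periodic smooth_periodic_iff by blast
  show "lin_op N (translate s U) = translate s (lin_op N U)" for s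
    using deriv_compose_affine[OF U, where a = 1 and s = s]
    by (simp add: fun_eq_iff vec_eq_iff lin_op_def translate_def)
  have R: "(deriv ^^ k) (\<lambda>y. reflect U y $ b) x
      = (if b = 1 then 1 else -1) * ((-1) ^ k * (deriv ^^ k) (\<lambda>y. U y $ b) (- x))" for k b x
  proof -
    have "smooth_fun (\<lambda>y. U (- y) $ b)"
      using smooth_fun_compose_affine[OF U[of b], of "-1" 0] by simp
    from deriv_scale[OF this] show ?thesis
      unfolding reflect_nth using deriv_compose_affine[OF U[of b], where a = "-1" and s = 0] by simp
  qed
  \<comment> \<open>Every derivative contributes a sign under x -> -x and the second component one
    more; the parity of the coefficients makes the total sign that of row \<open>a\<close>.\<close>
  have s: "coeff (N $ a $ b) k * (deriv ^^ k) (\<lambda>y. reflect U y $ b) x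
      = (if a = 1 then 1 else -1) * (coeff (N $ a $ b) k * (deriv ^^ k) (\<lambda>y. U y $ b) (- x))" for a b k x
    unfolding R using assms exhaust_2[of a] exhaust_2[of b] by (cases "even k") auto
  show "lin_op N (reflect U) = reflect (lin_op N U)"
  proof (intro ext, subst vec_eq_iff, intro allI)
    fix x and a :: 2
    show "lin_op N (reflect U) x $ a = reflect (lin_op N U) x $ a"
      unfolding reflect_nth[of "lin_op N U"]
      unfolding lin_op_def vec_lambda_beta s sum_distrib_left ..
  qed
qed

section \<open>A family of admissible test operators\<close>

lemma coeff_odd_mult:
  fixes p q :: "real poly"
  assumes "\<And>k. odd k \<Longrightarrow> coeff p k = 0" "\<And>k. odd k \<Longrightarrow> coeff q k = 0" "odd k"
  shows "coeff (p * q) k = 0"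
  unfolding coeff_mult
proof (rule sum.neutral, intro ballI)
  fix i assume "i \<in> {..k}"
  then have "odd i \<or> odd (k - i)"
    using assms(3) by auto
  then show "coeff p i * coeff q (k - i) = 0"
    using assms(1,2) by (metis mult_zero_left mult_zero_right)
qed

text \<open>The symbol of the damping is \<open>N (m\<^sub>c\<^sup>2 - m\<^sup>2)\<^sup>2\<^sup>k\<close>: it vanishes exactly at the critical wavenumbers,
  and \<open>k\<close> makes the order as high as \<open>dorder G\<close> requires. The off-diagonal entries \<open>\<partial>\<^sub>x\<close> and \<open>g \<partial>\<^sub>x\<close> keep
  the determinant positive as long as \<open>\<epsilon>\<^sup>2 < g\<close>.\<close>

definition damping :: "nat \<Rightarrow> int \<Rightarrow> real \<Rightarrow> real poly" where
  "damping k mc N = smult N ([:of_int (mc ^ 2), 0, 1:] ^ (2 * k))"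

text \<open>The critical parameter is 0. The shifts by \<epsilon> cancel in the trace and control Im
  (u cnj v), \<open>g\<close> is the ratio of |v|^2 to |u|^2, and \<open>N\<close> changes the
  symbol only away from the critical wavenumbers.\<close>

definition test_family :: "nat \<Rightarrow> int \<Rightarrow> real \<Rightarrow> real \<Rightarrow> real \<Rightarrow> lin_family" where
  "test_family k mc N \<epsilon> g l = vector [vector [[:l + \<epsilon>:] - damping k mc N, [:0, 1:]],
     vector [[:0, g:], [:l - \<epsilon>:] - damping k mc N]]"

definition damping_symbol :: "nat \<Rightarrow> int \<Rightarrow> real \<Rightarrow> int \<Rightarrow> real" where
  "damping_symbol k mc N m = N * (of_int (mc ^ 2 - m ^ 2)) ^ (2 * k)"

lemma eval_damping: "eval_of_real (damping k mc N) (\<i> * of_int m) = of_real (damping_symbol k mc N m)"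
  by (simp add: damping_def damping_symbol_def eval_of_real_smult eval_of_real_power eval_of_real_pCons
      eval_of_real_zero algebra_simps flip: power2_eq_square)

lemma test_family_nth:
  "test_family k mc N \<epsilon> g l $ 1 $ 1 = [:l + \<epsilon>:] - damping k mc N"
  "test_family k mc N \<epsilon> g l $ 1 $ 2 = [:0, 1:]"
  "test_family k mc N \<epsilon> g l $ 2 $ 1 = [:0, g:]"
  "test_family k mc N \<epsilon> g l $ 2 $ 2 = [:l - \<epsilon>:] - damping k mc N"
  by (simp_all add: test_family_def)

lemma symbol_test_family:
  "symbol (test_family k mc N \<epsilon> g l) m
    = vector [vector [of_real (l + \<epsilon> - damping_symbol k mc N m), \<i> * of_real (of_int m)],
        vector [\<i> * of_real (g * of_int m), of_real (l - \<epsilon> - damping_symbol k mc N m)]]"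
  by (simp add: vec_eq_iff forall_2 symbol_nth test_family_nth eval_of_real_diff eval_damping
      eval_of_real_pCons eval_of_real_zero)

lemma tr_test_family: "tr_sym (test_family k mc N \<epsilon> g l) m = 2 * l - 2 * damping_symbol k mc N m"
  by (simp add: tr_sym_def trace_def sum_2 symbol_test_family)

lemma det_test_family:
  "det_sym (test_family k mc N \<epsilon> g 0) m = damping_symbol k mc N m ^ 2 - \<epsilon> ^ 2 + g * of_int m ^ 2"
  by (simp add: det_sym_def det_2 symbol_test_family power2_eq_square algebra_simps)

lemma degree_damping: "N \<noteq> 0 \<Longrightarrow> degree (damping k mc N) = 4 * k"
  by (simp add: damping_def degree_power_eq)

lemma coeff_damping_top: "coeff (damping k mc N) (4 * k) = N"
  using lead_coeff_power[of "[:of_int (mc ^ 2), 0, 1:] :: real poly" "2 * k"]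
  by (simp add: damping_def degree_power_eq)

lemma coeff_damping_odd: "odd j \<Longrightarrow> coeff (damping k mc N) j = 0"
proof -
  have base: "coeff [:of_int (mc ^ 2), 0, 1:: real:] j = 0" if "odd j" for j
  proof -
    from that obtain i where "j = Suc (2 * i)" by (metis oddE Suc_eq_plus1)
    then show ?thesis
      by (cases i) (auto simp: coeff_pCons split: nat.splits)
  qed
  have "coeff ([:of_int (mc ^ 2), 0, 1:: real:] ^ n) j = 0" if "odd j" for n j
    using that
  proof (induction n arbitrary: j)
    case 0
    then show ?case by (auto simp: coeff_1 elim: oddE)
  next
    case (Suc n)
    then show ?case
      using coeff_odd_mult[OF base] by simp
  qed
  then show "odd j \<Longrightarrow> coeff (damping k mc N) j = 0"
    by (simp add: damping_def)
qed

text \<open>The parameter enters only the constant diagonal coefficients, and affinely, which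
  settles smoothness and the order of the parameter dependence.\<close>

lemma coeff_test_family_affine:
  "\<exists>A. \<forall>l. coeff (test_family k mc N \<epsilon> g l $ a $ b) j = A + (if a = b \<and> j = 0 then 1 else 0) * l"
  using exhaust_2[of a] exhaust_2[of b]
  by (intro exI[of _ "coeff (test_family k mc N \<epsilon> g 0 $ a $ b) j"])
    (auto simp: test_family_nth coeff_pCons split: nat.splits)

lemma deriv_affine: "deriv (\<lambda>l. A + B * l) = (\<lambda>l::real. B)"
  by (intro ext DERIV_imp_deriv) (auto intro!: derivative_eq_intros)

lemma smooth_fun_affine_map: "smooth_fun (\<lambda>l. A + B * l)"
proof -
  have "smooth_fun (\<lambda>x. x)"
    using smooth_fun_chain[of "\<lambda>n x. if n = 0 then x else if n = 1 then 1 else (0 :: real)"]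
    by (auto intro!: derivative_eq_intros)
  moreover have "smooth_fun (\<lambda>x. A)"
    using smooth_fun_chain[of "\<lambda>n x. if n = 0 then A else 0"] by auto
  ultimately show ?thesis
    by (intro smooth_fun_add_scale)
qed

lemma test_family_linear_part:
  assumes k: "k > 0" and N: "N \<noteq> 0"
  shows "linear_part (test_family k mc N \<epsilon> g) 0 (2 * k)"
proof -
  let ?L = "test_family k mc N \<epsilon> g"
  have deg: "degree ([:c:] - damping k mc N) = 4 * k" for c
    using k N degree_damping[OF N, of k mc] by (subst diff_conv_add_uminus, subst degree_add_eq_right) auto
  have top: "coeff ([:c:] - damping k mc N) (4 * k) = - N" for c
    using k by (simp add: coeff_damping_top coeff_pCons split: nat.splits)
  have "degree (?L l $ a $ b) \<le> 4 * k" for l a b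
    using exhaust_2[of a] exhaust_2[of b] k deg by (auto simp: test_family_nth)
  \<comment> \<open>The first diagonal entry at the critical parameter has degree exactly 4k, so no
    smaller order is possible.\<close>
  moreover have "2 * k \<le> m" if "order_le_near ?L 0 m" for m
  proof -
    have "degree (?L 0 $ 1 $ 1) \<le> 2 * m"
      using that eventually_nhds_x_imp_x unfolding order_le_near_def by blast
    then show ?thesis
      unfolding test_family_nth deg by simp
  qed
  ultimately have "half_order ?L 0 (2 * k)"
    using k by (auto simp: half_order_def order_le_near_def)
  moreover have "(deriv ^^ n) (\<lambda>l. coeff (?L l $ a $ b) j) differentiable (at l)" for a b j n l
  proof -
    obtain A where "\<And>l. coeff (?L l $ a $ b) j = A + (if a = b \<and> j = 0 then 1 else 0) * l"
      using coeff_test_family_affine by blast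
    then show ?thesis
      using smooth_fun_affine_map[of A "if a = b \<and> j = 0 then 1 else 0"] by (simp only: smooth_fun_def)
  qed
  moreover have "O2_equivariant (lin_op (?L l))" for l
  proof (rule lin_op_equivariant)
    show "coeff (?L l $ a $ a) j = 0" if "odd j" for a j
      using that exhaust_2[of a] by (auto simp: test_family_nth coeff_damping_odd coeff_pCons split:
          nat.splits)
  qed (auto simp: test_family_nth coeff_pCons split: nat.splits)
  moreover have "param_order ?L 0 \<le> 2 * (2 * k) - 1"
  proof -
    have "j = 0" if "\<not> (\<forall>\<^sub>F l in nhds 0. deriv (\<lambda>l. coeff (?L l $ a $ b) j) l = 0)" for a b j
    proof (rule ccontr)
      assume "j \<noteq> 0"
      then obtain A where "\<And>l. coeff (?L l $ a $ b) j = A + 0 * l"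
        using coeff_test_family_affine[of k mc N \<epsilon> g a b j] by auto
      then show False
        using that by (simp only: deriv_affine) simp
    qed
    then have 0: "insert 0 {j. \<exists>a b. \<not> (\<forall>\<^sub>F l in nhds 0. deriv (\<lambda>l. coeff (?L l $ a $ b) j) l = 0)} = {0}"
      by blast
    then show ?thesis
      unfolding param_order_def 0 by simp
  qed
  moreover have "coeff (?L l $ 1 $ 1) (2 * (2 * k)) * coeff (?L l $ 2 $ 2) (2 * (2 * k)) \<noteq> 0 \<and>
      coeff (?L l $ 1 $ 2) (2 * (2 * k)) = 0 \<and> coeff (?L l $ 2 $ 1) (2 * (2 * k)) = 0" for l
    using k N top by (auto simp: test_family_nth coeff_pCons split: nat.splits)
  ultimately show ?thesis
    unfolding linear_part_def by simp
qed

lemma damping_symbol_pos: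
  assumes "N > 0" "m \<noteq> mc" "m \<noteq> - mc"
  shows "damping_symbol k mc N m > 0"
proof -
  have "(mc - m) * (mc + m) \<noteq> 0"
    using assms by auto
  then have "mc ^ 2 - m ^ 2 \<noteq> 0"
    by (simp add: power2_eq_square algebra_simps)
  then have "(of_int (mc ^ 2 - m ^ 2) :: real) \<noteq> 0"
    by (simp only: of_int_eq_0_iff not_False_eq_True)
  then have "(of_int (mc ^ 2 - m ^ 2) :: real) ^ 2 > 0"
    by (simp only: zero_less_power2 not_False_eq_True)
  then have "(of_int (mc ^ 2 - m ^ 2) :: real) ^ (2 * k) > 0"
    unfolding power_mult by (rule zero_less_power)
  then show ?thesis
    using assms(1) by (simp add: damping_symbol_def)
qed

text \<open>mc^2 - m^2 is a nonzero integer, so its even powers are at least 1. This uniform bound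
  serves the liminf condition.\<close>

lemma damping_symbol_ge:
  assumes "N \<ge> 1" "\<bar>m\<bar> > \<bar>mc\<bar>"
  shows "damping_symbol k mc N m \<ge> 1"
proof -
  have "mc ^ 2 < m ^ 2"
    using assms(2) by (simp add: abs_le_square_iff not_le[symmetric])
  then have "(mc ^ 2 - m ^ 2) ^ 2 \<ge> 1"
    by (simp add: int_one_le_iff_zero_less)
  then have "(of_int (mc ^ 2 - m ^ 2) :: real) ^ 2 \<ge> 1"
    by (metis of_int_1_le_iff of_int_power)
  then have "(of_int (mc ^ 2 - m ^ 2) :: real) ^ (2 * k) \<ge> 1"
    unfolding power_mult by (rule one_le_power)
  from mult_mono[OF assms(1) this] assms(1) show ?thesis
    by (simp add: damping_symbol_def)
qed

lemma test_family_hopf: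
  assumes k: "k > 0" and N: "N \<ge> 1" and g: "\<epsilon> ^ 2 < g" and mc: "mc \<ge> 1"
  shows "hopf_crossing (test_family k mc N \<epsilon> g) 0 mc"
proof -
  let ?D = "damping_symbol k mc N" and ?L = "test_family k mc N \<epsilon> g"
  have g0: "g \<ge> 0"
    using g zero_le_power2[of \<epsilon>] by linarith
  have gm: "g * of_int m ^ 2 \<ge> g" if "m \<noteq> 0" for m :: int
  proof -
    have "m ^ 2 \<ge> 1"
      using that by (simp add: int_one_le_iff_zero_less)
    then have "of_int m ^ 2 \<ge> (1 :: real)"
      by (metis of_int_1_le_iff of_int_power)
    then show ?thesis
      using mult_left_mono[OF _ g0, of 1 "of_int m ^ 2"] by simp
  qed
  have "?D mc = 0"
    using k by (simp add: damping_symbol_def)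
  then have "tr_sym (?L 0) mc = 0"
    by (simp add: tr_test_family)
  \<comment> \<open>The diagonal shifts lower the determinant by \<epsilon>^2, which is outweighed
    by g m^2.\<close>
  moreover have det: "det_sym (?L 0) m > ?D m ^ 2" if "m \<noteq> 0" for m
    using gm[OF that] g by (simp add: det_test_family)
  moreover have "det_sym (?L 0) m > 0" if "m \<noteq> 0" for m
    using det[OF that] zero_le_power2[of "?D m"] by linarith
  moreover have "deriv (\<lambda>l. tr_sym (?L l) mc) 0 \<noteq> 0"
    unfolding tr_test_family using deriv_affine[of "- 2 * ?D mc" 2] by (simp add: algebra_simps)
  moreover have "tr_sym (?L 0) m < 0" if "m \<notin> {0, mc, - mc}" for m
    using damping_symbol_pos[of N m mc k] N that by (simp add: tr_test_family)
  moreover have "Liminf (filtercomap (\<lambda>m::int. \<bar>m\<bar>) at_top)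
       (\<lambda>m. ereal (det_sym (?L 0) m / \<bar>tr_sym (?L 0) m\<bar>)) > 0"
  proof -
    \<comment> \<open>Writing D for the damping symbol, the trace has modulus 2 D and the
      determinant exceeds D^2, which is at least D; hence the bound 1/2.\<close>
    have "1 / 2 \<le> det_sym (?L 0) m / \<bar>tr_sym (?L 0) m\<bar>" if "\<bar>m\<bar> \<ge> mc + 1" for m
    proof -
      have D: "?D m \<ge> 1"
        using that mc N by (intro damping_symbol_ge) auto
      have "?D m \<le> ?D m ^ 2"
        using mult_left_mono[OF D, of "?D m"] D by (simp add: power2_eq_square)
      moreover have "?D m ^ 2 < det_sym (?L 0) m"
        using that mc by (intro det) auto
      ultimately show ?thesis
        using D by (simp add: tr_test_family field_simps)
    qed
    then have "\<forall>\<^sub>F m in filtercomap (\<lambda>m::int. \<bar>m\<bar>) at_top.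
        ereal (1 / 2) \<le> ereal (det_sym (?L 0) m / \<bar>tr_sym (?L 0) m\<bar>)"
      unfolding eventually_filtercomap_at_top_linorder by auto
    from Liminf_bounded[OF this] show ?thesis
      by (rule less_le_trans[rotated]) simp
  qed
  ultimately show ?thesis
    unfolding hopf_crossing_def by blast
qed

text \<open>This is \<open>Re_xi\<close> on the test family, with denominators and the common factor
  -2 mc^2 \<omega> removed. It turns \<open>xi_R_vanishes\<close> into a polynomial relation in
  \<epsilon>, \<open>g\<close> and \<open>W\<close>, whose specializations determine the flux
  coefficients.\<close>

lemma test_family_relation:
  assumes G: "nonlinearity G" and van: "xi_R_vanishes G mc" and mc: "mc \<ge> 1"
    and G2: "hom_part 2 G = multiplier P (quad_flux a b c)"
    and G3: "hom_part 3 G = multiplier P (cubic_flux a' b' c' d')"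
    and P: "kappa P mc \<noteq> 0" and N: "N \<ge> 1" and g: "\<epsilon> ^ 2 < g"
    and k: "k = dorder G + 1" and W: "W = damping_symbol k mc N (2 * mc)"
  shows "(W ^ 2 - \<epsilon> ^ 2 + 4 * g * of_int mc ^ 2) * (2 * \<epsilon> * (a' - d'))
    = kappa P (2 * mc) * of_int mc * (a - 2 * c) * (2 * g * a * \<epsilon> + (W - \<epsilon>) * (c * g - b))"
proof -
  let ?L = "test_family k mc N \<epsilon> g" and ?m = "of_int mc :: real"
  define \<omega> where "\<omega> = sqrt (g * ?m ^ 2 - \<epsilon> ^ 2)"
  have m1: "?m \<ge> 1"
    using mc by simp
  have "g \<ge> 0"
    using g zero_le_power2[of \<epsilon>] by linarith
  then have "1 * g \<le> ?m ^ 2 * g"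
    using m1 by (intro mult_right_mono one_le_power)
  then have gm: "\<epsilon> ^ 2 < g * ?m ^ 2"
    using g by (simp add: mult.commute)
  then have \<omega>: "\<omega> > 0" "\<omega> ^ 2 = g * ?m ^ 2 - \<epsilon> ^ 2"
    by (simp_all add: \<omega>_def)
  have D0: "damping_symbol k mc N mc = 0"
    using k by (simp add: damping_symbol_def)
  have om: "omega_c (?L 0) mc = \<omega>"
    by (simp add: omega_c_def det_test_family D0 \<omega>_def algebra_simps)
  \<comment> \<open>The damping vanishes at the critical wavenumber m, and the row \<epsilon> u + i
    m v = i \<omega> u with u = m gives v = \<omega> + i \<epsilon>. Hence r = m \<omega>, J = - m
    \<epsilon> and |v|^2 = g m^2.\<close>
  define q :: "complex^2" where "q = vector [of_real ?m, Complex \<omega> \<epsilon>]"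
  \<comment> \<open>The family has order 4k, and by the choice of \<open>k\<close> the bound
    \<open>2 * (2 * k) - 1\<close> is at least \<open>dorder G\<close>.\<close>
  have "admissible_at G mc ?L 0"
    unfolding admissible_at_def
    using G test_family_linear_part[of k N mc \<epsilon> g] test_family_hopf[of k N \<epsilon> g mc] k N g mc by fastforce
  moreover have "critical_eigenvector (?L 0) mc q"
  proof -
    have "symbol (?L 0) mc *v q = (\<i> * of_real \<omega>) *s q"
      using \<omega>(2) by (simp add: symbol_test_family D0 q_def vec_eq_iff forall_2 matrix_vector_mult_def sum_2
        complex_eq_iff power2_eq_square algebra_simps)
    moreover have "q $ 1 \<noteq> 0"
      using mc by (simp add: q_def)
    then have "q \<noteq> 0" by auto
    ultimately show ?thesis
      by (simp add: critical_eigenvector_def om)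
  qed
  ultimately have xi0: "Re (xi G (?L 0) mc q) = 0"
    using van by (simp add: xi_R_vanishes_def)
  define \<Delta> where "\<Delta> = W ^ 2 - \<epsilon> ^ 2 + 4 * g * ?m ^ 2"
  have "\<Delta> > 0"
    using gm g zero_le_power2[of W] zero_le_power2[of \<epsilon>] unfolding \<Delta>_def by linarith
  define E where "E = ?m ^ 2 * (c * g - b)"
  have r: "r_c q = ?m * \<omega>"
    by (simp add: r_c_def q_def)
  have "0 \<le> g * ?m ^ 2"
    using gm zero_le_power2[of \<epsilon>] by linarith
  then have "c * cmod (q $ 2) ^ 2 - b * cmod (q $ 1) ^ 2 = E"
    using \<omega>(2) by (simp add: q_def cmod_def E_def algebra_simps)
  moreover have "Im (q $ 1 * cnj (q $ 2)) = - ?m * \<epsilon>"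
    by (simp add: q_def)
  moreover have "Im ((q $ 1 * cnj (q $ 2)) ^ 2) = - 2 * ?m ^ 2 * \<omega> * \<epsilon>"
    by (simp add: q_def power2_eq_square)
  moreover have "\<Delta> = (\<epsilon> - W) * (- \<epsilon> - W) + 2 * ?m * (2 * g * ?m)"
    by (simp add: \<Delta>_def power2_eq_square algebra_simps)
  moreover have "symbol (?L 0) (2 * mc) = vector [vector [of_real (\<epsilon> - W), \<i> * of_real (2 * ?m)],
      vector [\<i> * of_real (2 * g * ?m), of_real (- \<epsilon> - W)]]"
    by (simp add: symbol_test_family W mult_ac)
  ultimately have "Re (xi G (?L 0) mc q) = kappa P mc / (2 * (?m * \<omega>)) *
    (2 * (a' - d') * (- 2 * ?m ^ 2 * \<omega> * \<epsilon>)
      - 2 * kappa P (2 * mc) / \<Delta> * (2 * g * ?m * a * (- ?m * \<epsilon>) + (\<epsilon> - W) * E) * (a - 2 * c) * (?m * \<omega>))"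
    using Re_xi[OF G2 G3, of mc "?L 0" "\<epsilon> - W" "2 * ?m" "2 * g * ?m" "- \<epsilon> - W" \<Delta> "- ?m * \<epsilon>" q E] mc \<open>\<Delta> > 0\<close>
    by (simp add: r)
  then have "2 * (a' - d') * (- 2 * ?m ^ 2 * \<omega> * \<epsilon>)
      = 2 * kappa P (2 * mc) / \<Delta> * (2 * g * ?m * a * (- ?m * \<epsilon>) + (\<epsilon> - W) * E) * (a - 2 * c) * (?m * \<omega>)"
    using xi0 P m1 \<omega>(1) by auto
  then have "\<Delta> * (2 * (a' - d') * (- 2 * ?m ^ 2 * \<omega> * \<epsilon>))
      = 2 * kappa P (2 * mc) * (2 * g * ?m * a * (- ?m * \<epsilon>) + (\<epsilon> - W) * E) * (a - 2 * c) * (?m * \<omega>)"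
    using \<open>\<Delta> > 0\<close> by (simp add: field_simps)
  then have "(- 2 * ?m ^ 2 * \<omega>) * (\<Delta> * (2 * \<epsilon> * (a' - d')))
      = (- 2 * ?m ^ 2 * \<omega>) * (kappa P (2 * mc) * ?m * (a - 2 * c) * (2 * g * a * \<epsilon>
          + (W - \<epsilon>) * (c * g - b)))"
    unfolding E_def by (simp add: power2_eq_square algebra_simps)
  then show ?thesis
    using m1 \<omega>(1) by (simp add: \<Delta>_def mult_ac)
qed

lemma xi_R_vanishesD:
  assumes G: "nonlinearity G" and van: "xi_R_vanishes G mc" and mc: "mc \<ge> 1"
    and G2: "hom_part 2 G = multiplier P (quad_flux a b c)"
    and G3: "hom_part 3 G = multiplier P (cubic_flux a' b' c' d')"
    and P: "kappa P mc \<noteq> 0" "kappa P (2 * mc) \<noteq> 0"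
  shows "a = 2 * c \<and> a' = d'"
proof -
  define k where "k = dorder G + 1"
  define W where "W = damping_symbol k mc 1 (2 * mc)"
  let ?m = "of_int mc :: real" and ?\<kappa> = "kappa P (2 * mc)"
  note rel = test_family_relation[OF G van mc G2 G3 P(1) _ _ k_def refl]
  have W2: "damping_symbol k mc 2 (2 * mc) = 2 * W"
    by (simp add: W_def damping_symbol_def)
  have W0: "W > 0"
    unfolding W_def using mc by (intro damping_symbol_pos) auto
  have m1: "?m \<ge> 1"
    using mc by simp
  \<comment> \<open>\<epsilon> = 0 removes both the cubic term and J. The values 1 and 2 of
    \<open>g\<close> then produce the factors c - b and 2c - b, which both vanish unless a =
    2c.\<close>
  have "?\<kappa> * ?m * (a - 2 * c) * (W * (c - b)) = 0" "?\<kappa> * ?m * (a - 2 * c) * (W * (c * 2 - b)) = 0"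
    using rel[of 1 0 1] rel[of 1 0 2] by (simp_all add: W_def)
  then have zero: "a = 2 * c \<or> b = 0 \<and> c = 0"
    using P(2) m1 W0 by auto
  \<comment> \<open>Now \<epsilon> = 1 and g = 2, respecting \<epsilon>^2 < g. The relation after
    this one takes N = 2, which doubles \<open>W\<close> and changes nothing else.\<close>
  have 1: "(W ^ 2 - 1 + 8 * ?m ^ 2) * (2 * (a' - d')) = ?\<kappa> * ?m * (a - 2 * c) * (4 * a
      + (W - 1) * (c * 2 - b))"
    using rel[of 1 1 2] by (simp add: W_def)
  have 2: "(4 * W ^ 2 - 1 + 8 * ?m ^ 2) * (2 * (a' - d')) = ?\<kappa> * ?m * (a - 2 * c) * (4 * a
      + (2 * W - 1) * (c * 2 - b))"
    using rel[of 2 1 2] by (simp add: W2 power_mult_distrib)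
  have "?m ^ 2 \<ge> 1"
    using m1 by (rule one_le_power)
  then have pos: "W ^ 2 - 1 + 8 * ?m ^ 2 > 0"
    using zero_le_power2[of W] by linarith
  show ?thesis
  proof (cases "a = 2 * c")
    case True
    then show ?thesis
      using 1 pos by simp
  next
    case False
    then have bc: "b = 0" "c = 0"
      using zero by auto
    \<comment> \<open>For b = c = 0 the two right-hand sides agree, so the difference 6 W^2 (a' -
      d') of the left-hand sides vanishes.\<close>
    have "(4 * W ^ 2 - 1 + 8 * ?m ^ 2) * (2 * (a' - d')) - (W ^ 2 - 1 + 8 * ?m ^ 2) * (2 * (a' - d')) = 0"
      unfolding 1 2 bc by simp
    then have "W ^ 2 * (a' - d') = 0"
      by (simp add: algebra_simps)
    then have "a' = d'"
      using W0 by simp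
    \<comment> \<open>With a' = d' the first relation becomes 4 \<kappa> m a^2 = 0, against a being
      different from 2c = 0.\<close>
    with 1 bc False P(2) m1 show ?thesis
      by simp
  qed
qed

lemma kappa_nonzero:
  assumes "mc \<ge> 1" "poly P (of_int (mc ^ 2)) * poly P (of_int (4 * mc ^ 2)) \<noteq> 0"
  shows "kappa P mc \<noteq> 0" "kappa P (2 * mc) \<noteq> 0"
  using assms by (auto simp: kappa_def power_mult_distrib)

section \<open>The resonant counterexample\<close>

lemma dop_translate: "U \<in> smooth_periodic \<Longrightarrow> dop G (translate s U) = translate s (dop G U)"
  by (simp add: dop_def jet_translate) (simp add: translate_def)

text \<open>The multiplier contains only odd orders of differentiation and so reverses parity under
  reflection: a flux of the opposite parity yields an equivariant nonlinearity.\<close>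

lemma multiplier_equivariant:
  assumes "\<And>U x a. U \<in> smooth_periodic \<Longrightarrow>
      dop F (reflect U) x $ a = - (if a = 1 then 1 else -1) * dop F U (- x) $ a"
  shows "O2_equivariant (dop (multiplier P F))"
  unfolding O2_equivariant_def
proof (intro ballI conjI allI)
  fix U assume "U \<in> phase_space"
  then have U: "U \<in> smooth_periodic"
    by (rule phase_space_smooth_periodic)
  then show "dop (multiplier P F) (translate s U) = translate s (dop (multiplier P F) U)" for s
    by (rule dop_translate)
  show "dop (multiplier P F) (reflect U) = reflect (dop (multiplier P F) U)"
  proof (intro ext, subst vec_eq_iff, intro allI)
    fix x and a :: 2
    let ?s = "if a = 1 then 1 else -1 :: real"
    have sm: "smooth_fun (\<lambda>x. dop F U x $ a)"
      using smooth_fun_deval_jet[OF U] by (simp add: dop_def)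
    have "smooth_fun (\<lambda>x. dop F U (- x) $ a)"
      using smooth_fun_compose_affine[OF sm, of "-1" 0] by simp
    then have "(deriv ^^ n) (\<lambda>x. dop F (reflect U) x $ a) x
        = - ?s * ((- 1) ^ n * (deriv ^^ n) (\<lambda>x. dop F U x $ a) (- x))" for n
      unfolding assms[OF U] using deriv_compose_affine[OF sm, of n "-1" 0] by (subst deriv_scale) simp_all
    then have "coeff P k * (- 1) ^ k * (deriv ^^ Suc (2 * k)) (\<lambda>x. dop F (reflect U) x $ a) x
        = ?s * (coeff P k * (- 1) ^ k * (deriv ^^ Suc (2 * k)) (\<lambda>x. dop F U x $ a) (- x))" for k
      by (simp del: funpow.simps)
    then show "dop (multiplier P F) (reflect U) x $ a = reflect (dop (multiplier P F) U) x $ a"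
      unfolding reflect_nth dop_multiplier[OF U] dop_multiplier[OF reflect_smooth_periodic[OF U]]
      by (simp only: sum_distrib_left)
  qed
qed

lemma deval_at_zero:
  assumes "homogeneous (Suc j) p"
  shows "deval id (\<lambda>_. 0) p = 0"
  unfolding deval_def
proof (rule sum.neutral, intro ballI)
  fix m assume "m \<in> Poly_Mapping.keys p"
  then have "mdeg m = Suc j"
    using assms by (simp add: homogeneous_def)
  then obtain i where "i \<in> Poly_Mapping.keys m"
    by (metis mdeg_def sum.empty nat.distinct(1) ex_in_conv)
  then have "(\<Prod>i\<in>Poly_Mapping.keys m. (0::real) ^ Poly_Mapping.lookup m i) = 0"
    by (intro prod_zero bexI[of _ i]) (auto simp: in_keys_iff)
  then show "id (Poly_Mapping.lookup p m) * (\<Prod>i\<in>Poly_Mapping.keys m. 0 ^ Poly_Mapping.lookup m i) = 0"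
    by simp
qed

lemma multiplier_nonlinearity:
  assumes hom: "\<And>a. homogeneous 2 (F $ a)" and "O2_equivariant (dop (multiplier P F))"
  shows "nonlinearity (multiplier P F)"
proof -
  have h: "homogeneous (Suc (Suc 0)) (multiplier P F $ a)" for a
    using homogeneous_multiplier[of 1 F P a] hom by (simp add: numeral_2_eq_2)
  have "dlin id (\<lambda>_. 0) h (multiplier P F $ a) = 0" for a h
    unfolding dlin_def using deval_at_zero[OF homogeneous_dpderiv[OF \<open>homogeneous (Suc (Suc 0))
        (multiplier P F $ a)\<close>]]
    by simp
  moreover have "\<exists>f :: dpoly^2. multiplier P F = (\<chi> a. Dx (f $ a))"
    by (rule exI[of _ "\<chi> a. \<Sum>k\<le>degree P. dconst (coeff P k * (-1) ^ k) * (Dx ^^ (2 * k)) (F $ a)"])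
      (simp add: multiplier_def)
  ultimately show ?thesis
    using assms(2) deval_at_zero[OF h] by (simp add: nonlinearity_def)
qed

lemma dvars_dmono: "dvars (dmono r i k) \<subseteq> UNIV \<times> {0}"
proof -
  have "dvars (dvar (b, 0) ^ n) \<subseteq> UNIV \<times> {0}" for b n
  proof (induction n)
    case 0
    show ?case by (simp add: dvars_def)
  next
    case (Suc n)
    then show ?case
      using dvars_mult[of "dvar (b, 0)" "dvar (b, 0) ^ n"] by auto
  qed
  then show ?thesis
    unfolding dmono_def using dvars_mult dvars_dconst by (smt (verit) Un_least empty_subsetI order_trans)
qed

lemma derivative_free_quad_flux: "derivative_free P 2 (multiplier P (quad_flux a b c))"
proof -
  have "dvars (quad_flux a b c $ i) \<subseteq> UNIV \<times> {0}" for i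
    using exhaust_2[of i] dvars_dmono dvars_add by (auto simp: quad_flux_def) blast+
  then show ?thesis
    unfolding derivative_free_def is_flux_def
    by (intro exI[of _ "quad_flux a b c"] conjI allI homogeneous_quad_flux refl)
qed

lemma quad_flux_reflect:
  "dop (quad_flux a b c) (reflect U) x $ i = - (if i
      = 1 then 1 else -1) * dop (quad_flux a b c) U (- x) $ i"
  using exhaust_2[of i] by (auto simp: dop_quad_flux reflect_nth)

lemma multiplier_zero: "multiplier P 0 = 0"
proof -
  have "(Dx ^^ n) 0 = 0" for n
    by (induction n) auto
  then show ?thesis
    by (simp add: multiplier_def vec_eq_iff)
qed

lemma cubic_flux_zero: "cubic_flux 0 0 0 0 = 0"
  by (simp add: cubic_flux_def vec_eq_iff forall_2)

text \<open>The flux (u v, 0) has a = 1 and c = 0, so it is not variational, whereas P(mc^2) = 0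
  makes \<open>kappa P mc\<close>, and with it the real part of xi, vanish for every admissible
  family.\<close>

lemma resonant_counterexample:
  fixes P :: "real poly" and G :: "dpoly^2"
  assumes P: "P \<noteq> 0" and mc: "mc \<ge> 1" "poly P (of_int (mc ^ 2)) = 0" and G: "G
      = multiplier P (quad_flux 1 0 0)"
  shows "nonlinearity G" "derivative_free P 2 (hom_part 2 G)" "derivative_free P 3 (hom_part 3 G)"
    "xi_R_vanishes G mc" "\<not> variational P 2 (hom_part 2 G)"
proof -
  have "homogeneous 2 (G $ a)" for a
    using homogeneous_multiplier[of 1 "quad_flux 1 0 0" P a] homogeneous_quad_flux
    by (simp add: G numeral_2_eq_2)
  then have G2: "hom_part 2 G = multiplier P (quad_flux 1 0 0)" and G3: "hom_part 3 G = 0"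
    using hom_part_homogeneous[of 2 G] by (simp_all add: G)
  show "nonlinearity G"
    unfolding G
    by (intro multiplier_nonlinearity multiplier_equivariant quad_flux_reflect homogeneous_quad_flux)
  show "derivative_free P 2 (hom_part 2 G)"
    unfolding G2 by (rule derivative_free_quad_flux)
  show "derivative_free P 3 (hom_part 3 G)"
    unfolding G3 derivative_free_def is_flux_def
    by (rule exI[of _ 0]) (simp add: multiplier_zero dvars_def)
  show "xi_R_vanishes G mc"
    by (rule xi_R_vanishesI[OF G2, of 0 0 0 0])
      (use mc in \<open>auto simp: G3 cubic_flux_zero multiplier_zero kappa_def\<close>)
  show "\<not> variational P 2 (hom_part 2 G)"
    using variational_quad_imp[OF _ P, of 1 0 0] by (auto simp: G2)
qed

section \<open>The equivalence and its failure at resonance\<close>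

theorem theorem3p2:
  shows "(\<forall>(G :: dpoly^2) (P :: real poly) (mc :: int).
            nonlinearity G \<longrightarrow> P \<noteq> 0 \<longrightarrow>
            derivative_free P 2 (hom_part 2 G) \<longrightarrow> derivative_free P 3 (hom_part 3 G) \<longrightarrow>
            mc \<ge> 1 \<longrightarrow> poly P (of_int (mc^2)) * poly P (of_int (4 * mc^2)) \<noteq> 0 \<longrightarrow>
            (variational P 2 (hom_part 2 G) \<and> variational P 3 (hom_part 3 G)
               \<longleftrightarrow> xi_R_vanishes G mc))
       \<and> (\<exists>(G :: dpoly^2) (P :: real poly) (mc :: int).
            nonlinearity G \<and> P \<noteq> 0 \<and>
            derivative_free P 2 (hom_part 2 G) \<and> derivative_free P 3 (hom_part 3 G) \<and>
            mc \<ge> 1 \<and> poly P (of_int (mc^2)) * poly P (of_int (4 * mc^2)) = 0 \<and>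
            xi_R_vanishes G mc \<and>
            \<not> (variational P 2 (hom_part 2 G) \<and> variational P 3 (hom_part 3 G)))"
proof (intro conjI allI impI)
  fix G :: "dpoly^2" and P :: "real poly" and mc :: int
  assume G: "nonlinearity G" and P: "P \<noteq> 0" and df: "derivative_free P 2 (hom_part 2 G)" "derivative_free P 3 (hom_part 3 G)"
    and mc: "mc \<ge> 1" and nr: "poly P (of_int (mc^2)) * poly P (of_int (4 * mc^2)) \<noteq> 0"
  obtain a b c where G2: "hom_part 2 G = multiplier P (quad_flux a b c)"
    using quadratic_flux_form[OF G P df(1)] .
  obtain a' b' c' d' where G3: "hom_part 3 G = multiplier P (cubic_flux a' b' c' d')"
    using cubic_flux_form[OF G P df(2)] .
  have "variational P 2 (hom_part 2 G) \<longleftrightarrow> a = 2 * c"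
    unfolding G2 by (rule iffI[OF variational_quad_imp[OF _ P] variational_quad])
  moreover have "variational P 3 (hom_part 3 G) \<longleftrightarrow> a' = d'"
    unfolding G3 by (rule iffI[OF variational_cubic_imp[OF _ P] variational_cubic])
  ultimately have "variational P 2 (hom_part 2 G) \<and> variational P 3 (hom_part 3 G) \<longleftrightarrow> a = 2 * c \<and> a' = d'"
    by (simp only:)
  also have "\<dots> \<longleftrightarrow> xi_R_vanishes G mc"
    using xi_R_vanishesI[OF G2 G3 mc] xi_R_vanishesD[OF G _ mc G2 G3 kappa_nonzero[OF mc nr]] by blast
  finally show "variational P 2 (hom_part 2 G) \<and> variational P 3 (hom_part 3 G) \<longleftrightarrow> xi_R_vanishes G mc" .
next
  \<comment> \<open>With this P the operator P(-d^2/dx^2) = -1 - d^2/dx^2 annihilates the wavenumber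
    1, taken as critical.\<close>
  let ?P = "[:-1, 1:] :: real poly"
  have P: "?P \<noteq> 0" "poly ?P (of_int (1 ^ 2)) = 0"
    by simp_all
  from resonant_counterexample[OF P(1) order_refl P(2) refl]
  show "\<exists>(G :: dpoly^2) (P :: real poly) (mc :: int).
            nonlinearity G \<and> P \<noteq> 0 \<and>
            derivative_free P 2 (hom_part 2 G) \<and> derivative_free P 3 (hom_part 3 G) \<and>
            mc \<ge> 1 \<and> poly P (of_int (mc^2)) * poly P (of_int (4 * mc^2)) = 0 \<and>
            xi_R_vanishes G mc \<and>
            \<not> (variational P 2 (hom_part 2 G) \<and> variational P 3 (hom_part 3 G))"
    using P by (intro exI[of _ "multiplier ?P (quad_flux 1 0 0)"] exI[of _ ?P] exI[of _ 1]) auto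
qed

end
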